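(* Let $F$ be a compactly supported distribution on $\mathbb{C}^d$. Consider the infinite matrix $\mathbf{A}_F=(a_{\alpha\beta})_{\alpha,\beta\in\mathbb{Z}_+^d}$ with $a_{\alpha\beta}=\langle F,Z^\alpha\bar Z^\beta\rangle$, $Z=(z_1,\dots,z_d)$. Suppose that $\mathbf{A}_F$ has finite rank $m$. Then $\operatorname{supp}F$ consists of at most $m$ points, and $F=\sum_q L_q\delta(Z-Z_q)$, where $Z_q\in\mathbb{C}^d$ are points and $L_q$ are linear differential operators with constant coefficients.
   Context: $Z^\alpha=z_1^{\alpha_1}\cdots z_d^{\alpha_d}$, $\bar Z^\beta=\bar z_1^{\beta_1}\cdots\bar z_d^{\beta_d}$; $\langle F,\phi\rangle$ denotes the action of $F$ on a smooth function $\phi$. *)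

theory Defs
  imports "HOL-Analysis.Analysis"
begin

fun dderiv :: "'a::real_normed_vector list \<Rightarrow> ('a \<Rightarrow> complex) \<Rightarrow> 'a \<Rightarrow> complex" where
  "dderiv [] f = f"
| "dderiv (v # vs) f = (\<lambda>x. frechet_derivative (dderiv vs f) (at x) v)"

definition smooth_fun :: "('a::real_normed_vector \<Rightarrow> complex) \<Rightarrow> bool" where
  "smooth_fun f \<longleftrightarrow> (\<forall>vs x. dderiv vs f differentiable (at x))"

text \<open>Multi-indices of real partial derivatives of order at most N (lists of basis vectors).\<close>
definition dirs :: "nat \<Rightarrow> 'a::euclidean_space list set" where
  "dirs N = {vs. set vs \<subseteq> Basis \<and> length vs \<le> N}"

text \<open>A compactly supported distribution (element of E'): a linear functional on smooth
  functions, continuous for the C-infinity topology, i.e. bounded by one of its seminorms.\<close>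
definition comp_distr :: "(('a::euclidean_space \<Rightarrow> complex) \<Rightarrow> complex) \<Rightarrow> bool" where
  "comp_distr F \<longleftrightarrow>
     (\<forall>\<phi> \<psi>. smooth_fun \<phi> \<longrightarrow> smooth_fun \<psi> \<longrightarrow> F (\<lambda>x. \<phi> x + \<psi> x) = F \<phi> + F \<psi>) \<and>
     (\<forall>\<phi> c. smooth_fun \<phi> \<longrightarrow> F (\<lambda>x. c * \<phi> x) = c * F \<phi>) \<and>
     (\<exists>K C N. compact K \<and> (\<forall>\<phi>. smooth_fun \<phi> \<longrightarrow>
        norm (F \<phi>) \<le> C * (\<Sum>vs\<in>dirs N. (SUP x\<in>K. norm (dderiv vs \<phi> x)))))"

definition dsupp :: "(('a::euclidean_space \<Rightarrow> complex) \<Rightarrow> complex) \<Rightarrow> 'a set" where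
  "dsupp F = - \<Union>{U. open U \<and> (\<forall>\<phi>. smooth_fun \<phi> \<and> compact (closure {x. \<phi> x \<noteq> 0})
                       \<and> closure {x. \<phi> x \<noteq> 0} \<subseteq> U \<longrightarrow> F \<phi> = 0)}"

definition monom :: "('d::finite \<Rightarrow> nat) \<Rightarrow> ('d \<Rightarrow> nat) \<Rightarrow> complex^'d \<Rightarrow> complex" where
  "monom \<alpha> \<beta> = (\<lambda>z. \<Prod>i\<in>UNIV. (z$i) ^ \<alpha> i * (cnj (z$i)) ^ \<beta> i)"

definition rows_indep :: "('i \<Rightarrow> 'j \<Rightarrow> complex) \<Rightarrow> 'i set \<Rightarrow> bool" where
  "rows_indep A I \<longleftrightarrow> (\<forall>c. (\<forall>j. (\<Sum>i\<in>I. c i * A i j) = 0) \<longrightarrow> (\<forall>i\<in>I. c i = 0))"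

definition has_rank :: "('i \<Rightarrow> 'j \<Rightarrow> complex) \<Rightarrow> nat \<Rightarrow> bool" where
  "has_rank A m \<longleftrightarrow> (\<exists>I. finite I \<and> card I = m \<and> rows_indep A I) \<and>
                      (\<forall>I. finite I \<and> rows_indep A I \<longrightarrow> card I \<le> m)"

end

theory Submission
  imports
    "HOL-Complex_Analysis.Complex_Analysis"
    "HOL-Computational_Algebra.Fundamental_Theorem_Algebra"
    "Jordan_Normal_Form.Determinant"
    Defs
begin

text \<open>Finite rank \<open>m\<close> means that the pairing \<open>F (f g)\<close> of holomorphic polynomials \<open>f\<close> with antiholomorphic
  polynomials \<open>g\<close> factors as \<open>F (f g) = \<Sum>k<m. F (f G\<^sub>k) F (f\<^sub>k g)\<close>. Applied to exponentials, the
  factorization writes the matrix of \<open>F (f\<^sub>k G\<^sub>j e\<^bsup>zl - cnj(zl)\<^esup>)\<close>, with \<open>l\<close> a coordinate, as a product of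
  an entire and an antientire matrix in \<open>z\<close>; since it grows at most polynomially, Liouville's theorem for the
  determinants and Cramer's rule give a nonzero polynomial \<open>c\<close> with \<open>c(z\<^sub>i) F = 0\<close> for each coordinate, and
  likewise for the conjugate coordinates. Polynomials are dense in the smooth functions (in all derivatives
  on compact sets), so these are identities of distributions. Cutting off at the finitely many common zeros
  leaves distributions killed by high powers of \<open>z\<^sub>i - q\<^sub>i\<close> and \<open>cnj (z\<^sub>i - q\<^sub>i)\<close>; these depend only on a jet
  at \<open>q\<close>. Polynomials that vanish to high order at all support points but one show that the
  number of support points is at most \<open>m\<close>.\<close>

text \<open>The exponent \<open>zl - cnj(zl)\<close> is purely imaginary. Its exponential has
  modulus one and each derivative costs one factor of size |z|, so the growth exponent depends on
  \<open>F\<close> alone and not on the polynomials paired with it; either exponential by itself may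
  grow exponentially. The families \<open>f\<^sub>k\<close> and \<open>G\<^sub>k\<close> are
  biorthogonal, hence both determinants are 1 at z = 0. The polynomial multiplying the Taylor series
  in Cramer's rule is therefore invertible as a power series, and all the series are combinations of
  finitely many fixed ones with polynomial coefficients of bounded degree. That is why one
  \<open>c\<close> serves all test polynomials. The rank controls only pairings with polynomials,
  whereas localisation multiplies by cutoffs and divides by polynomials away from their zeros.
  Density moves the argument into the ideal of smooth g with gF = 0, where such divisions are
  legitimate. Both kinds of annihilator are needed: powers of \<open>z\<^sub>i - q\<^sub>i\<close>
  alone put no bound on the conjugate derivatives at \<open>q\<close>, while together with the
  conjugates they kill high powers of the real coordinates.\<close>

no_notation fps_nth (infixl "$" 75)
no_notation Matrix.vec_index (infixl "$" 100)
no_notation Matrix.scalar_prod (infix "\<bullet>" 70)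
hide_const (open) Polynomial.monom

section \<open>Calculus of smooth functions\<close>

abbreviation pd :: "'a::real_normed_vector \<Rightarrow> ('a \<Rightarrow> complex) \<Rightarrow> 'a \<Rightarrow> complex" where
  "pd v f \<equiv> (\<lambda>x. frechet_derivative f (at x) v)"

lemma pd_eqI: "(f has_derivative f') (at x) \<Longrightarrow> pd v f x = f' v"
  by (metis frechet_derivative_at)

lemma dderiv_append: "dderiv (vs @ ws) f = dderiv vs (dderiv ws f)"
  by (induction vs) auto

text \<open>The last entry of a word is the innermost derivative. Peeling it off differentiates the
  function itself, so an induction over words that also varies the function can use the product rule
  before any outer derivative.\<close>

lemma dderiv_snoc: "dderiv (vs @ [v]) f = dderiv vs (pd v f)"
  by (simp add: dderiv_append)

lemma smooth_fun_differentiable: "smooth_fun f \<Longrightarrow> f differentiable (at x)"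
  unfolding smooth_fun_def by (metis dderiv.simps(1))

lemma smooth_fun_dderiv: "smooth_fun f \<Longrightarrow> smooth_fun (dderiv vs f)"
  unfolding smooth_fun_def by (metis dderiv_append)

lemma smooth_fun_pd: "smooth_fun f \<Longrightarrow> smooth_fun (pd v f)"
  using smooth_fun_dderiv[of f "[v]"] by simp

lemma has_derivative_pd:
  "f differentiable (at x) \<Longrightarrow> (f has_derivative (\<lambda>v. pd v f x)) (at x)"
  by (simp add: frechet_derivative_works[symmetric])

lemma smooth_fun_has_derivative: "smooth_fun f \<Longrightarrow> (f has_derivative (\<lambda>v. pd v f x)) (at x)"
  by (simp add: has_derivative_pd smooth_fun_differentiable)

lemma smooth_fun_continuous: "smooth_fun f \<Longrightarrow> continuous_on S f"
  by (meson continuous_at_imp_continuous_on differentiable_imp_continuous_within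
      smooth_fun_differentiable)

text \<open>Iterated derivatives of composite functions have no convenient closed form; a class
  stable under a single differentiation takes their place.\<close>

lemma smooth_fun_coinduct:
  assumes "f \<in> S" "\<And>g x. g \<in> S \<Longrightarrow> g differentiable (at x)" "\<And>g v. g \<in> S \<Longrightarrow> pd v g \<in> S"
  shows "smooth_fun f"
proof -
  have "dderiv vs f \<in> S" for vs
    by (induction vs) (use assms in auto)
  then show ?thesis
    unfolding smooth_fun_def using assms by blast
qed

text \<open>The linear span of \<open>e\<^bsup>-1/t\<^esup> t\<^bsup>-n\<^esup>\<close> (extended by 0), \<open>n \<ge> 0\<close>, is closed under differentiation.\<close>
definition flatexp :: "nat \<Rightarrow> real \<Rightarrow> real" where
  "flatexp n t = (if t > 0 then exp (- inverse t) * inverse t ^ n else 0)"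

text \<open>With s = 1/t, a single term of the exponential series gives exp s >= s^(n+2) / (n+2)!.
  The two spare powers of s turn into the square of t, which sends the difference quotient at 0 to
  zero.\<close>

lemma flat_bound: "\<bar>flatexp n t\<bar> \<le> fact (n + 2) * t\<^sup>2"
proof (cases "t > 0")
  case True
  define s where "s = inverse t"
  have s: "s > 0" "t = inverse s" using True by (auto simp: s_def)
  have sm: "(\<lambda>k. s ^ k /\<^sub>R fact k) sums exp s" by (rule exp_converges)
  have "(\<Sum>k\<in>{n+2}. s ^ k /\<^sub>R fact k) \<le> (\<Sum>k. s ^ k /\<^sub>R fact k)"
    by (rule sum_le_suminf) (use s sm in \<open>auto simp: sums_iff\<close>)
  then have "s ^ (n+2) / fact (n+2) \<le> exp s"
    using sm by (simp add: sums_iff field_simps)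
  then have "s ^ (n+2) \<le> exp s * fact (n+2)"
    using fact_gt_zero[of "n+2", where ?'a=real] by (simp only: pos_divide_le_eq)
  then have "exp (-s) * s ^ (n+2) \<le> fact (n+2)"
    by (simp add: exp_minus field_simps)
  moreover have "exp (-s) * s ^ n = (exp (-s) * s ^ (n+2)) * t\<^sup>2"
  proof -
    have "s\<^sup>2 * t\<^sup>2 = 1" using s by (simp flip: power_mult_distrib)
    then have "exp (-s) * s ^ n = (exp (-s) * s ^ n) * (s\<^sup>2 * t\<^sup>2)" by simp
    then show ?thesis by (simp only: power_add mult.assoc)
  qed
  ultimately have "exp (-s) * s ^ n \<le> fact (n+2) * t\<^sup>2"
    by (metis mult_right_mono zero_le_power2)
  then show ?thesis
    using True s(1) unfolding flatexp_def s_def by simp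
next
  case False
  then show ?thesis by (auto simp: flatexp_def)
qed

lemma flat_has_derivative:
  "(flatexp n has_field_derivative (- real n * flatexp (Suc n) t + flatexp (n + 2) t)) (at t)"
proof -
  consider "t > 0" | "t < 0" | "t = 0" by linarith
  then show ?thesis
  proof cases
    case 1
    have "((\<lambda>t. exp (- inverse t) * inverse t ^ n) has_field_derivative
        (- real n * flatexp (Suc n) t + flatexp (n + 2) t)) (at t)"
      using 1
      apply (auto intro!: derivative_eq_intros simp: flatexp_def)
      apply (cases n)
       apply (auto simp: field_simps power2_eq_square)
      done
    then show ?thesis
      by (rule has_field_derivative_transform_within_open[where S="{0<..}"])
        (use 1 in \<open>auto simp: flatexp_def\<close>)
  next
    case 2
    have "((\<lambda>t. 0) has_field_derivative (- real n * flatexp (Suc n) t + flatexp (n + 2) t)) (at t)"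
      using 2 by (auto simp: flatexp_def)
    then show ?thesis
      by (rule has_field_derivative_transform_within_open[where S="{..<0}"])
        (use 2 in \<open>auto simp: flatexp_def\<close>)
  next
    case 3
    have "((\<lambda>h. (flatexp n (0 + h) - flatexp n 0) / h) \<longlongrightarrow> 0) (at 0)"
    proof (rule Lim_null_comparison)
      show "\<forall>\<^sub>F h in at 0. norm ((flatexp n (0 + h) - flatexp n 0) / h) \<le> fact (n+2) * \<bar>h\<bar>"
      proof (rule eventually_at_filter[THEN iffD2], rule always_eventually, intro allI impI)
        fix h :: real assume "h \<noteq> 0"
        have "\<bar>flatexp n h\<bar> / \<bar>h\<bar> \<le> (fact (n+2) * h\<^sup>2) / \<bar>h\<bar>"
          using flat_bound[of n h] \<open>h \<noteq> 0\<close> by (intro divide_right_mono) auto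
        also have "\<dots> = fact (n+2) * \<bar>h\<bar>"
        proof -
          have "h\<^sup>2 = \<bar>h\<bar> * \<bar>h\<bar>" by (simp add: power2_eq_square)
          then show ?thesis using \<open>h \<noteq> 0\<close> by (simp only: times_divide_eq_right[symmetric]) simp
        qed
        finally show "norm ((flatexp n (0 + h) - flatexp n 0) / h) \<le> fact (n+2) * \<bar>h\<bar>"
          by (simp add: flatexp_def)
      qed
      show "((\<lambda>h::real. fact (n+2) * \<bar>h\<bar>) \<longlongrightarrow> 0) (at 0)"
        by (auto intro!: tendsto_eq_intros)
    qed
    then show ?thesis
      using 3 by (simp add: DERIV_def flatexp_def)
  qed
qed

text \<open>A class of functions that is closed under directional derivatives, so that all its members are smooth;
  this yields all the closure properties of smooth functions at once.\<close>
inductive smooth_gen :: "('a::real_normed_vector \<Rightarrow> complex) \<Rightarrow> bool" where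
  base: "smooth_fun f \<Longrightarrow> smooth_gen f"
| add: "smooth_gen f \<Longrightarrow> smooth_gen g \<Longrightarrow> smooth_gen (\<lambda>x. f x + g x)"
| mult: "smooth_gen f \<Longrightarrow> smooth_gen g \<Longrightarrow> smooth_gen (\<lambda>x. f x * g x)"
| exp: "smooth_gen f \<Longrightarrow> smooth_gen (\<lambda>x. exp (f x))"
| inverse: "smooth_gen f \<Longrightarrow> (\<And>x. f x \<noteq> 0) \<Longrightarrow> smooth_gen (\<lambda>x. inverse (f x))"
| linear: "smooth_gen f \<Longrightarrow> bounded_linear L \<Longrightarrow> smooth_gen (\<lambda>x. L (f x))"
| flat: "smooth_gen f \<Longrightarrow> smooth_gen (\<lambda>x. of_real (flatexp n (Re (f x))))"

lemma pd_const [simp]: "pd v (\<lambda>x. c) = (\<lambda>x. 0)"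
  by (rule ext, rule pd_eqI) (rule has_derivative_const)

lemma dderiv_zero: "dderiv vs (\<lambda>x. 0) = (\<lambda>x. 0)"
  by (induction vs) auto

lemma smooth_fun_const [intro, simp]: "smooth_fun (\<lambda>x. c)"
  by (rule smooth_fun_coinduct[where S="range (\<lambda>c x. c)"]) auto

lemma smooth_fun_bounded_linear:
  assumes "bounded_linear f" shows "smooth_fun f"
proof (rule smooth_fun_coinduct[where S="insert f (range (\<lambda>c x. c))"])
  have "pd v f = (\<lambda>x. f v)" for v
    by (rule ext, rule pd_eqI) (use assms bounded_linear_imp_has_derivative in blast)
  then show "pd v g \<in> insert f (range (\<lambda>c x. c))" if "g \<in> insert f (range (\<lambda>c x. c))" for v g
    using that by auto
qed (use assms bounded_linear_imp_differentiable in auto)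

lemma pd_add:
  assumes "f differentiable (at x)" "g differentiable (at x)"
  shows "pd v (\<lambda>x. f x + g x) x = pd v f x + pd v g x"
  by (rule pd_eqI) (intro has_derivative_add has_derivative_pd assms)

lemma pd_mult:
  assumes "f differentiable (at x)" "g differentiable (at x)"
  shows "pd v (\<lambda>x. f x * g x) x = pd v f x * g x + f x * pd v g x"
proof -
  have "((\<lambda>x. f x * g x) has_derivative (\<lambda>v. f x * pd v g x + pd v f x * g x)) (at x)"
    by (intro has_derivative_mult has_derivative_pd assms)
  then show ?thesis by (simp add: pd_eqI)
qed

lemma pd_linear:
  assumes "f differentiable (at x)" "bounded_linear L"
  shows "pd v (\<lambda>x. L (f x)) x = L (pd v f x)"
  by (rule pd_eqI, rule bounded_linear.has_derivative[OF assms(2) has_derivative_pd[OF assms(1)]])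

lemma pd_field:
  assumes "f differentiable (at x)" "(g has_field_derivative g') (at (f x))"
  shows "((\<lambda>x. g (f x)) has_derivative (\<lambda>v. g' * pd v f x)) (at x)"
  using has_derivative_compose[OF has_derivative_pd[OF assms(1)]
      assms(2)[unfolded has_field_derivative_def]] by simp

lemma pd_flat:
  assumes "f differentiable (at x)"
  shows "((\<lambda>x. complex_of_real (flatexp n (Re (f x)))) has_derivative
      (\<lambda>v. of_real ((- real n * flatexp (Suc n) (Re (f x)) + flatexp (n + 2) (Re (f x))) * Re (pd v f x)))) (at x)"
proof -
  have "((\<lambda>x. Re (f x)) has_derivative (\<lambda>v. Re (pd v f x))) (at x)"
    by (rule bounded_linear.has_derivative[OF bounded_linear_Re has_derivative_pd[OF assms]])
  from has_derivative_compose[OF this flat_has_derivative[unfolded has_field_derivative_def]]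
  show ?thesis
    by (rule bounded_linear.has_derivative[OF bounded_linear_of_real])
qed

text \<open>Differentiability and closure are proved together because the product and chain rules
  behind the closure need the differentiability of the constituents.\<close>

lemma smooth_gen_pd:
  "smooth_gen f \<Longrightarrow> (\<forall>x. f differentiable (at x)) \<and> (\<forall>v. smooth_gen (pd v f))"
proof (induction rule: smooth_gen.induct)
  case (base f)
  then show ?case
    by (simp add: smooth_fun_differentiable smooth_fun_pd smooth_gen.base)
next
  case (add f g)
  have "pd v (\<lambda>x. f x + g x) = (\<lambda>x. pd v f x + pd v g x)" for v
    using add by (intro ext pd_add) auto
  then show ?case using add by (auto intro: smooth_gen.add)
next
  case (mult f g)
  have "pd v (\<lambda>x. f x * g x) = (\<lambda>x. pd v f x * g x + f x * pd v g x)" for v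
    using mult by (intro ext pd_mult) auto
  then show ?case
    using mult by (auto intro!: smooth_gen.add smooth_gen.mult differentiable_mult)
next
  case (exp f)
  have *: "((\<lambda>x. exp (f x)) has_derivative (\<lambda>v. exp (f x) * pd v f x)) (at x)" for x
    using exp by (intro pd_field) (auto intro!: derivative_eq_intros)
  have "pd v (\<lambda>x. exp (f x)) = (\<lambda>x. exp (f x) * pd v f x)" for v
    using pd_eqI[OF *] by auto
  then show ?case
    using exp * by (auto intro!: smooth_gen.mult smooth_gen.exp differentiableI)
next
  case (inverse f)
  \<comment> \<open>The square is a product of two inverses because the class has products but no
    power constructor.\<close>
  have *: "((\<lambda>x. inverse (f x)) has_derivative
      (\<lambda>v. (- 1 * (inverse (f x) * inverse (f x))) * pd v f x)) (at x)" for x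
    using DERIV_inverse[OF inverse(2), of x UNIV] inverse(3)
    by (intro pd_field) (auto simp: power2_eq_square)
  have "pd v (\<lambda>x. inverse (f x)) = (\<lambda>x. (- 1 * (inverse (f x) * inverse (f x))) * pd v f x)" for v
    using pd_eqI[OF *] by auto
  moreover have "smooth_gen (\<lambda>x. (- 1 * (inverse (f x) * inverse (f x))) * pd v f x)" for v
    by (intro smooth_gen.mult smooth_gen.inverse smooth_gen.base[OF smooth_fun_const])
      (simp_all add: inverse)
  ultimately show ?case
    using * by (auto intro!: differentiableI)
next
  case (linear f L)
  have "pd v (\<lambda>x. L (f x)) = (\<lambda>x. L (pd v f x))" for v
    using linear by (intro ext pd_linear) auto
  moreover have "(\<lambda>x. L (f x)) differentiable (at x)" for x
    by (rule differentiableI, rule bounded_linear.has_derivative[OF linear(2)], rule has_derivative_pd)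
      (use linear in auto)
  ultimately show ?case using linear by (auto intro: smooth_gen.linear)
next
  case (flat f n)
  note * = pd_flat[of f _ n]
  have "pd v (\<lambda>x. complex_of_real (flatexp n (Re (f x)))) =
      (\<lambda>x. (of_real (- real n) * of_real (flatexp (Suc n) (Re (f x)))
           + of_real (flatexp (n + 2) (Re (f x)))) * of_real (Re (pd v f x)))" for v
    using pd_eqI[OF *] flat by auto
  moreover have "smooth_gen (\<lambda>x. (of_real (- real n) * of_real (flatexp (Suc n) (Re (f x)))
           + of_real (flatexp (n + 2) (Re (f x)))) * of_real (Re (pd v f x)))" for v
    by (intro smooth_gen.mult smooth_gen.add smooth_gen.flat
        smooth_gen.linear[where L="\<lambda>z. of_real (Re z)"]
        bounded_linear_compose[OF bounded_linear_of_real bounded_linear_Re]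
        smooth_gen.base[OF smooth_fun_const])
      (simp_all add: flat)
  ultimately show ?case
    using * flat by (auto intro!: differentiableI)
qed

lemma smooth_gen_smooth:
  assumes "smooth_gen f" shows "smooth_fun f"
proof (rule smooth_fun_coinduct[where S="Collect smooth_gen"])
  show "g differentiable (at x)" if "g \<in> Collect smooth_gen" for g and x :: 'a
    using smooth_gen_pd[of g] that by simp
  show "pd v g \<in> Collect smooth_gen" if "g \<in> Collect smooth_gen" for g and v :: 'a
    using smooth_gen_pd[of g] that by simp
qed (use assms in simp)

lemma smooth_fun_add [intro]: "smooth_fun f \<Longrightarrow> smooth_fun g \<Longrightarrow> smooth_fun (\<lambda>x. f x + g x)"
  by (rule smooth_gen_smooth, rule smooth_gen.add) (auto intro: smooth_gen.base)

lemma smooth_fun_mult [intro]: "smooth_fun f \<Longrightarrow> smooth_fun g \<Longrightarrow> smooth_fun (\<lambda>x. f x * g x)"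
  by (rule smooth_gen_smooth, rule smooth_gen.mult) (auto intro: smooth_gen.base)

lemma smooth_fun_exp [intro]: "smooth_fun f \<Longrightarrow> smooth_fun (\<lambda>x. exp (f x))"
  by (rule smooth_gen_smooth, rule smooth_gen.exp) (auto intro: smooth_gen.base)

lemma smooth_fun_inverse [intro]:
  "smooth_fun f \<Longrightarrow> (\<And>x. f x \<noteq> 0) \<Longrightarrow> smooth_fun (\<lambda>x. inverse (f x))"
  by (rule smooth_gen_smooth, rule smooth_gen.inverse) (auto intro: smooth_gen.base)

lemma smooth_fun_linear_compose:
  "smooth_fun f \<Longrightarrow> bounded_linear L \<Longrightarrow> smooth_fun (\<lambda>x. L (f x))"
  by (rule smooth_gen_smooth, rule smooth_gen.linear) (auto intro: smooth_gen.base)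

lemma smooth_fun_cnj [intro]: "smooth_fun f \<Longrightarrow> smooth_fun (\<lambda>x. cnj (f x))"
  by (rule smooth_fun_linear_compose[OF _ bounded_linear_cnj])

lemma smooth_fun_flat [intro]: "smooth_fun f \<Longrightarrow> smooth_fun (\<lambda>x. of_real (flatexp n (Re (f x))))"
  by (rule smooth_gen_smooth, rule smooth_gen.flat) (auto intro: smooth_gen.base)

lemma smooth_fun_minus [intro]: "smooth_fun f \<Longrightarrow> smooth_fun (\<lambda>x. - f x)"
  using smooth_fun_mult[OF smooth_fun_const[of "-1"]] by simp

lemma smooth_fun_diff [intro]: "smooth_fun f \<Longrightarrow> smooth_fun g \<Longrightarrow> smooth_fun (\<lambda>x. f x - g x)"
  unfolding diff_conv_add_uminus by (intro smooth_fun_add smooth_fun_minus)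

lemma smooth_fun_power [intro]: "smooth_fun f \<Longrightarrow> smooth_fun (\<lambda>x. f x ^ n)"
  by (induction n) auto

lemma smooth_fun_sum [intro]: "(\<And>i. i \<in> I \<Longrightarrow> smooth_fun (f i)) \<Longrightarrow> smooth_fun (\<lambda>x. \<Sum>i\<in>I. f i x)"
  by (induction I rule: infinite_finite_induct) auto

lemma smooth_fun_prod [intro]: "(\<And>i. i \<in> I \<Longrightarrow> smooth_fun (f i)) \<Longrightarrow> smooth_fun (\<lambda>x. \<Prod>i\<in>I. f i x)"
  by (induction I rule: infinite_finite_induct) auto

lemma smooth_fun_divide [intro]:
  "smooth_fun f \<Longrightarrow> smooth_fun g \<Longrightarrow> (\<And>x. g x \<noteq> 0) \<Longrightarrow> smooth_fun (\<lambda>x. f x / g x)"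
  unfolding divide_inverse by (intro smooth_fun_mult smooth_fun_inverse)

lemma pd_smooth_add: "smooth_fun f \<Longrightarrow> smooth_fun g \<Longrightarrow> pd v (\<lambda>x. f x + g x) = (\<lambda>x. pd v f x + pd v g x)"
  by (intro ext pd_add smooth_fun_differentiable)

lemma pd_smooth_mult: "smooth_fun f \<Longrightarrow> smooth_fun g \<Longrightarrow>
    pd v (\<lambda>x. f x * g x) = (\<lambda>x. pd v f x * g x + f x * pd v g x)"
  by (intro ext pd_mult smooth_fun_differentiable)

lemma pd_smooth_cmult: "smooth_fun f \<Longrightarrow> pd v (\<lambda>x. c * f x) = (\<lambda>x. c * pd v f x)"
  by (subst pd_smooth_mult) auto

lemma dderiv_add: "smooth_fun f \<Longrightarrow> smooth_fun g \<Longrightarrow>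
    dderiv vs (\<lambda>x. f x + g x) = (\<lambda>x. dderiv vs f x + dderiv vs g x)"
proof (induction vs)
  case (Cons v vs)
  then show ?case
    using pd_smooth_add[of "dderiv vs f" "dderiv vs g" v] by (simp add: smooth_fun_dderiv)
qed simp

lemma dderiv_cmult: "smooth_fun f \<Longrightarrow> dderiv vs (\<lambda>x. c * f x) = (\<lambda>x. c * dderiv vs f x)"
proof (induction vs)
  case (Cons v vs)
  then show ?case
    using pd_smooth_cmult[of "dderiv vs f" c v] by (simp add: smooth_fun_dderiv)
qed simp

lemma dderiv_diff: "smooth_fun f \<Longrightarrow> smooth_fun g \<Longrightarrow>
    dderiv vs (\<lambda>x. f x - g x) = (\<lambda>x. dderiv vs f x - dderiv vs g x)"
  using dderiv_add[of f "\<lambda>x. (-1) * g x" vs] dderiv_cmult[of g vs "-1"]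
    smooth_fun_mult[OF smooth_fun_const[of "-1"], of g] by simp

text \<open>No smoothness is assumed. \<open>frechet_derivative\<close> is a choice among the
  derivatives at a point, and functions that agree on an open set have the same derivatives there,
  so the choices coincide.\<close>

lemma dderiv_cong_open:
  assumes "open U" "\<And>x. x \<in> U \<Longrightarrow> f x = g x" "x \<in> U"
  shows "dderiv vs f x = dderiv vs g x"
  using assms(3)
proof (induction vs arbitrary: x)
  case (Cons v vs)
  have 1: "(h has_derivative f') (at x)"
    if "(g has_derivative f') (at x)" "\<And>x. x \<in> U \<Longrightarrow> g x = h x" for f' and g h :: "'a \<Rightarrow> complex"
    using has_derivative_transform_within_open[OF that(1) assms(1) Cons.prems] that(2) by blast
  have "(dderiv vs f has_derivative f') (at x) \<longleftrightarrow> (dderiv vs g has_derivative f') (at x)" for f'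
    using 1[of "dderiv vs f" f' "dderiv vs g"] 1[of "dderiv vs g" f' "dderiv vs f"] Cons.IH by metis
  then show ?case
    unfolding dderiv.simps frechet_derivative_def by presburger
qed (use assms in auto)

lemma pd_smooth_exp:
  "smooth_fun f \<Longrightarrow> pd v (\<lambda>x. exp (f x)) = (\<lambda>x. exp (f x) * pd v f x)"
proof
  fix x assume "smooth_fun f"
  then have "((\<lambda>x. exp (f x)) has_derivative (\<lambda>v. exp (f x) * pd v f x)) (at x)"
    by (intro pd_field smooth_fun_differentiable) (auto intro!: derivative_eq_intros)
  then show "pd v (\<lambda>x. exp (f x)) x = exp (f x) * pd v f x"
    by (rule pd_eqI)
qed

lemma pd_smooth_linear:
  assumes "smooth_fun f" "bounded_linear L"
  shows "pd v (\<lambda>x. L (f x)) = (\<lambda>x. L (pd v f x))"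
  by (rule ext, rule pd_linear) (use assms smooth_fun_differentiable in auto)

lemma pd_smooth_diff:
  assumes "smooth_fun f" "smooth_fun g"
  shows "pd v (\<lambda>x. f x - g x) = (\<lambda>x. pd v f x - pd v g x)"
  using dderiv_diff[OF assms, of "[v]"] by simp

section \<open>Symmetry of mixed partial derivatives\<close>

lemma pd_scaleR:
  assumes "smooth_fun f" shows "pd (s *\<^sub>R u) f x = s *\<^sub>R pd u f x"
  using bounded_linear.linear[OF has_derivative_bounded_linear[OF smooth_fun_has_derivative[OF assms, of x]]]
  by (rule linear_scale)

lemma smooth_fun_line_derivative:
  assumes "smooth_fun f"
  shows "((\<lambda>s. f (y + s *\<^sub>R u)) has_vector_derivative pd u f (y + s *\<^sub>R u)) (at s)"
proof -
  have "((\<lambda>s. y + s *\<^sub>R u) has_derivative (\<lambda>h. h *\<^sub>R u)) (at s)"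
    by (auto intro!: derivative_eq_intros)
  from has_derivative_compose[OF this smooth_fun_has_derivative[OF assms]]
  show ?thesis
    by (simp add: has_vector_derivative_def pd_scaleR[OF assms])
qed

text \<open>The mean value theorem is applied twice: to the increment in direction \<open>v\<close>
  as a function of the distance along \<open>u\<close>, then to \<open>pd u f\<close> along
  \<open>v\<close>. As an equality it needs real values, hence the functional \<open>L\<close>,
  which will be \<open>Re\<close> and \<open>Im\<close>.\<close>

lemma mixed_difference:
  fixes L :: "complex \<Rightarrow> real"
  assumes f: "smooth_fun f" and L: "bounded_linear L" and h: "h > 0"
  shows "\<exists>s t. 0 \<le> s \<and> s \<le> h \<and> 0 \<le> t \<and> t \<le> h \<and>
     L (f (x + h *\<^sub>R u + h *\<^sub>R v) - f (x + h *\<^sub>R u) - f (x + h *\<^sub>R v) + f x)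
       = h * h * L (pd v (pd u f) (x + s *\<^sub>R u + t *\<^sub>R v))"
proof -
  interpret L: bounded_linear L by fact
  have der: "((\<lambda>s. L (g (y + s *\<^sub>R w))) has_real_derivative L (pd w g (y + s *\<^sub>R w))) (at s)"
    if "smooth_fun g" for g and y w :: 'a and s
    using L.has_vector_derivative[OF smooth_fun_line_derivative[OF that, of y w s]]
    by (simp add: has_real_derivative_iff_has_vector_derivative)
  let ?p = "\<lambda>s. L (f ((x + h *\<^sub>R v) + s *\<^sub>R u)) - L (f (x + s *\<^sub>R u))"
  have "\<exists>s>0. s < h \<and> ?p h - ?p 0
      = (h - 0) * (L (pd u f ((x + h *\<^sub>R v) + s *\<^sub>R u)) - L (pd u f (x + s *\<^sub>R u)))"
    by (rule MVT2[OF h]) (rule DERIV_diff[OF der[OF f] der[OF f]])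
  then obtain s where s: "0 < s" "s < h" and ps: "?p h - ?p 0
      = h * (L (pd u f ((x + h *\<^sub>R v) + s *\<^sub>R u)) - L (pd u f (x + s *\<^sub>R u)))" by auto
  let ?q = "\<lambda>t. L (pd u f ((x + s *\<^sub>R u) + t *\<^sub>R v))"
  have "\<exists>t>0. t < h \<and> ?q h - ?q 0 = (h - 0) * L (pd v (pd u f) ((x + s *\<^sub>R u) + t *\<^sub>R v))"
    by (rule MVT2[OF h]) (rule der[OF smooth_fun_pd[OF f]])
  then obtain t where t: "0 < t" "t < h" and qt: "?q h - ?q 0 = h * L (pd v (pd u f) ((x + s *\<^sub>R u) + t *\<^sub>R v))"
    by auto
  have "(x + h *\<^sub>R v) + s *\<^sub>R u = (x + s *\<^sub>R u) + h *\<^sub>R v" by simp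
  then have "?p h - ?p 0 = h * (?q h - ?q 0)" unfolding ps by (simp only: scaleR_zero_left add_0_right)
  also have "\<dots> = h * h * L (pd v (pd u f) (x + s *\<^sub>R u + t *\<^sub>R v))" using qt by simp
  finally have "L (f (x + h *\<^sub>R u + h *\<^sub>R v) - f (x + h *\<^sub>R u) - f (x + h *\<^sub>R v) + f x)
       = h * h * L (pd v (pd u f) (x + s *\<^sub>R u + t *\<^sub>R v))"
    by (simp add: L.diff L.add add.commute add.left_commute)
  then show ?thesis using s t by (intro exI[of _ s] exI[of _ t]) auto
qed

lemma mixed_difference_limit:
  fixes L :: "complex \<Rightarrow> real"
  assumes f: "smooth_fun f" and L: "bounded_linear L"
  shows "(\<lambda>n. L (f (x + inverse (Suc n) *\<^sub>R u + inverse (Suc n) *\<^sub>R v) - f (x + inverse (Suc n) *\<^sub>R u)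
       - f (x + inverse (Suc n) *\<^sub>R v) + f x) / (inverse (Suc n))\<^sup>2) \<longlonglongrightarrow> L (pd v (pd u f) x)"
proof -
  define h where "h n = inverse (real (Suc n))" for n
  have h: "h n > 0" for n by (simp add: h_def)
  have h0: "h \<longlonglongrightarrow> 0" unfolding h_def by (rule LIMSEQ_inverse_real_of_nat)
  have "\<forall>n. \<exists>s t. 0 \<le> s \<and> s \<le> h n \<and> 0 \<le> t \<and> t \<le> h n \<and>
     L (f (x + h n *\<^sub>R u + h n *\<^sub>R v) - f (x + h n *\<^sub>R u) - f (x + h n *\<^sub>R v) + f x)
       = h n * h n * L (pd v (pd u f) (x + s *\<^sub>R u + t *\<^sub>R v))"
    using mixed_difference[OF f L h] by blast
  then obtain s t where st: "\<And>n. 0 \<le> s n" "\<And>n. s n \<le> h n" "\<And>n. 0 \<le> t n" "\<And>n. t n \<le> h n"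
    and eq: "\<And>n. L (f (x + h n *\<^sub>R u + h n *\<^sub>R v) - f (x + h n *\<^sub>R u) - f (x + h n *\<^sub>R v) + f x)
       = h n * h n * L (pd v (pd u f) (x + s n *\<^sub>R u + t n *\<^sub>R v))" by metis
  have s0: "s \<longlonglongrightarrow> 0" by (rule tendsto_sandwich[OF _ _ tendsto_const h0]) (auto simp: st)
  have t0: "t \<longlonglongrightarrow> 0" by (rule tendsto_sandwich[OF _ _ tendsto_const h0]) (auto simp: st)
  have "(\<lambda>n. x + s n *\<^sub>R u + t n *\<^sub>R v) \<longlonglongrightarrow> x + 0 *\<^sub>R u + 0 *\<^sub>R v"
    by (intro tendsto_intros s0 t0)
  then have lim: "(\<lambda>n. x + s n *\<^sub>R u + t n *\<^sub>R v) \<longlonglongrightarrow> x" by simp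
  have "isCont (pd v (pd u f)) x"
    using smooth_fun_continuous[OF smooth_fun_pd[OF smooth_fun_pd[OF f]], of UNIV]
    by (simp add: continuous_on_eq_continuous_at)
  from isCont_tendsto_compose[OF this lim]
  have "(\<lambda>n. L (pd v (pd u f) (x + s n *\<^sub>R u + t n *\<^sub>R v))) \<longlonglongrightarrow> L (pd v (pd u f) x)"
    by (rule bounded_linear.tendsto[OF L])
  moreover have "L (pd v (pd u f) (x + s n *\<^sub>R u + t n *\<^sub>R v)) =
    L (f (x + h n *\<^sub>R u + h n *\<^sub>R v) - f (x + h n *\<^sub>R u) - f (x + h n *\<^sub>R v) + f x) / (h n)\<^sup>2" for n
    using h[of n] by (simp add: eq power2_eq_square)
  ultimately show ?thesis by (simp add: h_def)
qed

text \<open>The second difference is symmetric in \<open>u\<close> and \<open>v\<close>, while its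
  quotient by the squared step tends to either mixed derivative.\<close>

lemma pd_commute:
  assumes f: "smooth_fun f"
  shows "pd u (pd v f) = pd v (pd u f)"
proof
  fix x
  have *: "L (pd u (pd v f) x) = L (pd v (pd u f) x)" if L: "bounded_linear L" for L :: "complex \<Rightarrow> real"
  proof (rule LIMSEQ_unique)
    show "(\<lambda>n. L (f (x + inverse (Suc n) *\<^sub>R u + inverse (Suc n) *\<^sub>R v) - f (x + inverse (Suc n) *\<^sub>R u)
       - f (x + inverse (Suc n) *\<^sub>R v) + f x) / (inverse (Suc n))\<^sup>2) \<longlonglongrightarrow> L (pd u (pd v f) x)"
      using mixed_difference_limit[OF f L, of x v u] by (simp add: algebra_simps)
    show "(\<lambda>n. L (f (x + inverse (Suc n) *\<^sub>R u + inverse (Suc n) *\<^sub>R v) - f (x + inverse (Suc n) *\<^sub>R u)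
       - f (x + inverse (Suc n) *\<^sub>R v) + f x) / (inverse (Suc n))\<^sup>2) \<longlonglongrightarrow> L (pd v (pd u f) x)"
      by (rule mixed_difference_limit[OF f L])
  qed
  show "pd u (pd v f) x = pd v (pd u f) x"
    using *[OF bounded_linear_Re] *[OF bounded_linear_Im] by (simp add: complex_eq_iff)
qed

lemma pd_dderiv:
  assumes "smooth_fun f" shows "pd v (dderiv vs f) = dderiv vs (pd v f)"
proof (induction vs)
  case (Cons w vs)
  then show ?case
    using pd_commute[OF smooth_fun_dderiv[OF assms, of vs], of v w] by simp
qed simp

section \<open>Continuity of compactly supported distributions\<close>

lemma finite_dirs: "finite (dirs N :: 'a::euclidean_space list set)"
  using finite_lists_length_le[OF finite_Basis, of N] by (simp add: dirs_def)

lemma comp_distr_add: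
  "comp_distr F \<Longrightarrow> smooth_fun f \<Longrightarrow> smooth_fun g \<Longrightarrow> F (\<lambda>x. f x + g x) = F f + F g"
  unfolding comp_distr_def by blast

lemma comp_distr_cmult:
  "comp_distr F \<Longrightarrow> smooth_fun f \<Longrightarrow> F (\<lambda>x. c * f x) = c * F f"
  unfolding comp_distr_def by blast

lemma comp_distr_zero: "comp_distr F \<Longrightarrow> F (\<lambda>x. 0) = 0"
  using comp_distr_cmult[of F "\<lambda>x. 0" 0] by simp

lemma comp_distr_diff:
  assumes "comp_distr F" "smooth_fun f" "smooth_fun g" shows "F (\<lambda>x. f x - g x) = F f - F g"
  using comp_distr_add[OF assms(1,2), of "\<lambda>x. (-1) * g x"] comp_distr_cmult[OF assms(1,3), of "-1"]
    smooth_fun_mult[OF smooth_fun_const[of "-1"] assms(3)] by simp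

lemma comp_distr_sum:
  assumes "comp_distr F" "\<And>i. i \<in> I \<Longrightarrow> smooth_fun (f i)"
  shows "F (\<lambda>x. \<Sum>i\<in>I. f i x) = (\<Sum>i\<in>I. F (f i))"
  using assms(2)
proof (induction I rule: infinite_finite_induct)
  case (insert i I)
  then show ?case
    using comp_distr_add[OF assms(1), of "f i" "\<lambda>x. \<Sum>i\<in>I. f i x"] smooth_fun_sum[of I f] by simp
qed (simp_all add: comp_distr_zero[OF assms(1)])

lemma comp_distr_sum_cmult:
  assumes "comp_distr F" "\<And>i. i \<in> I \<Longrightarrow> smooth_fun (f i)"
  shows "F (\<lambda>x. \<Sum>i\<in>I. c i * f i x) = (\<Sum>i\<in>I. c i * F (f i))"
proof -
  have "F (\<lambda>x. \<Sum>i\<in>I. c i * f i x) = (\<Sum>i\<in>I. F (\<lambda>x. c i * f i x))"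
    by (rule comp_distr_sum[OF assms(1)]) (intro smooth_fun_mult smooth_fun_const assms(2))
  also have "\<dots> = (\<Sum>i\<in>I. c i * F (f i))"
    by (rule sum.cong) (use comp_distr_cmult[OF assms(1)] assms(2) in auto)
  finally show ?thesis .
qed

text \<open>One pointwise bound \<open>M\<close> replaces the sum of suprema; the number of words is
  absorbed into the constant.\<close>

lemma comp_distr_bound:
  fixes F :: "('a::euclidean_space \<Rightarrow> complex) \<Rightarrow> complex"
  assumes F: "comp_distr F"
  obtains K C N where "compact K" "C \<ge> 0"
    "\<And>f M. smooth_fun f \<Longrightarrow> M \<ge> 0 \<Longrightarrow> (\<And>vs x. vs \<in> dirs N \<Longrightarrow> x \<in> K \<Longrightarrow> norm (dderiv vs f x) \<le> M)
       \<Longrightarrow> norm (F f) \<le> C * M"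
proof -
  obtain K C N where K: "compact K" and *: "\<And>f. smooth_fun f \<Longrightarrow>
      norm (F f) \<le> C * (\<Sum>vs\<in>dirs N. (SUP x\<in>K. norm (dderiv vs f x)))"
    using F unfolding comp_distr_def by (elim conjE exE) (rule that, auto)
  show thesis
  proof (cases "K = {}")
    \<comment> \<open>The supremum over the empty set is an unspecified real, so the seminorm
      estimate only bounds all values of \<open>F\<close> by one constant \<open>B\<close>.
      Homogeneity then forces \<open>F\<close> to vanish.\<close>
    case True
    define B where "B = C * (\<Sum>vs\<in>(dirs N :: 'a list set). (SUP x\<in>{}::'a set. norm (dderiv vs (\<lambda>x. 0) x)))"
    have B: "norm (F f) \<le> B" if "smooth_fun f" for f
      using *[OF that] True by (simp add: B_def)
    have "F f = 0" if f: "smooth_fun f" for f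
    proof (rule ccontr)
      assume "F f \<noteq> 0"
      then obtain n where n: "B < of_nat n * norm (F f)"
        using reals_Archimedean3[of "norm (F f)"] by auto
      have "norm (F (\<lambda>x. of_nat n * f x)) \<le> B"
        by (rule B) (intro smooth_fun_mult smooth_fun_const f)
      then show False using n by (simp add: comp_distr_cmult[OF F f] norm_mult)
    qed
    then show thesis using that[of "{}" 0 0] by simp
  next
    case False
    \<comment> \<open>\<open>C\<close> may be negative; with its absolute value the estimate becomes
      monotone in the suprema.\<close>
    show thesis
    proof (rule that[OF K, of "\<bar>C\<bar> * card (dirs N :: 'a list set)" N])
      fix f :: "'a \<Rightarrow> complex" and M :: real
      assume f: "smooth_fun f" and M: "M \<ge> 0"
        and b: "\<And>vs x. vs \<in> dirs N \<Longrightarrow> x \<in> K \<Longrightarrow> norm (dderiv vs f x) \<le> M"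
      have 1: "(SUP x\<in>K. norm (dderiv vs f x)) \<le> M" if "vs \<in> dirs N" for vs
        using b that False by (intro cSUP_least) auto
      have 2: "0 \<le> (SUP x\<in>K. norm (dderiv vs f x))" if "vs \<in> dirs N" for vs
      proof -
        obtain x where "x \<in> K" using False by blast
        moreover have "bdd_above ((\<lambda>x. norm (dderiv vs f x)) ` K)"
          using b that by (intro bdd_aboveI2) auto
        ultimately show ?thesis by (intro cSUP_upper2[where x=x]) auto
      qed
      have "norm (F f) \<le> \<bar>C\<bar> * (\<Sum>vs\<in>dirs N. (SUP x\<in>K. norm (dderiv vs f x)))"
        using *[OF f] sum_nonneg[of "dirs N" "\<lambda>vs. (SUP x\<in>K. norm (dderiv vs f x))"] 2
        by (smt (verit) mult_right_mono)
      also have "\<dots> \<le> \<bar>C\<bar> * (card (dirs N :: 'a list set) * M)"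
        using sum_bounded_above[of "dirs N" "\<lambda>vs. (SUP x\<in>K. norm (dderiv vs f x))" M] 1
        by (intro mult_left_mono) auto
      finally show "norm (F f) \<le> \<bar>C\<bar> * card (dirs N :: 'a list set) * M" by simp
    qed auto
  qed
qed

text \<open>Convergence for the C-infinity seminorms on \<open>K\<close>. Derivatives of all orders
  are demanded, although \<open>F\<close> sees only those up to some \<open>N\<close>, so that the
  notion is stable under differentiation and under multiplication by smooth functions.\<close>

definition cconv :: "'a::euclidean_space set \<Rightarrow> (nat \<Rightarrow> 'a \<Rightarrow> complex) \<Rightarrow> ('a \<Rightarrow> complex) \<Rightarrow> bool" where
  "cconv K f g \<longleftrightarrow> (\<forall>vs. set vs \<subseteq> Basis \<longrightarrow>
     uniform_limit K (\<lambda>n. dderiv vs (f n)) (dderiv vs g) sequentially)"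

lemma comp_distr_cconv:
  fixes F :: "('a::euclidean_space \<Rightarrow> complex) \<Rightarrow> complex"
  assumes F: "comp_distr F"
  obtains K where "compact K"
    "\<And>f g. (\<And>n. smooth_fun (f n)) \<Longrightarrow> smooth_fun g \<Longrightarrow> cconv K f g \<Longrightarrow> (\<lambda>n. F (f n)) \<longlonglongrightarrow> F g"
proof -
  obtain K C N where K: "compact K" and C: "C \<ge> 0" and
    b: "\<And>f M. smooth_fun f \<Longrightarrow> M \<ge> 0 \<Longrightarrow> (\<And>vs x. vs \<in> dirs N \<Longrightarrow> x \<in> K \<Longrightarrow> norm (dderiv vs f x) \<le> M)
       \<Longrightarrow> norm (F f) \<le> C * M"
    by (rule comp_distr_bound[OF F]) blast
  show thesis
  proof (rule that[OF K])
    fix f and g :: "'a \<Rightarrow> complex"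
    assume f: "\<And>n. smooth_fun (f n)" and g: "smooth_fun g" and c: "cconv K f g"
    show "(\<lambda>n. F (f n)) \<longlonglongrightarrow> F g"
    proof (rule tendstoI)
      fix e :: real assume e: "e > 0"
      \<comment> \<open>The added 1 covers the case \<open>C = 0\<close>.\<close>
      define d where "d = e / (C + 1)"
      have d: "d > 0" "C * d < e" using e C by (auto simp: d_def field_simps add_pos_nonneg)
      have "\<forall>\<^sub>F n in sequentially. \<forall>vs\<in>dirs N. \<forall>x\<in>K. dist (dderiv vs (f n) x) (dderiv vs g x) < d"
      proof (rule eventually_ball_finite[OF finite_dirs], rule ballI)
        fix vs :: "'a list" assume "vs \<in> dirs N"
        then have "uniform_limit K (\<lambda>n. dderiv vs (f n)) (dderiv vs g) sequentially"
          using c by (auto simp: cconv_def dirs_def)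
        then show "\<forall>\<^sub>F n in sequentially. \<forall>x\<in>K. dist (dderiv vs (f n) x) (dderiv vs g x) < d"
          using d(1) by (rule uniform_limitD)
      qed
      then show "\<forall>\<^sub>F n in sequentially. dist (F (f n)) (F g) < e"
      proof eventually_elim
        case (elim n)
        have "norm (F (\<lambda>x. f n x - g x)) \<le> C * d"
          by (rule b) (use elim d f g in \<open>auto simp: dderiv_diff dist_norm less_imp_le intro: smooth_fun_diff\<close>)
        then show ?case using d by (simp add: comp_distr_diff[OF F f g] dist_norm)
      qed
    qed
  qed
qed

lemma cconv_pd:
  assumes "cconv K f g" "v \<in> Basis" shows "cconv K (\<lambda>n. pd v (f n)) (pd v g)"
  unfolding cconv_def
proof (intro allI impI)
  fix vs :: "'a list" assume "set vs \<subseteq> Basis"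
  then have "set (vs @ [v]) \<subseteq> Basis" using assms(2) by simp
  then show "uniform_limit K (\<lambda>n. dderiv vs (pd v (f n))) (dderiv vs (pd v g)) sequentially"
    using assms(1) unfolding cconv_def dderiv_snoc[symmetric] by blast
qed

lemma compact_smooth_bounded: "compact K \<Longrightarrow> smooth_fun f \<Longrightarrow> bounded (f ` K)"
  by (simp add: compact_continuous_image compact_imp_bounded smooth_fun_continuous)

text \<open>Leibniz's rule without binomial sums: the innermost derivative splits the product into
  two products of the same kind, so the induction runs over all \<open>f\<close>, \<open>g\<close>
  and \<open>h\<close> at once. Compactness of \<open>K\<close> bounds the fixed factor in the base
  case.\<close>

lemma cconv_mult:
  assumes K: "compact K" and "\<And>n. smooth_fun (f n)" "smooth_fun g" "smooth_fun h" "cconv K f g"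
  shows "cconv K (\<lambda>n x. h x * f n x) (\<lambda>x. h x * g x)"
proof -
  have "uniform_limit K (\<lambda>n. dderiv vs (\<lambda>x. h x * f n x)) (dderiv vs (\<lambda>x. h x * g x)) sequentially"
    if "set vs \<subseteq> Basis" "\<And>n. smooth_fun (f n)" "smooth_fun g" "smooth_fun h" "cconv K f g" for vs f g h
    using that
  proof (induction vs arbitrary: f g h rule: rev_induct)
    case Nil
    have "uniform_limit K f g sequentially"
      using Nil.prems(5)[unfolded cconv_def, rule_format, of "[]"] by simp
    then show ?case
      using Nil by (auto intro!: uniform_lim_mult uniform_limit_const compact_smooth_bounded[OF K])
  next
    case (snoc v vs)
    have v: "v \<in> Basis" and vs: "set vs \<subseteq> Basis" using snoc.prems by auto
    note sm = snoc.prems(2-4)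
    have eq: "dderiv (vs @ [v]) (\<lambda>x. h x * g x) =
        (\<lambda>x. dderiv vs (\<lambda>x. pd v h x * g x) x + dderiv vs (\<lambda>x. h x * pd v g x) x)"
      if g: "smooth_fun g" for g
      unfolding dderiv_snoc pd_smooth_mult[OF sm(3) g]
      by (rule dderiv_add) (intro smooth_fun_mult smooth_fun_pd sm g)+
    have "uniform_limit K (\<lambda>n x. dderiv vs (\<lambda>x. pd v h x * f n x) x + dderiv vs (\<lambda>x. h x * pd v (f n) x) x)
        (\<lambda>x. dderiv vs (\<lambda>x. pd v h x * g x) x + dderiv vs (\<lambda>x. h x * pd v g x) x) sequentially"
      by (intro uniform_limit_add snoc.IH smooth_fun_pd sm cconv_pd snoc.prems(5) v vs)
    then show ?case unfolding eq[OF sm(1)] eq[OF sm(2)] .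
  qed
  then show ?thesis using assms unfolding cconv_def by blast
qed

text \<open>One compact set serves every multiplier \<open>h\<close>, since multiplication by a
  smooth function preserves \<open>cconv\<close> on the same \<open>K\<close>.\<close>

lemma comp_distr_mult_cconv:
  fixes F :: "('a::euclidean_space \<Rightarrow> complex) \<Rightarrow> complex"
  assumes F: "comp_distr F"
  obtains K where "compact K"
    "\<And>f g h. (\<And>n. smooth_fun (f n)) \<Longrightarrow> smooth_fun g \<Longrightarrow> smooth_fun h \<Longrightarrow> cconv K f g
       \<Longrightarrow> (\<lambda>n. F (\<lambda>x. h x * f n x)) \<longlonglongrightarrow> F (\<lambda>x. h x * g x)"
proof -
  obtain K where K: "compact K" and *:
    "\<And>f g. (\<And>n. smooth_fun (f n)) \<Longrightarrow> smooth_fun g \<Longrightarrow> cconv K f g \<Longrightarrow> (\<lambda>n. F (f n)) \<longlonglongrightarrow> F g"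
    by (rule comp_distr_cconv[OF F]) blast
  show thesis
    by (rule that[OF K], rule *) (auto intro: cconv_mult[OF K])
qed

text \<open>Differentiating a partial sum reproduces the partial sum with one term fewer, times a
  smooth factor that can be moved into \<open>g\<close>. The induction over words thus returns to
  the same statement with another \<open>g\<close>, and the shift of the index is invisible in the
  limit.\<close>

lemma exp_series_cconv:
  fixes K :: "'a::euclidean_space set"
  assumes K: "compact K" and "smooth_fun g" and l: "smooth_fun l"
  shows "cconv K (\<lambda>M x. g x * (\<Sum>n<M. (z * l x) ^ n / fact n)) (\<lambda>x. g x * exp (z * l x))"
proof -
  define S where "S M x = (\<Sum>n<M. (z * l x) ^ n / fact n)" for M x
  have zl: "smooth_fun (\<lambda>x. z * l x)" by (intro smooth_fun_mult smooth_fun_const l)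
  have S: "smooth_fun (S M)" for M
    unfolding S_def by (intro smooth_fun_sum smooth_fun_divide smooth_fun_power zl) auto
  have pdS: "pd v (S M) = (\<lambda>x. z * pd v l x * S (M - 1) x)" for v M
  proof
    fix x
    have "((\<lambda>w. \<Sum>n<M. w ^ n / fact n) has_field_derivative (\<Sum>n<M - 1. (z * l x) ^ n / fact n))
        (at (z * l x))"
    proof (cases M)
      case (Suc k)
      have "((\<lambda>w. \<Sum>n<Suc k. w ^ n / fact n) has_field_derivative
          (\<Sum>n<Suc k. of_nat n * (z * l x) ^ (n - 1) / fact n)) (at (z * l x))"
        by (auto intro!: derivative_eq_intros)
      also have "(\<Sum>n<Suc k. of_nat n * (z * l x) ^ (n - 1) / fact n) = (\<Sum>n<k. (z * l x) ^ n / fact n)"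
        by (subst sum.lessThan_Suc_shift) (simp add: fact_reduce del: of_nat_Suc)
      finally show ?thesis using Suc by simp
    qed simp
    from pd_field[OF smooth_fun_differentiable[OF zl] this]
    show "pd v (S M) x = z * pd v l x * S (M - 1) x"
      unfolding S_def[abs_def] by (subst pd_eqI, assumption) (simp add: pd_smooth_cmult[OF l, THEN fun_cong])
  qed
  have "uniform_limit K (\<lambda>M. dderiv vs (\<lambda>x. g x * S M x)) (dderiv vs (\<lambda>x. g x * exp (z * l x))) sequentially"
    if "smooth_fun g" for vs g
    using that
  proof (induction vs arbitrary: g rule: rev_induct)
    case Nil
    obtain R where R: "\<And>x. x \<in> K \<Longrightarrow> norm (z * l x) \<le> R"
      using compact_smooth_bounded[OF K zl] by (auto simp: bounded_iff)
    have "uniform_limit K (\<lambda>M x. \<Sum>n<M. (z * l x) ^ n / fact n) (\<lambda>x. \<Sum>n. (z * l x) ^ n / fact n) sequentially"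
    proof (rule Weierstrass_m_test)
      show "norm ((z * l x) ^ n / fact n) \<le> R ^ n / fact n" if "x \<in> K" for n x
        unfolding norm_divide norm_power norm_fact
        by (rule divide_right_mono, rule power_mono) (use R[OF that] in auto)
      show "summable (\<lambda>n. R ^ n / fact n)"
        using summable_exp_generic[of R] by (simp add: field_simps)
    qed
    moreover have "(\<Sum>n. w ^ n / fact n) = exp w" for w :: complex
      unfolding exp_def by (simp add: scaleR_conv_of_real field_simps)
    ultimately have "uniform_limit K S (\<lambda>x. exp (z * l x)) sequentially"
      by (simp add: S_def[abs_def])
    then show ?case
      using Nil by (auto intro!: uniform_lim_mult uniform_limit_const compact_smooth_bounded[OF K]
          smooth_fun_exp zl)
  next
    case (snoc v vs)
    have g2: "smooth_fun (\<lambda>x. g x * (z * pd v l x))"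
      by (intro smooth_fun_mult smooth_fun_pd smooth_fun_const snoc.prems l)
    have eq: "dderiv (vs @ [v]) (\<lambda>x. g x * S M x) =
        (\<lambda>x. dderiv vs (\<lambda>x. pd v g x * S M x) x + dderiv vs (\<lambda>x. g x * (z * pd v l x) * S (M - 1) x) x)" for M
      unfolding dderiv_snoc pd_smooth_mult[OF snoc.prems S] pdS[THEN fun_cong]
      using dderiv_add[of "\<lambda>x. pd v g x * S M x" "\<lambda>x. g x * (z * pd v l x) * S (M - 1) x" vs]
        smooth_fun_mult[OF smooth_fun_pd[OF snoc.prems] S] smooth_fun_mult[OF g2 S]
      by (simp add: mult.assoc)
    have ex: "smooth_fun (\<lambda>x. exp (z * l x))" by (rule smooth_fun_exp[OF zl])
    have eq2: "dderiv (vs @ [v]) (\<lambda>x. g x * exp (z * l x)) =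
        (\<lambda>x. dderiv vs (\<lambda>x. pd v g x * exp (z * l x)) x + dderiv vs (\<lambda>x. g x * (z * pd v l x) * exp (z * l x)) x)"
      unfolding dderiv_snoc pd_smooth_mult[OF snoc.prems ex] pd_smooth_exp[OF zl, THEN fun_cong] pd_smooth_cmult[OF l, THEN fun_cong]
      using dderiv_add[of "\<lambda>x. pd v g x * exp (z * l x)" "\<lambda>x. g x * (z * pd v l x) * exp (z * l x)" vs]
        smooth_fun_mult[OF smooth_fun_pd[OF snoc.prems] ex] smooth_fun_mult[OF g2 ex]
      by (simp add: ac_simps)
    have 2: "uniform_limit K (\<lambda>M. dderiv vs (\<lambda>x. g x * (z * pd v l x) * S (M - 1) x))
        (dderiv vs (\<lambda>x. g x * (z * pd v l x) * exp (z * l x))) sequentially"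
      by (rule filterlim_compose[OF snoc.IH[OF g2] filterlim_minus_const_nat_at_top])
    show ?case
      unfolding eq eq2
      by (rule uniform_limit_add[OF snoc.IH[OF smooth_fun_pd[OF snoc.prems]] 2])
  qed
  then show ?thesis using assms(2) unfolding cconv_def S_def by blast
qed

text \<open>This makes the pairing with an exponential an entire function of \<open>z\<close> whose
  Taylor coefficients are, up to factorials, the moments of \<open>F\<close> against powers of
  \<open>l\<close>.\<close>

lemma comp_distr_exp_sums:
  fixes F :: "('a::euclidean_space \<Rightarrow> complex) \<Rightarrow> complex"
  assumes F: "comp_distr F" and g: "smooth_fun g" and l: "smooth_fun l"
  shows "(\<lambda>n. F (\<lambda>x. g x * l x ^ n) / fact n * z ^ n) sums F (\<lambda>x. g x * exp (z * l x))"
proof -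
  obtain K where K: "compact K" and *:
    "\<And>f g. (\<And>n. smooth_fun (f n)) \<Longrightarrow> smooth_fun g \<Longrightarrow> cconv K f g \<Longrightarrow> (\<lambda>n. F (f n)) \<longlonglongrightarrow> F g"
    by (rule comp_distr_cconv[OF F]) blast
  have zl: "smooth_fun (\<lambda>x. z * l x)" by (intro smooth_fun_mult smooth_fun_const l)
  have gl: "smooth_fun (\<lambda>x. g x * l x ^ n)" for n by (intro smooth_fun_mult smooth_fun_power g l)
  have "F (\<lambda>x. g x * (\<Sum>n<M. (z * l x) ^ n / fact n)) = (\<Sum>n<M. F (\<lambda>x. g x * l x ^ n) / fact n * z ^ n)" for M
  proof -
    have "F (\<lambda>x. g x * (\<Sum>n<M. (z * l x) ^ n / fact n)) = F (\<lambda>x. \<Sum>n<M. (z ^ n / fact n) * (g x * l x ^ n))"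
      by (rule arg_cong[where f=F]) (simp add: sum_distrib_left power_mult_distrib mult_ac)
    also have "\<dots> = (\<Sum>n<M. (z ^ n / fact n) * F (\<lambda>x. g x * l x ^ n))"
      by (rule comp_distr_sum_cmult[OF F gl])
    finally show ?thesis by (simp add: mult_ac)
  qed
  moreover have "(\<lambda>M. F (\<lambda>x. g x * (\<Sum>n<M. (z * l x) ^ n / fact n))) \<longlonglongrightarrow> F (\<lambda>x. g x * exp (z * l x))"
    by (rule * ) (intro smooth_fun_mult smooth_fun_sum smooth_fun_divide smooth_fun_power smooth_fun_exp g zl
        smooth_fun_const exp_series_cconv[OF K g l] | simp)+
  ultimately show ?thesis by (simp add: sums_def)
qed

text \<open>The exponent is imaginary, so the exponential itself is bounded by 1, and every
  derivative brings down at most one factor \<open>z\<close> or \<open>cnj z\<close>. The exponent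
  \<open>N\<close> is the order in the seminorm of \<open>F\<close>, chosen before \<open>g\<close>
  and \<open>l\<close>; only the constant depends on them.\<close>

lemma comp_distr_oscillatory_bound:
  fixes F :: "('a::euclidean_space \<Rightarrow> complex) \<Rightarrow> complex"
  assumes F: "comp_distr F"
  obtains N where "\<And>g l. smooth_fun g \<Longrightarrow> smooth_fun l \<Longrightarrow>
    \<exists>C\<ge>0. \<forall>z. norm (F (\<lambda>x. g x * exp (z * l x - cnj (z * l x)))) \<le> C * (1 + norm z) ^ N"
proof -
  obtain K C N where K: "compact K" and C: "C \<ge> 0" and
    b: "\<And>f M. smooth_fun f \<Longrightarrow> M \<ge> 0 \<Longrightarrow> (\<And>vs x. vs \<in> dirs N \<Longrightarrow> x \<in> K \<Longrightarrow> norm (dderiv vs f x) \<le> M)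
       \<Longrightarrow> norm (F f) \<le> C * M"
    by (rule comp_distr_bound[OF F]) blast
  show thesis
  proof (rule that[of N])
    fix g l :: "'a \<Rightarrow> complex" assume g: "smooth_fun g" and l: "smooth_fun l"
    define e where "e z x = z * l x - cnj (z * l x)" for z x
    have e: "smooth_fun (e z)" for z :: complex
      unfolding e_def by (intro smooth_fun_diff smooth_fun_cnj smooth_fun_mult smooth_fun_const l)
    have ex: "smooth_fun (\<lambda>x. exp (e z x))" for z :: complex by (rule smooth_fun_exp[OF e])
    have zl: "smooth_fun (\<lambda>x. z * l x)" for z :: complex by (intro smooth_fun_mult smooth_fun_const l)
    have pde: "pd v (e z) = (\<lambda>x. z * pd v l x - cnj z * cnj (pd v l x))" for v and z :: complex
      unfolding e_def pd_smooth_diff[OF zl smooth_fun_cnj[OF zl]] pd_smooth_linear[OF zl bounded_linear_cnj]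
        pd_smooth_linear[OF zl bounded_linear_cnj, THEN fun_cong] pd_smooth_cmult[OF l, THEN fun_cong] by simp
    have "\<exists>C\<ge>0. \<forall>z. \<forall>x\<in>K. norm (dderiv vs (\<lambda>x. g x * exp (e z x)) x) \<le> C * (1 + norm z) ^ length vs"
      if "smooth_fun g" for vs g
      using that
    proof (induction vs arbitrary: g rule: rev_induct)
      case Nil
      obtain R where R: "\<And>x. x \<in> K \<Longrightarrow> norm (g x) \<le> R" "R > 0"
        using compact_smooth_bounded[OF K Nil] by (auto simp: bounded_pos)
      have "norm (exp (e z x)) = 1" for z :: complex and x
        by (simp add: norm_exp_eq_Re e_def)
      then show ?case using R by (intro exI[of _ R]) (auto simp: norm_mult)
    next
      case (snoc v vs)
      note gs = snoc.prems
      have g1: "smooth_fun (pd v g)" by (rule smooth_fun_pd[OF gs])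
      have g2: "smooth_fun (\<lambda>x. g x * pd v l x)" by (intro smooth_fun_mult smooth_fun_pd l gs)
      have g3: "smooth_fun (\<lambda>x. g x * cnj (pd v l x))" by (intro smooth_fun_mult smooth_fun_cnj smooth_fun_pd l gs)
      obtain C1 C2 C3 where C: "C1 \<ge> 0" "C2 \<ge> 0" "C3 \<ge> 0"
        "\<And>z x. x \<in> K \<Longrightarrow> norm (dderiv vs (\<lambda>x. pd v g x * exp (e z x)) x) \<le> C1 * (1 + norm z) ^ length vs"
        "\<And>z x. x \<in> K \<Longrightarrow> norm (dderiv vs (\<lambda>x. g x * pd v l x * exp (e z x)) x) \<le> C2 * (1 + norm z) ^ length vs"
        "\<And>z x. x \<in> K \<Longrightarrow> norm (dderiv vs (\<lambda>x. g x * cnj (pd v l x) * exp (e z x)) x) \<le> C3 * (1 + norm z) ^ length vs"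
        using snoc.IH[OF g1] snoc.IH[OF g2] snoc.IH[OF g3] by blast
      have eq: "dderiv (vs @ [v]) (\<lambda>x. g x * exp (e z x)) =
        (\<lambda>x. dderiv vs (\<lambda>x. pd v g x * exp (e z x)) x +
             (z * dderiv vs (\<lambda>x. g x * pd v l x * exp (e z x)) x -
              cnj z * dderiv vs (\<lambda>x. g x * cnj (pd v l x) * exp (e z x)) x))" for z :: complex
      proof -
        have s1: "smooth_fun (\<lambda>x. pd v g x * exp (e z x))" by (rule smooth_fun_mult[OF g1 ex])
        have s2: "smooth_fun (\<lambda>x. g x * pd v l x * exp (e z x))" by (rule smooth_fun_mult[OF g2 ex])
        have s3: "smooth_fun (\<lambda>x. g x * cnj (pd v l x) * exp (e z x))" by (rule smooth_fun_mult[OF g3 ex])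
        have zs2: "smooth_fun (\<lambda>x. z * (g x * pd v l x * exp (e z x)))" by (rule smooth_fun_mult[OF smooth_fun_const s2])
        have zs3: "smooth_fun (\<lambda>x. cnj z * (g x * cnj (pd v l x) * exp (e z x)))" by (rule smooth_fun_mult[OF smooth_fun_const s3])
        have "pd v (\<lambda>x. g x * exp (e z x)) = (\<lambda>x. pd v g x * exp (e z x) +
            (z * (g x * pd v l x * exp (e z x)) - cnj z * (g x * cnj (pd v l x) * exp (e z x))))"
          unfolding pd_smooth_mult[OF gs ex] pd_smooth_exp[OF e, THEN fun_cong] pde[THEN fun_cong] by (simp add: algebra_simps)
        then show ?thesis
          unfolding dderiv_snoc
          by (simp only: dderiv_add[OF s1 smooth_fun_diff[OF zs2 zs3]] dderiv_diff[OF zs2 zs3]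
              dderiv_cmult[OF s2] dderiv_cmult[OF s3])
      qed
      show ?case
      proof (intro exI[of _ "C1 + C2 + C3"] conjI allI ballI)
        fix z :: complex and x assume x: "x \<in> K"
        let ?p = "(1 + norm z) ^ length vs"
        have "norm (dderiv (vs @ [v]) (\<lambda>x. g x * exp (e z x)) x) \<le>
          norm (dderiv vs (\<lambda>x. pd v g x * exp (e z x)) x) +
          (norm (z * dderiv vs (\<lambda>x. g x * pd v l x * exp (e z x)) x) +
           norm (cnj z * dderiv vs (\<lambda>x. g x * cnj (pd v l x) * exp (e z x)) x))"
          unfolding eq by (rule order_trans[OF norm_triangle_ineq add_left_mono[OF norm_triangle_ineq4]])
        also have "\<dots> \<le> C1 * ?p + (norm z * (C2 * ?p) + norm z * (C3 * ?p))"
          unfolding norm_mult complex_mod_cnj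
          by (intro add_mono mult_left_mono C(4-6) x norm_ge_zero)
        also have "\<dots> \<le> C1 * ?p * (1 + norm z) + ((1 + norm z) * (C2 * ?p) + (1 + norm z) * (C3 * ?p))"
        proof (intro add_mono mult_right_mono mult_nonneg_nonneg C(1-3))
          have "0 \<le> C1 * ?p" using C(1) by simp
          then show "C1 * ?p \<le> C1 * ?p * (1 + norm z)"
            using mult_left_mono[of 1 "1 + norm z" "C1 * ?p"] by simp
        qed auto
        also have "\<dots> = (C1 + C2 + C3) * (1 + norm z) ^ length (vs @ [v])"
          by (simp add: algebra_simps)
        finally show "norm (dderiv (vs @ [v]) (\<lambda>x. g x * exp (e z x)) x) \<le> (C1 + C2 + C3) * (1 + norm z) ^ length (vs @ [v])" .
      qed (use C in auto)
    qed
    then have "\<forall>vs. \<exists>C\<ge>0. \<forall>z. \<forall>x\<in>K. norm (dderiv vs (\<lambda>x. g x * exp (e z x)) x) \<le> C * (1 + norm z) ^ length vs"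
      using g by blast
    then obtain c where c: "\<And>vs. c vs \<ge> 0"
      "\<And>vs z x. x \<in> K \<Longrightarrow> norm (dderiv vs (\<lambda>x. g x * exp (e z x)) x) \<le> c vs * (1 + norm z) ^ length vs"
      by metis
    show "\<exists>C\<ge>0. \<forall>z. norm (F (\<lambda>x. g x * exp (z * l x - cnj (z * l x)))) \<le> C * (1 + norm z) ^ N"
    proof (intro exI[of _ "C * (\<Sum>vs\<in>dirs N. c vs)"] conjI allI)
      fix z :: complex
      have "norm (F (\<lambda>x. g x * exp (e z x))) \<le> C * ((\<Sum>vs\<in>dirs N. c vs) * (1 + norm z) ^ N)"
      proof (rule b)
        show "smooth_fun (\<lambda>x. g x * exp (e z x))" by (rule smooth_fun_mult[OF g ex])
        show "0 \<le> (\<Sum>vs\<in>dirs N. c vs) * (1 + norm z) ^ N" by (simp add: c sum_nonneg)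
        fix vs :: "'a list" and x assume vs: "vs \<in> dirs N" and x: "x \<in> K"
        have "norm (dderiv vs (\<lambda>x. g x * exp (e z x)) x) \<le> c vs * (1 + norm z) ^ length vs"
          by (rule c(2)[OF x])
        also have "\<dots> \<le> (\<Sum>vs\<in>dirs N. c vs) * (1 + norm z) ^ N"
          using vs by (intro mult_mono member_le_sum power_increasing finite_dirs sum_nonneg c) (auto simp: dirs_def c)
        finally show "norm (dderiv vs (\<lambda>x. g x * exp (e z x)) x) \<le> (\<Sum>vs\<in>dirs N. c vs) * (1 + norm z) ^ N" .
      qed
      then show "norm (F (\<lambda>x. g x * exp (z * l x - cnj (z * l x)))) \<le> C * (\<Sum>vs\<in>dirs N. c vs) * (1 + norm z) ^ N"
        by (simp add: e_def mult.assoc)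
    qed (simp add: C c sum_nonneg)
  qed
qed

section \<open>Density of the polynomials\<close>

text \<open>Polynomials in the real coordinates. Multiplying by one coordinate at a time, instead of
  closing under products, lets an induction absorb each new factor into a monomial carried
  along.\<close>

inductive ppoly :: "('a::euclidean_space \<Rightarrow> complex) \<Rightarrow> bool" where
  const: "ppoly (\<lambda>x. c)"
| var: "b \<in> Basis \<Longrightarrow> ppoly p \<Longrightarrow> ppoly (\<lambda>x. of_real (x \<bullet> b) * p x)"
| add: "ppoly p \<Longrightarrow> ppoly q \<Longrightarrow> ppoly (\<lambda>x. p x + q x)"

lemma bounded_linear_coord: "bounded_linear (\<lambda>x. complex_of_real (x \<bullet> b))"
  by (rule bounded_linear_compose[OF bounded_linear_of_real bounded_linear_inner_left])

lemma smooth_fun_coord: "smooth_fun (\<lambda>x. complex_of_real (x \<bullet> b))"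
  by (rule smooth_fun_bounded_linear[OF bounded_linear_coord])

lemma pd_coord: "pd v (\<lambda>x. complex_of_real (x \<bullet> b)) x = of_real (v \<bullet> b)"
  by (rule pd_eqI) (rule bounded_linear_imp_has_derivative[OF bounded_linear_coord])

lemma ppoly_smooth: "ppoly p \<Longrightarrow> smooth_fun p"
proof (induction rule: ppoly.induct)
  case (var b p)
  then show ?case by (intro smooth_fun_mult smooth_fun_coord)
qed auto

lemma ppoly_cmult: "ppoly p \<Longrightarrow> ppoly (\<lambda>x. c * p x)"
proof (induction rule: ppoly.induct)
  case (var b p)
  then show ?case using ppoly.var[OF var(1,3)] by (simp add: mult.left_commute)
next
  case (add p q)
  then show ?case using ppoly.add[OF add(3,4)] by (simp add: distrib_left)
qed (auto intro: ppoly.const)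

lemma ppoly_mult: "ppoly p \<Longrightarrow> ppoly q \<Longrightarrow> ppoly (\<lambda>x. p x * q x)"
proof (induction rule: ppoly.induct)
  case (var b p)
  then show ?case using ppoly.var[OF var(1), of "\<lambda>x. p x * q x"] by (simp add: mult.assoc)
next
  case (add p1 p2)
  then show ?case using ppoly.add[of "\<lambda>x. p1 x * q x" "\<lambda>x. p2 x * q x"] by (simp add: distrib_right)
qed (auto intro: ppoly_cmult)

lemma ppoly_diff: "ppoly p \<Longrightarrow> ppoly q \<Longrightarrow> ppoly (\<lambda>x. p x - q x)"
  using ppoly.add[of p "\<lambda>x. (-1) * q x"] ppoly_cmult[of q "-1"] by simp

lemma ppoly_power: "ppoly p \<Longrightarrow> ppoly (\<lambda>x. p x ^ n)"
  by (induction n) (auto intro: ppoly_mult ppoly.const)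

lemma ppoly_sum: "(\<And>i. i \<in> I \<Longrightarrow> ppoly (f i)) \<Longrightarrow> ppoly (\<lambda>x. \<Sum>i\<in>I. f i x)"
  by (induction I rule: infinite_finite_induct) (auto intro: ppoly.const ppoly.add)

lemma ppoly_coord: "b \<in> Basis \<Longrightarrow> ppoly (\<lambda>x. of_real (x \<bullet> b))"
  using ppoly.var[OF _ ppoly.const[of 1]] by simp

lemma real_polynomial_function_ppoly:
  fixes r :: "'a::euclidean_space \<Rightarrow> real"
  shows "real_polynomial_function r \<Longrightarrow> ppoly (\<lambda>x. of_real (r x))"
proof (induction rule: real_polynomial_function.induct)
  case (linear f)
  then interpret bounded_linear f .
  have "f x = (\<Sum>b\<in>Basis. (x \<bullet> b) * f b)" for x
    by (subst (1) euclidean_representation[symmetric, of x]) (simp add: sum scale del: euclidean_representation)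
  then have "complex_of_real (f x) = (\<Sum>b\<in>Basis. of_real (x \<bullet> b) * of_real (f b))" for x
    unfolding of_real_mult[symmetric] of_real_sum[symmetric] by (rule arg_cong[where f=complex_of_real])
  then have "(\<lambda>x. complex_of_real (f x)) = (\<lambda>x. \<Sum>b\<in>Basis. of_real (x \<bullet> b) * of_real (f b))"
    by (rule ext)
  moreover have "ppoly (\<lambda>x::'a. \<Sum>b\<in>Basis. of_real (x \<bullet> b) * of_real (f b))"
    by (rule ppoly_sum, rule ppoly.var, assumption, rule ppoly.const)
  ultimately show ?case by (simp only:)
next
  case (add f g)
  then show ?case using ppoly.add[OF add(3,4)] by simp
next
  case (mult f g)
  then show ?case using ppoly_mult[OF mult(3,4)] by simp
qed (rule ppoly.const)

lemma polynomial_function_ppoly: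
  fixes g :: "'a::euclidean_space \<Rightarrow> complex"
  assumes "polynomial_function g" shows "ppoly g"
proof -
  have "real_polynomial_function (\<lambda>x. Re (g x))" "real_polynomial_function (\<lambda>x. Im (g x))"
    using assms bounded_linear_Re bounded_linear_Im unfolding polynomial_function_def comp_def by blast+
  then have "ppoly (\<lambda>x. of_real (Re (g x)) + \<i> * of_real (Im (g x)))"
    by (intro ppoly.add ppoly_cmult real_polynomial_function_ppoly)
  then show ?thesis by (simp add: complex_eq[symmetric])
qed

lemma pd_coord_power:
  assumes "b \<in> Basis"
  shows "pd b (\<lambda>x. complex_of_real (x \<bullet> b) ^ n) x = of_nat n * of_real (x \<bullet> b) ^ (n - 1)"
proof -
  have "((\<lambda>w. w ^ n) has_field_derivative of_nat n * complex_of_real (x \<bullet> b) ^ (n - 1)) (at (complex_of_real (x \<bullet> b)))"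
    using DERIV_pow by (auto intro!: derivative_eq_intros)
  from pd_eqI[OF pd_field[OF smooth_fun_differentiable[OF smooth_fun_coord] this], of b]
  show ?thesis using assms by (simp add: pd_coord)
qed

lemma ppoly_antiderivative:
  fixes p :: "'a::euclidean_space \<Rightarrow> complex"
  assumes b: "b \<in> Basis"
  shows "ppoly p \<Longrightarrow> \<exists>P. ppoly P \<and> pd b P = p"
proof -
  \<comment> \<open>The additional power of the coordinate \<open>b\<close> strengthens the
    induction: a factor in direction \<open>b\<close> raises this power, and any other coordinate is
    constant along \<open>b\<close> and simply multiplies the antiderivative.\<close>
  have "\<exists>P. ppoly P \<and> pd b P = (\<lambda>x. of_real (x \<bullet> b) ^ n * p x)" if "ppoly p" for n p
    using that
  proof (induction arbitrary: n rule: ppoly.induct)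
    case (const c)
    let ?P = "\<lambda>x. c / of_nat (Suc n) * complex_of_real (x \<bullet> b) ^ Suc n"
    have "smooth_fun (\<lambda>x. complex_of_real (x \<bullet> b) ^ Suc n)"
      by (intro smooth_fun_power smooth_fun_coord)
    from pd_smooth_cmult[OF this, of "c / of_nat (Suc n)" b]
    have "pd b ?P = (\<lambda>x. of_real (x \<bullet> b) ^ n * c)"
      using pd_coord_power[OF b, of "Suc n"] by (simp add: mult.commute del: power_Suc of_nat_Suc)
    then show ?case
      using ppoly_cmult[OF ppoly_power[OF ppoly_coord[OF b]]] by blast
  next
    case (var d p)
    show ?case
    proof (cases "d = b")
      case True
      then show ?thesis using var.IH[of "Suc n"] by (simp add: mult.assoc mult.left_commute)
    next
      case False
      obtain P where P: "ppoly P" "pd b P = (\<lambda>x. of_real (x \<bullet> b) ^ n * p x)" using var.IH by blast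
      have "pd b (\<lambda>x. of_real (x \<bullet> d) * P x) = (\<lambda>x. of_real (x \<bullet> b) ^ n * (of_real (x \<bullet> d) * p x))"
        using False b var(1) fun_cong[OF P(2)]
        by (simp add: pd_smooth_mult[OF smooth_fun_coord ppoly_smooth[OF P(1)]] pd_coord inner_not_same_Basis mult.left_commute)
      then show ?thesis using ppoly.var[OF var(1) P(1)] by blast
    qed
  next
    case (add p q)
    obtain P where P: "ppoly P" "pd b P = (\<lambda>x. of_real (x \<bullet> b) ^ n * p x)" using add.IH by blast
    obtain Q where Q: "ppoly Q" "pd b Q = (\<lambda>x. of_real (x \<bullet> b) ^ n * q x)" using add.IH by blast
    have "pd b (\<lambda>x. P x + Q x) = (\<lambda>x. of_real (x \<bullet> b) ^ n * (p x + q x))"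
      using fun_cong[OF P(2)] fun_cong[OF Q(2)]
      by (simp add: pd_smooth_add[OF ppoly_smooth[OF P(1)] ppoly_smooth[OF Q(1)]] distrib_left)
    then show ?case using ppoly.add[OF P(1) Q(1)] by blast
  qed
  from this[of p 0] show "ppoly p \<Longrightarrow> \<exists>P. ppoly P \<and> pd b P = p" by simp
qed

section \<open>Approximation by restriction to a coordinate hyperplane\<close>

definition zero_coord :: "'a::euclidean_space \<Rightarrow> 'a \<Rightarrow> 'a" where
  "zero_coord b x = x - (x \<bullet> b) *\<^sub>R b"

lemma zero_coord_inner: "b \<in> Basis \<Longrightarrow> c \<in> Basis \<Longrightarrow> zero_coord b x \<bullet> c = (if c = b then 0 else x \<bullet> c)"
  by (auto simp: zero_coord_def inner_diff_left inner_Basis)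

lemma ppoly_zero_coord:
  assumes b: "b \<in> Basis" shows "ppoly p \<Longrightarrow> ppoly (\<lambda>x. p (zero_coord b x))"
proof (induction rule: ppoly.induct)
  case (var d p)
  then show ?case
    by (cases "d = b") (auto simp: zero_coord_inner b intro: ppoly.const ppoly.var)
qed (auto intro: ppoly.intros)

lemma bounded_linear_zero_coord: "bounded_linear (zero_coord b)"
  unfolding zero_coord_def[abs_def]
  by (intro bounded_linear_sub bounded_linear_ident bounded_linear_compose[OF bounded_linear_scaleR_left]
      bounded_linear_inner_left)

lemma zero_coord_has_derivative:
  assumes "smooth_fun f"
  shows "((\<lambda>x. f (zero_coord b x)) has_derivative (\<lambda>v. pd (zero_coord b v) f (zero_coord b x))) (at x)"
  by (rule has_derivative_compose[OF bounded_linear_imp_has_derivative[OF bounded_linear_zero_coord]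
        smooth_fun_has_derivative[OF assms]])

lemma smooth_fun_zero_coord:
  assumes "smooth_fun f" shows "smooth_fun (\<lambda>x. f (zero_coord b x))"
proof (rule smooth_fun_coinduct[where S="(\<lambda>f x. f (zero_coord b x)) ` Collect smooth_fun"])
  fix g :: "'a \<Rightarrow> complex"
  assume "g \<in> (\<lambda>f x. f (zero_coord b x)) ` Collect smooth_fun"
  then obtain h where h: "smooth_fun h" "g = (\<lambda>x. h (zero_coord b x))" by auto
  show "g differentiable (at x)" for x
    unfolding h(2) by (rule differentiableI[OF zero_coord_has_derivative[OF h(1)]])
  show "pd v g \<in> (\<lambda>f x. f (zero_coord b x)) ` Collect smooth_fun" for v
  proof
    show "pd v g = (\<lambda>x. pd (zero_coord b v) h (zero_coord b x))"
      unfolding h(2) by (rule ext, rule pd_eqI, rule zero_coord_has_derivative[OF h(1)])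
    show "pd (zero_coord b v) h \<in> Collect smooth_fun"
      using smooth_fun_pd[OF h(1)] by simp
  qed
qed (use assms in auto)

lemma dderiv_zero_coord:
  assumes f: "smooth_fun f" and b: "b \<in> Basis" and "set vs \<subseteq> Basis - {b}"
  shows "dderiv vs (\<lambda>x. f (zero_coord b x)) = (\<lambda>x. dderiv vs f (zero_coord b x))"
  using assms(3)
proof (induction vs)
  case (Cons v vs)
  have "zero_coord b v = v"
    using Cons.prems b by (auto simp: zero_coord_def inner_not_same_Basis)
  then have "pd v (\<lambda>x. dderiv vs f (zero_coord b x)) = (\<lambda>x. pd v (dderiv vs f) (zero_coord b x))"
    using pd_eqI[OF zero_coord_has_derivative[OF smooth_fun_dderiv[OF f, of vs]], of b _ v] by auto
  then show ?case using Cons by simp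
qed simp

lemma pd_zero_coord:
  assumes f: "smooth_fun f" and b: "b \<in> Basis"
  shows "pd b (\<lambda>x. f (zero_coord b x)) = (\<lambda>x. 0)"
proof
  fix x
  have "zero_coord b b = 0" using b by (simp add: zero_coord_def)
  moreover have "pd 0 f y = 0" for y
    using pd_scaleR[OF f, where s=0 and u=0 and x=y] by simp
  ultimately show "pd b (\<lambda>x. f (zero_coord b x)) x = 0"
    using pd_eqI[OF zero_coord_has_derivative[OF f], of b] by simp
qed

text \<open>Derivatives of a smooth function commute, so one occurrence of \<open>b\<close> can be
  moved to the innermost place.\<close>

lemma dderiv_remove1:
  assumes f: "smooth_fun f" and "b \<in> set vs"
  shows "dderiv vs f = dderiv (remove1 b vs) (pd b f)"
  using assms(2)
proof (induction vs)
  case (Cons v vs)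
  then show ?case using pd_dderiv[OF f, of vs v] by (cases "v = b") auto
qed simp

lemma coord_mean_value:
  assumes h: "smooth_fun h" and b: "b \<in> Basis"
    and bound: "\<And>s. s \<in> closed_segment 0 (x \<bullet> b) \<Longrightarrow> norm (pd b h (zero_coord b x + s *\<^sub>R b)) \<le> B"
  shows "norm (h x - h (zero_coord b x)) \<le> B * \<bar>x \<bullet> b\<bar>"
proof -
  let ?k = "\<lambda>s. h (zero_coord b x + s *\<^sub>R b)"
  have "norm (?k (x \<bullet> b) - ?k 0) \<le> B * norm (x \<bullet> b - 0)"
  proof (rule differentiable_bound[where S="closed_segment 0 (x \<bullet> b)"])
    fix s assume s: "s \<in> closed_segment 0 (x \<bullet> b)"
    show "(?k has_derivative (\<lambda>t. t *\<^sub>R pd b h (zero_coord b x + s *\<^sub>R b))) (at s within closed_segment 0 (x \<bullet> b))"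
      using smooth_fun_line_derivative[OF h, of "zero_coord b x" b s]
      unfolding has_vector_derivative_def by (rule has_derivative_at_withinI)
    show "onorm (\<lambda>t. t *\<^sub>R pd b h (zero_coord b x + s *\<^sub>R b)) \<le> B"
    proof (rule onorm_le)
      fix t :: real
      show "norm (t *\<^sub>R pd b h (zero_coord b x + s *\<^sub>R b)) \<le> B * norm t"
        using mult_left_mono[OF bound[OF s], of "\<bar>t\<bar>"] by (simp add: mult.commute)
    qed
  qed auto
  then show ?thesis by (simp add: zero_coord_def)
qed

text \<open>For one more direction \<open>b\<close>, integrate an approximation of the derivative of \<open>f\<close> along \<open>b\<close>, and correct it
  by an approximation of \<open>f\<close> on the hyperplane where the coordinate \<open>b\<close> vanishes.\<close>
lemma ppoly_approx:
  fixes K :: "'a::euclidean_space set"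
  assumes K: "K = cbox (- a) a" "0 \<in> K"
  shows "set bs \<subseteq> Basis \<Longrightarrow> smooth_fun f \<Longrightarrow> e > 0 \<Longrightarrow>
    \<exists>p. ppoly p \<and> (\<forall>vs. mset vs \<subseteq># mset bs \<longrightarrow> (\<forall>x\<in>K. norm (dderiv vs f x - dderiv vs p x) \<le> e))"
proof (induction bs arbitrary: f e)
  case Nil
  have "compact K" using K by (simp add: compact_cbox)
  from Stone_Weierstrass_polynomial_function[OF this smooth_fun_continuous[OF Nil(2)] Nil(3)]
  obtain p where p: "polynomial_function p" "\<And>x. x \<in> K \<Longrightarrow> norm (f x - p x) < e" by blast
  show ?case
    using polynomial_function_ppoly[OF p(1)] p(2) by (intro exI[of _ p]) (auto intro: less_imp_le)
next
  case (Cons b bs)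
  have b: "b \<in> Basis" and bs: "set bs \<subseteq> Basis" using Cons.prems by auto
  note f = Cons.prems(2)
  have ab: "a \<bullet> b \<ge> 0" using K b by (auto simp: mem_box)
  \<comment> \<open>Words containing \<open>b\<close> need an error of at most \<open>e\<close>. For
    the others the error is integrated over a segment of length at most \<open>a \<bullet> b\<close>
    and may cost \<open>e / 2\<close>; the other half is left for the hyperplane. The summand 1
    avoids division by zero.\<close>
  define e1 where "e1 = min e (e / (2 * (1 + a \<bullet> b)))"
  have e1: "e1 > 0" "e1 \<le> e" using \<open>e > 0\<close> ab by (auto simp: e1_def add_pos_nonneg)
  have e1': "e1 * (a \<bullet> b) \<le> e / 2"
  proof -
    have "e1 * (a \<bullet> b) \<le> e / (2 * (1 + a \<bullet> b)) * (1 + a \<bullet> b)"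
      using \<open>e > 0\<close> ab by (intro mult_mono) (auto simp: e1_def)
    also have "\<dots> = e / 2"
    proof -
      have "e / (2 * c) * c = e / 2" if "c \<noteq> 0" for c :: real using that by simp
      from this[of "1 + a \<bullet> b"] show ?thesis using ab by linarith
    qed
    finally show ?thesis .
  qed
  obtain p1 where p1: "ppoly p1"
    "\<And>vs x. mset vs \<subseteq># mset bs \<Longrightarrow> x \<in> K \<Longrightarrow> norm (dderiv vs (pd b f) x - dderiv vs p1 x) \<le> e1"
    using Cons.IH[OF bs smooth_fun_pd[OF f] e1(1), of b] by blast
  obtain p2 where p2: "ppoly p2"
    "\<And>vs x. mset vs \<subseteq># mset bs \<Longrightarrow> x \<in> K \<Longrightarrow> norm (dderiv vs f x - dderiv vs p2 x) \<le> e / 2"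
    using Cons.IH[OF bs f, of "e / 2"] \<open>e > 0\<close> by auto
  obtain Q where Q: "ppoly Q" "pd b Q = p1" using ppoly_antiderivative[OF b p1(1)] by blast
  let ?z = "zero_coord b"
  \<comment> \<open>On the hyperplane \<open>?z x = x\<close>, so \<open>P\<close> equals
    \<open>p2\<close> there, while the correction does not depend on the coordinate \<open>b\<close>
    and leaves the derivative \<open>p1\<close> of \<open>Q\<close> along \<open>b\<close>
    unchanged.\<close>
  define r where "r = (\<lambda>x. p2 x - Q x)"
  define P where "P = (\<lambda>x. Q x + r (?z x))"
  have r: "ppoly r" unfolding r_def by (rule ppoly_diff[OF p2(1) Q(1)])
  have P: "ppoly P" unfolding P_def by (rule ppoly.add[OF Q(1) ppoly_zero_coord[OF b r]])
  note sm = ppoly_smooth[OF P] ppoly_smooth[OF Q(1)] ppoly_smooth[OF p1(1)] ppoly_smooth[OF p2(1)] ppoly_smooth[OF r]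
  have pdP: "pd b P = p1"
    unfolding P_def pd_smooth_add[OF sm(2) smooth_fun_zero_coord[OF sm(5)]]
      fun_cong[OF pd_zero_coord[OF sm(5) b]] fun_cong[OF Q(2)] by simp
  define g where "g = (\<lambda>x. f x - P x)"
  have g: "smooth_fun g" unfolding g_def by (rule smooth_fun_diff[OF f sm(1)])
  have pdg: "pd b g = (\<lambda>x. pd b f x - p1 x)"
    unfolding g_def pd_smooth_diff[OF f sm(1)] fun_cong[OF pdP] ..
  have zz: "?z (?z x) = ?z x" for x using b by (simp add: zero_coord_def inner_diff_left)
  have gz: "(\<lambda>x. g (?z x)) = (\<lambda>x. (\<lambda>x. f x - p2 x) (?z x))"
    by (auto simp: g_def P_def r_def zz)
  \<comment> \<open>This is what the symmetric box is for: moving one coordinate between 0 and its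
    value stays inside \<open>K\<close>, so bounds on \<open>K\<close> can be integrated.\<close>
  have zK: "?z x + s *\<^sub>R b \<in> K" if "x \<in> K" "s \<in> closed_segment 0 (x \<bullet> b)" for x s
    unfolding K mem_box
  proof
    fix i :: 'a assume i: "i \<in> Basis"
    have x: "- (a \<bullet> j) \<le> x \<bullet> j" "x \<bullet> j \<le> a \<bullet> j" if "j \<in> Basis" for j
      using that \<open>x \<in> K\<close> K by (auto simp: mem_box)
    have "- (a \<bullet> b) \<le> s" "s \<le> a \<bullet> b"
      using that(2) x[OF b] ab by (auto simp: closed_segment_eq_real_ivl split: if_splits)
    then show "- a \<bullet> i \<le> (?z x + s *\<^sub>R b) \<bullet> i \<and> (?z x + s *\<^sub>R b) \<bullet> i \<le> a \<bullet> i"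
      using x[OF i] b i by (auto simp: inner_add_left zero_coord_inner inner_Basis)
  qed
  \<comment> \<open>A word containing \<open>b\<close> sees only the derivative of \<open>g\<close>
    along \<open>b\<close>, controlled by \<open>p1\<close>. Any other word is compared with its
    value on the hyperplane, controlled by \<open>p2\<close>.\<close>
  have main: "norm (dderiv vs g x) \<le> e" if vs: "mset vs \<subseteq># mset (b # bs)" and x: "x \<in> K" for vs x
  proof (cases "b \<in> set vs")
    case True
    then have *: "mset (remove1 b vs) \<subseteq># mset bs"
      using vs by (simp add: subset_eq_diff_conv)
    have "dderiv vs g x = dderiv (remove1 b vs) (pd b f) x - dderiv (remove1 b vs) p1 x"
      unfolding dderiv_remove1[OF g True] pdg by (simp add: dderiv_diff[OF smooth_fun_pd[OF f] sm(3)])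
    then show ?thesis using p1(2)[OF * x] e1 by simp
  next
    case False
    have vsb: "mset vs \<subseteq># mset bs"
    proof (rule mset_subset_eqI)
      fix v
      show "count (mset vs) v \<le> count (mset bs) v"
      proof (cases "v = b")
        case True
        then have "count (mset vs) v = 0" using False by (simp only: count_eq_zero_iff set_mset_mset not_False_eq_True)
        then show ?thesis by linarith
      qed (use mset_subset_eq_count[OF vs, of v] in auto)
    qed
    then have vs': "set vs \<subseteq> Basis - {b}"
      using bs False set_mset_mono[OF vsb] by auto
    have 1: "dderiv vs g (?z x) = dderiv vs f (?z x) - dderiv vs p2 (?z x)"
    proof -
      have "dderiv vs g (?z x) = dderiv vs (\<lambda>x. g (?z x)) x"
        by (simp add: dderiv_zero_coord[OF g b vs'])
      also have "\<dots> = dderiv vs (\<lambda>x. f x - p2 x) (?z x)"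
        unfolding gz by (simp add: dderiv_zero_coord[OF smooth_fun_diff[OF f sm(4)] b vs'])
      also have "\<dots> = dderiv vs f (?z x) - dderiv vs p2 (?z x)"
        by (simp add: dderiv_diff[OF f sm(4)])
      finally show ?thesis .
    qed
    have "?z x \<in> K" using zK[OF x, of 0] by simp
    then have 2: "norm (dderiv vs g (?z x)) \<le> e / 2"
      unfolding 1 by (rule p2(2)[OF vsb])
    have "norm (dderiv vs g x - dderiv vs g (?z x)) \<le> e1 * \<bar>x \<bullet> b\<bar>"
    proof (rule coord_mean_value[OF smooth_fun_dderiv[OF g] b])
      fix s assume s: "s \<in> closed_segment 0 (x \<bullet> b)"
      have "pd b (dderiv vs g) y = dderiv vs (pd b f) y - dderiv vs p1 y" for y
        unfolding pd_dderiv[OF g, THEN fun_cong] pdg by (simp add: dderiv_diff[OF smooth_fun_pd[OF f] sm(3)])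
      then show "norm (pd b (dderiv vs g) (?z x + s *\<^sub>R b)) \<le> e1"
        using p1(2)[OF vsb zK[OF x s]] by simp
    qed
    also have "\<dots> \<le> e1 * (a \<bullet> b)"
      using x K b e1 by (intro mult_left_mono) (auto simp: mem_box abs_le_iff)
    finally have 3: "norm (dderiv vs g x - dderiv vs g (?z x)) \<le> e / 2" using e1' by linarith
    show ?thesis
      using norm_triangle_ineq[of "dderiv vs g x - dderiv vs g (?z x)" "dderiv vs g (?z x)"] 2 3 by simp
  qed
  show ?case
    using P main by (intro exI[of _ P]) (auto simp: g_def dderiv_diff[OF f sm(1)])
qed

lemma ppoly_dense:
  fixes K :: "'a::euclidean_space set"
  assumes K: "compact K" and f: "smooth_fun f"
  obtains p where "\<And>n. ppoly (p n)" "cconv K p f"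
proof -
  obtain a where a: "insert 0 K \<subseteq> cbox (- a) a"
    using bounded_subset_cbox_symmetric[of "insert 0 K"] compact_imp_bounded[OF K] by auto
  obtain B :: "'a list" where B: "set B = Basis" using finite_list[OF finite_Basis] by blast
  \<comment> \<open>With \<open>n\<close> copies of the basis, every word of length at most
    \<open>n\<close> is a sub-multiset, so \<open>p n\<close> approximates all derivatives up to
    order \<open>n\<close> with error 1/(n+1).\<close>
  define bs where "bs n = concat (replicate n B)" for n
  have bs: "set (bs n) \<subseteq> Basis" for n using B by (auto simp: bs_def)
  have "\<exists>p. ppoly p \<and> (\<forall>vs. mset vs \<subseteq># mset (bs n) \<longrightarrow>
      (\<forall>x\<in>cbox (- a) a. norm (dderiv vs f x - dderiv vs p x) \<le> inverse (Suc n)))" for n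
    by (rule ppoly_approx[OF refl _ bs f]) (use a in auto)
  then obtain p where p: "\<And>n. ppoly (p n)"
    "\<And>n vs x. mset vs \<subseteq># mset (bs n) \<Longrightarrow> x \<in> cbox (- a) a \<Longrightarrow>
       norm (dderiv vs f x - dderiv vs (p n) x) \<le> inverse (Suc n)"
    by metis
  have cnt: "count (mset (bs n)) v \<ge> n" if "v \<in> Basis" for n v
  proof (induction n)
    case (Suc n)
    have "count (mset B) v \<ge> 1" using that B by (simp add: Suc_le_eq)
    from add_mono[OF this Suc] show ?case by (simp add: bs_def)
  qed simp
  have "cconv K p f"
    unfolding cconv_def
  proof (intro allI impI)
    fix vs :: "'a list" assume vs: "set vs \<subseteq> Basis"
    have sub: "mset vs \<subseteq># mset (bs n)" if "n \<ge> length vs" for n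
    proof (rule mset_subset_eqI)
      fix v
      show "count (mset vs) v \<le> count (mset (bs n)) v"
      proof (cases "v \<in> set vs")
        case True
        then show ?thesis
          using cnt[of v n] vs that count_le_length[of vs v] by (simp add: subset_iff count_mset)
      next
        case False
        then have "count (mset vs) v = 0" by (simp only: count_eq_zero_iff set_mset_mset not_False_eq_True)
        then show ?thesis by linarith
      qed
    qed
    show "uniform_limit K (\<lambda>n. dderiv vs (p n)) (dderiv vs f) sequentially"
    proof (rule uniform_limitI)
      fix e :: real assume "e > 0"
      then have "\<forall>\<^sub>F n in sequentially. inverse (real (Suc n)) < e"
        using LIMSEQ_inverse_real_of_nat by (metis order_tendstoD(2))
      then show "\<forall>\<^sub>F n in sequentially. \<forall>x\<in>K. dist (dderiv vs (p n) x) (dderiv vs f x) < e"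
        using eventually_ge_at_top[of "length vs"]
      proof eventually_elim
        case (elim n)
        show ?case
        proof
          fix x assume "x \<in> K"
          then have "norm (dderiv vs f x - dderiv vs (p n) x) \<le> inverse (Suc n)"
            using a by (intro p(2) sub elim) auto
          then show "dist (dderiv vs (p n) x) (dderiv vs f x) < e"
            using elim by (simp add: dist_norm norm_minus_commute)
        qed
      qed
    qed
  qed
  then show thesis using p(1) that by blast
qed

section \<open>Bump functions and the annihilator of a distribution\<close>

lemma flatexp_nonneg: "flatexp n t \<ge> 0"
  by (simp add: flatexp_def)

lemma flatexp_pos: "t > 0 \<Longrightarrow> flatexp n t > 0"
  by (simp add: flatexp_def)

lemma flatexp_zero: "t \<le> 0 \<Longrightarrow> flatexp n t = 0"
  by (simp add: flatexp_def)

text \<open>The usual quotient A / (A + B) of flat functions, written in the squared distance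
  because the distance is not smooth at \<open>q\<close>. The denominator is positive since every
  point is closer than 2\<rho> or farther than \<rho>.\<close>

lemma bump_exists:
  fixes q :: "'a::euclidean_space"
  assumes "\<rho> > 0"
  obtains u where "smooth_fun u" "\<And>x. dist x q \<le> \<rho> \<Longrightarrow> u x = 1" "\<And>x. dist x q \<ge> 2 * \<rho> \<Longrightarrow> u x = 0"
proof -
  define N where "N x = (\<Sum>b\<in>Basis. (complex_of_real (x \<bullet> b) - of_real (q \<bullet> b))\<^sup>2)" for x
  have N: "smooth_fun N"
    unfolding N_def by (intro smooth_fun_sum smooth_fun_power smooth_fun_diff smooth_fun_coord smooth_fun_const)
  have N_eq: "N x = of_real ((dist x q)\<^sup>2)" for x
    unfolding N_def dist_norm power2_norm_eq_inner
    by (subst euclidean_inner) (simp add: inner_diff_left power2_eq_square)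
  define A where "A x = complex_of_real (flatexp 0 (Re (of_real (4 * \<rho>\<^sup>2) - N x)))" for x
  define B where "B x = complex_of_real (flatexp 0 (Re (N x - of_real (\<rho>\<^sup>2))))" for x
  have A: "smooth_fun A" and B: "smooth_fun B"
    unfolding A_def B_def by (intro smooth_fun_flat smooth_fun_diff N smooth_fun_const)+
  have "A x + B x \<noteq> 0" for x
  proof -
    have "flatexp 0 (4 * \<rho>\<^sup>2 - (dist x q)\<^sup>2) + flatexp 0 ((dist x q)\<^sup>2 - \<rho>\<^sup>2) > 0"
    proof (cases "(dist x q)\<^sup>2 < 4 * \<rho>\<^sup>2")
      case True
      then show ?thesis by (intro add_pos_nonneg flatexp_pos flatexp_nonneg) auto
    next
      case False
      moreover have "\<rho>\<^sup>2 > 0" using assms by simp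
      ultimately show ?thesis by (intro add_nonneg_pos flatexp_pos flatexp_nonneg) linarith
    qed
    then show ?thesis
      unfolding A_def B_def N_eq of_real_add[symmetric] of_real_diff[symmetric] Re_complex_of_real of_real_eq_0_iff
      by linarith
  qed
  note AB = this
  show thesis
  proof (rule that[of "\<lambda>x. A x / (A x + B x)"])
    show "smooth_fun (\<lambda>x. A x / (A x + B x))"
      by (intro smooth_fun_divide smooth_fun_add A B AB)
    fix x
    show "A x / (A x + B x) = 1" if "dist x q \<le> \<rho>"
    proof -
      have "(dist x q)\<^sup>2 \<le> \<rho>\<^sup>2" using that by (intro power_mono) auto
      then have "B x = 0" by (simp add: B_def N_eq flatexp_zero)
      then show ?thesis using AB[of x] by simp
    qed
    show "A x / (A x + B x) = 0" if "dist x q \<ge> 2 * \<rho>"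
    proof -
      have "(2 * \<rho>)\<^sup>2 \<le> (dist x q)\<^sup>2" using that assms by (intro power_mono) auto
      then have "A x = 0" by (simp add: A_def N_eq flatexp_zero power_mult_distrib)
      then show ?thesis by simp
    qed
  qed
qed

text \<open>The ideal of smooth \<open>g\<close> for which the distribution gF is zero. Testing
  against all smooth \<open>f\<close>, and not only polynomials, is what allows multiplication by
  cutoffs.\<close>

definition Ann :: "(('a::euclidean_space \<Rightarrow> complex) \<Rightarrow> complex) \<Rightarrow> ('a \<Rightarrow> complex) set" where
  "Ann F = {g. smooth_fun g \<and> (\<forall>f. smooth_fun f \<longrightarrow> F (\<lambda>x. g x * f x) = 0)}"

lemma Ann_smooth: "g \<in> Ann F \<Longrightarrow> smooth_fun g"
  by (simp add: Ann_def)

lemma Ann_D: "g \<in> Ann F \<Longrightarrow> smooth_fun f \<Longrightarrow> F (\<lambda>x. g x * f x) = 0"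
  by (simp add: Ann_def)

lemma Ann_mult_right:
  assumes "g \<in> Ann F" "smooth_fun h" shows "(\<lambda>x. g x * h x) \<in> Ann F"
proof -
  have "F (\<lambda>x. g x * h x * f x) = 0" if f: "smooth_fun f" for f
    using Ann_D[OF assms(1) smooth_fun_mult[OF assms(2) f]] by (simp add: mult.assoc)
  then show ?thesis
    using smooth_fun_mult[OF Ann_smooth[OF assms(1)] assms(2)] by (simp add: Ann_def)
qed

lemma Ann_add:
  assumes F: "comp_distr F" and "g \<in> Ann F" "h \<in> Ann F" shows "(\<lambda>x. g x + h x) \<in> Ann F"
proof -
  have "F (\<lambda>x. (g x + h x) * f x) = 0" if f: "smooth_fun f" for f
    using comp_distr_add[OF F smooth_fun_mult[OF Ann_smooth f] smooth_fun_mult[OF Ann_smooth f], OF assms(2,3)]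
      Ann_D[OF assms(2) f] Ann_D[OF assms(3) f] by (simp add: distrib_right)
  then show ?thesis
    using smooth_fun_add[OF Ann_smooth[OF assms(2)] Ann_smooth[OF assms(3)]] by (simp add: Ann_def)
qed

lemma Ann_zero: "comp_distr F \<Longrightarrow> (\<lambda>x. 0) \<in> Ann F"
  by (simp add: Ann_def comp_distr_zero)

lemma Ann_sum:
  assumes F: "comp_distr F" and "\<And>i. i \<in> I \<Longrightarrow> g i \<in> Ann F" shows "(\<lambda>x. \<Sum>i\<in>I. g i x) \<in> Ann F"
  using assms(2)
proof (induction I rule: infinite_finite_induct)
  case (insert i I)
  then show ?case
    using Ann_add[OF F, of "g i" "\<lambda>x. \<Sum>i\<in>I. g i x"] by simp
qed (simp_all add: Ann_zero[OF F])

text \<open>The quotient \<open>\<psi> / E\<close>, which is singular at the zeros of \<open>E\<close>, is written as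
  \<open>\<psi> * cnj E / D\<close>, where \<open>D\<close> has no zeros and equals \<open>E * cnj E\<close> on the support of \<open>\<psi>\<close>.\<close>
lemma Ann_divide:
  assumes gE: "(\<lambda>x. g x * E x) \<in> Ann F" and E: "smooth_fun E" and \<psi>: "smooth_fun \<psi>"
    and \<epsilon>: "\<epsilon> > 0" "\<And>x. \<psi> x \<noteq> 0 \<Longrightarrow> \<epsilon> \<le> (norm (E x))\<^sup>2"
  shows "(\<lambda>x. g x * \<psi> x) \<in> Ann F"
proof -
  \<comment> \<open>The flat term is positive exactly where the squared modulus of \<open>E\<close>
    is below \<epsilon>, in particular at the zeros of \<open>E\<close>.\<close>
  define D where "D x = E x * cnj (E x) + complex_of_real (flatexp 0 (Re (of_real \<epsilon> - E x * cnj (E x))))" for x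
  have EE: "E x * cnj (E x) = of_real ((norm (E x))\<^sup>2)" for x
    by (metis complex_norm_square)
  have D: "smooth_fun D"
    unfolding D_def
    by (intro smooth_fun_add smooth_fun_flat smooth_fun_diff smooth_fun_mult smooth_fun_cnj smooth_fun_const E)
  have D0: "D x \<noteq> 0" for x
  proof -
    have "(norm (E x))\<^sup>2 + flatexp 0 (\<epsilon> - (norm (E x))\<^sup>2) > 0"
    proof (cases "E x = 0")
      case True
      then show ?thesis using \<epsilon>(1) by (simp add: flatexp_pos)
    next
      case False
      then show ?thesis by (intro add_pos_nonneg flatexp_nonneg) auto
    qed
    then show ?thesis
      unfolding D_def EE of_real_add[symmetric] of_real_diff[symmetric] Re_complex_of_real of_real_eq_0_iff
      by linarith
  qed
  have eq: "(\<lambda>x. g x * \<psi> x) = (\<lambda>x. g x * E x * (\<psi> x * cnj (E x) / D x))"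
  proof
    fix x
    show "g x * \<psi> x = g x * E x * (\<psi> x * cnj (E x) / D x)"
    proof (cases "\<psi> x = 0")
      case False
      from \<epsilon>(2)[OF False] have "D x = E x * cnj (E x)"
        by (simp add: D_def EE flatexp_zero del: of_real_power)
      then show ?thesis using D0[of x] by (simp add: field_simps)
    qed simp
  qed
  show ?thesis
    unfolding eq by (intro Ann_mult_right[OF gE] smooth_fun_divide smooth_fun_mult smooth_fun_cnj \<psi> E D D0)
qed

text \<open>Polynomial approximations of \<open>f\<close> remain convergent for \<open>F\<close>
  after multiplication by \<open>h\<close>, so the vanishing on polynomials passes to the
  limit.\<close>

lemma Ann_ppolyI:
  assumes F: "comp_distr F" and h: "smooth_fun h" and 0: "\<And>p. ppoly p \<Longrightarrow> F (\<lambda>x. h x * p x) = 0"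
  shows "h \<in> Ann F"
proof -
  obtain K where K: "compact K" and *:
    "\<And>f g h. (\<And>n. smooth_fun (f n)) \<Longrightarrow> smooth_fun g \<Longrightarrow> smooth_fun h \<Longrightarrow> cconv K f g
       \<Longrightarrow> (\<lambda>n. F (\<lambda>x. h x * f n x)) \<longlonglongrightarrow> F (\<lambda>x. h x * g x)"
    by (rule comp_distr_mult_cconv[OF F]) blast
  have "F (\<lambda>x. h x * f x) = 0" if f: "smooth_fun f" for f
  proof -
    obtain p where p: "\<And>n. ppoly (p n)" "cconv K p f" by (rule ppoly_dense[OF K f]) blast
    have "(\<lambda>n. F (\<lambda>x. h x * p n x)) \<longlonglongrightarrow> F (\<lambda>x. h x * f x)"
      by (rule *[OF ppoly_smooth[OF p(1)] f h p(2)])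
    then show ?thesis by (simp add: 0[OF p(1)] LIMSEQ_const_iff)
  qed
  then show ?thesis using h by (simp add: Ann_def)
qed

section \<open>Reduction to monomials in the coordinates and their conjugates\<close>

lemma bounded_linear_component: "bounded_linear (\<lambda>x::complex^'d::finite. x $ i)"
  by (rule bounded_linear_vec_nth)

lemma smooth_fun_component: "smooth_fun (\<lambda>x::complex^'d::finite. x $ i)"
  by (rule smooth_fun_bounded_linear[OF bounded_linear_component])

lemma smooth_fun_monom: "smooth_fun (monom \<alpha> \<beta>)"
  unfolding monom_def by (intro smooth_fun_prod smooth_fun_mult smooth_fun_power smooth_fun_cnj smooth_fun_component)

lemma monom_upd1: "monom (\<alpha>(i := Suc (\<alpha> i))) \<beta> x = x $ i * monom \<alpha> \<beta> x"
  unfolding monom_def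
  by (subst (1 2) prod.remove[of UNIV i]) (auto intro!: prod.cong simp: mult.assoc)

lemma monom_upd2: "monom \<alpha> (\<beta>(i := Suc (\<beta> i))) x = cnj (x $ i) * monom \<alpha> \<beta> x"
  unfolding monom_def
  by (subst (1 2) prod.remove[of UNIV i]) (auto intro!: prod.cong simp: mult.assoc mult.left_commute)

lemma Basis_coord_cases:
  assumes "b \<in> (Basis :: (complex^'d::finite) set)"
  obtains (re) i where "\<And>x. complex_of_real (x \<bullet> b) = (x $ i + cnj (x $ i)) / 2"
  | (im) i where "\<And>x. complex_of_real (x \<bullet> b) = - \<i> * (x $ i - cnj (x $ i)) / 2"
proof -
  obtain i c where b: "b = axis i c" "c \<in> (Basis :: complex set)"
    using assms by (auto simp: Basis_vec_def)
  then consider "c = 1" | "c = \<i>" by (auto simp: Basis_complex_def)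
  then show thesis
  proof cases
    case 1
    have "complex_of_real (x \<bullet> b) = (x $ i + cnj (x $ i)) / 2" for x
      by (simp add: b inner_axis 1 inner_complex_def complex_eq_iff)
    then show thesis by (rule re)
  next
    case 2
    have "complex_of_real (x \<bullet> b) = - \<i> * (x $ i - cnj (x $ i)) / 2" for x
      by (simp add: b inner_axis 2 inner_complex_def complex_eq_iff)
    then show thesis by (rule im)
  qed
qed

lemma Ann_monomI:
  fixes F :: "(complex^'d::finite \<Rightarrow> complex) \<Rightarrow> complex"
  assumes F: "comp_distr F" and h: "smooth_fun h" and 0: "\<And>\<alpha> \<beta>. F (\<lambda>x. h x * monom \<alpha> \<beta> x) = 0"
  shows "h \<in> Ann F"
proof (rule Ann_ppolyI[OF F h])
  \<comment> \<open>A real coordinate is a combination of \<open>x $ i\<close> and its conjugate,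
    each of which is absorbed by raising one exponent; hence the induction over arbitrary \<alpha>
    and \<beta>.\<close>
  have *: "F (\<lambda>x. h x * monom \<alpha> \<beta> x * p x) = 0" if "ppoly p" for p \<alpha> \<beta>
    using that
  proof (induction arbitrary: \<alpha> \<beta> rule: ppoly.induct)
    case (const c)
    have "F (\<lambda>x. c * (h x * monom \<alpha> \<beta> x)) = 0"
      using comp_distr_cmult[OF F smooth_fun_mult[OF h smooth_fun_monom], of c \<alpha> \<beta>] 0 by simp
    then show ?case by (simp add: mult.commute)
  next
    case (var b p)
    have p: "smooth_fun p" using var by (simp add: ppoly_smooth)
    have sm: "smooth_fun (\<lambda>x. h x * monom \<alpha> \<beta> x * p x)" for \<alpha> \<beta>
      by (intro smooth_fun_mult h smooth_fun_monom p)
    have lin: "F (\<lambda>x. c * (h x * monom \<alpha> \<beta> x * p x) + d * (h x * monom \<alpha>' \<beta>' x * p x)) = 0"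
      for c d \<alpha> \<beta> \<alpha>' \<beta>'
      using comp_distr_add[OF F smooth_fun_mult[OF smooth_fun_const[of c] sm[of \<alpha> \<beta>]]
          smooth_fun_mult[OF smooth_fun_const[of d] sm[of \<alpha>' \<beta>']]]
      by (simp add: comp_distr_cmult[OF F sm] var.IH)
    show ?case
      using \<open>b \<in> Basis\<close>
    proof (cases b rule: Basis_coord_cases)
      case (re i)
      have "(\<lambda>x. h x * monom \<alpha> \<beta> x * (complex_of_real (x \<bullet> b) * p x)) =
        (\<lambda>x. (1/2) * (h x * monom (\<alpha>(i := Suc (\<alpha> i))) \<beta> x * p x) + (1/2) * (h x * monom \<alpha> (\<beta>(i := Suc (\<beta> i))) x * p x))"
        unfolding re monom_upd1 monom_upd2 by (simp add: field_simps)
      then show ?thesis by (simp only: lin)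
    next
      case (im i)
      have "(\<lambda>x. h x * monom \<alpha> \<beta> x * (complex_of_real (x \<bullet> b) * p x)) =
        (\<lambda>x. (-\<i>/2) * (h x * monom (\<alpha>(i := Suc (\<alpha> i))) \<beta> x * p x) + (\<i>/2) * (h x * monom \<alpha> (\<beta>(i := Suc (\<beta> i))) x * p x))"
        unfolding im monom_upd1 monom_upd2 by (simp add: field_simps)
      then show ?thesis by (simp only: lin)
    qed
  next
    case (add p q)
    have "smooth_fun (\<lambda>x. h x * monom \<alpha> \<beta> x * r x)" if "ppoly r" for r
      by (intro smooth_fun_mult h smooth_fun_monom ppoly_smooth that)
    from comp_distr_add[OF F this[OF add(1)] this[OF add(2)]]
    show ?case using add.IH by (simp add: distrib_left)
  qed
  fix p :: "complex^'d \<Rightarrow> complex" assume "ppoly p"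
  from *[OF this, of "\<lambda>_. 0" "\<lambda>_. 0"] show "F (\<lambda>x. h x * p x) = 0"
    by (simp add: monom_def)
qed

section \<open>Linear algebra\<close>

text \<open>Matrices are plain functions, so entries may depend on a parameter and a row is replaced
  by function update.\<close>

definition detn :: "nat \<Rightarrow> (nat \<Rightarrow> nat \<Rightarrow> complex) \<Rightarrow> complex" where
  "detn m A = Determinant.det (Matrix.mat m m (\<lambda>(i, j). A i j))"

lemma detn_cong: "(\<And>i j. i < m \<Longrightarrow> j < m \<Longrightarrow> A i j = B i j) \<Longrightarrow> detn m A = detn m B"
  unfolding detn_def by (rule arg_cong[where f=Determinant.det]) auto

lemma detn_sum:
  "detn m A = (\<Sum>p | p permutes {0..<m}. signof p * (\<Prod>i = 0..<m. A i (p i)))"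
proof -
  have "p i < m" if "p permutes {0..<m}" "i < m" for p i
    using permutes_in_image[OF that(1), of i] that(2) by simp
  then show ?thesis
    unfolding detn_def Determinant.det_def by (auto intro!: sum.cong prod.cong)
qed

lemma detn_mult: "detn m A * detn m B = detn m (\<lambda>i j. \<Sum>k<m. A i k * B k j)"
proof -
  let ?A = "Matrix.mat m m (\<lambda>(i, j). A i j)" and ?B = "Matrix.mat m m (\<lambda>(i, j). B i j)"
  have "detn m A * detn m B = Determinant.det (?A * ?B)"
    unfolding detn_def by (rule Determinant.det_mult[symmetric]) auto
  also have "?A * ?B = Matrix.mat m m (\<lambda>(i, j). \<Sum>k<m. A i k * B k j)"
    by (rule eq_matI) (auto simp: scalar_prod_def lessThan_atLeast0 intro!: sum.cong)
  finally show ?thesis by (simp add: detn_def)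
qed

lemma detn_one: "detn m (\<lambda>i j. if i = j then 1 else 0) = 1"
proof -
  have "Matrix.mat m m (\<lambda>(i, j). if i = j then 1 else 0) = (1\<^sub>m m :: complex mat)"
    by (rule eq_matI) auto
  then show ?thesis by (simp add: detn_def)
qed

text \<open>Cramer's rule for the row equation x A = v, without dividing by the determinant.
  Expanding along the replaced row exhibits the numerators as the entries of v times the adjugate,
  and the adjugate times A is det A times the identity.\<close>

lemma detn_cramer:
  assumes "j < m"
  shows "(\<Sum>k<m. detn m (A(k := v)) * A k j) = detn m A * v j"
proof -
  let ?A = "Matrix.mat m m (\<lambda>(i, j). A i j)"
  have A: "?A \<in> carrier_mat m m" by simp
  have exp: "detn m (A(k := v)) = (\<Sum>i<m. v i * adj_mat ?A $$ (i, k))" if k: "k < m" for k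
  proof -
    let ?B = "Matrix.mat m m (\<lambda>(i, j). (A(k := v)) i j)"
    have "detn m (A(k := v)) = (\<Sum>i<m. ?B $$ (k, i) * cofactor ?B k i)"
      unfolding detn_def by (rule laplace_expansion_row[OF _ k]) simp
    also have "\<dots> = (\<Sum>i<m. v i * adj_mat ?A $$ (i, k))"
    proof (rule sum.cong[OF refl])
      fix i assume "i \<in> {..<m}"
      then have i: "i < m" by simp
      have "mat_delete ?B k i = mat_delete ?A k i"
        using k i by (auto simp: mat_delete_def intro!: eq_matI)
      then show "?B $$ (k, i) * cofactor ?B k i = v i * adj_mat ?A $$ (i, k)"
        using k i by (simp add: cofactor_def adj_mat_def)
    qed
    finally show ?thesis .
  qed
  have "(\<Sum>k<m. detn m (A(k := v)) * A k j) = (\<Sum>k<m. \<Sum>i<m. v i * (adj_mat ?A $$ (i, k) * A k j))"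
    by (rule sum.cong) (simp_all add: exp sum_distrib_right mult.assoc)
  also have "\<dots> = (\<Sum>i<m. v i * (\<Sum>k<m. adj_mat ?A $$ (i, k) * A k j))"
    by (subst sum.swap) (simp add: sum_distrib_left)
  also have "\<dots> = (\<Sum>i<m. v i * (adj_mat ?A * ?A) $$ (i, j))"
    using assms adj_mat(1)[OF A]
    by (intro sum.cong refl arg_cong2[where f="(*)"])
      (auto simp: scalar_prod_def lessThan_atLeast0 intro!: sum.cong)
  also have "\<dots> = (\<Sum>i<m. if i = j then v i * detn m A else 0)"
    unfolding adj_mat(3)[OF A] using assms by (intro sum.cong refl) (auto simp: detn_def)
  also have "\<dots> = detn m A * v j"
    using assms by (simp add: sum.delta' sum.delta mult.commute)
  finally show ?thesis .
qed

text \<open>Gaussian elimination: a nonzero entry of the new equation serves as pivot, its unknown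
  is eliminated from the other equations, and its value is recovered afterwards.\<close>

lemma homogeneous_system_solvable:
  fixes a :: "'e \<Rightarrow> 'j \<Rightarrow> complex"
  assumes "finite E" "finite J" "card E < card J"
  shows "\<exists>c. (\<exists>j\<in>J. c j \<noteq> 0) \<and> (\<forall>e\<in>E. (\<Sum>j\<in>J. c j * a e j) = 0)"
  using assms
proof (induction E arbitrary: J a rule: finite_induct)
  case empty
  then obtain j where "j \<in> J" by fastforce
  then show ?case by (intro exI[of _ "\<lambda>_. 1"]) auto
next
  case (insert e E)
  show ?case
  proof (cases "\<forall>j\<in>J. a e j = 0")
    case True
    obtain c where "\<exists>j\<in>J. c j \<noteq> 0" "\<forall>e\<in>E. (\<Sum>j\<in>J. c j * a e j) = 0"
      using insert.IH[of J a] insert.prems insert.hyps by auto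
    then show ?thesis using True by (intro exI[of _ c]) auto
  next
    case False
    then obtain j0 where j0: "j0 \<in> J" "a e j0 \<noteq> 0" by blast
    define a' where "a' e' j = a e' j - a e' j0 * a e j / a e j0" for e' j
    have "card E < card (J - {j0})"
      using insert.prems insert.hyps j0 by (simp add: card_Diff_singleton)
    then obtain c where c: "\<exists>j\<in>J - {j0}. c j \<noteq> 0" "\<And>e. e \<in> E \<Longrightarrow> (\<Sum>j\<in>J - {j0}. c j * a' e j) = 0"
      using insert.IH[of "J - {j0}" a'] insert.prems by blast
    define d where "d = c(j0 := - (\<Sum>j\<in>J - {j0}. c j * a e j) / a e j0)"
    have sum: "(\<Sum>j\<in>J. d j * a e' j) = d j0 * a e' j0 + (\<Sum>j\<in>J - {j0}. c j * a e' j)" for e'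
    proof -
      have "(\<Sum>j\<in>J - {j0}. d j * a e' j) = (\<Sum>j\<in>J - {j0}. c j * a e' j)"
        by (rule sum.cong) (auto simp: d_def)
      then show ?thesis using sum.remove[OF insert.prems(1) j0(1), of "\<lambda>j. d j * a e' j"] by simp
    qed
    have "(\<Sum>j\<in>J. d j * a e' j) = 0" if "e' \<in> insert e E" for e'
    proof (cases "e' = e")
      case True
      then show ?thesis unfolding sum using j0 by (simp add: d_def)
    next
      case False
      then have "0 = (\<Sum>j\<in>J - {j0}. c j * a' e' j)" using c(2) that by simp
      also have "\<dots> = (\<Sum>j\<in>J - {j0}. c j * a e' j) - (\<Sum>j\<in>J - {j0}. c j * a e j) * (a e' j0 / a e j0)"
        unfolding sum_distrib_right sum_subtractf[symmetric]
        by (rule sum.cong) (auto simp: a'_def right_diff_distrib)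
      finally show ?thesis unfolding sum by (simp add: d_def)
    qed
    moreover have "\<exists>j\<in>J. d j \<noteq> 0" using c(1) by (auto simp: d_def)
    ultimately show ?thesis by blast
  qed
qed

section \<open>Spans of functions and dual families\<close>

inductive_set fspan :: "('a \<Rightarrow> complex) set \<Rightarrow> ('a \<Rightarrow> complex) set" for S where
  zero: "(\<lambda>x. 0) \<in> fspan S"
| step: "p \<in> fspan S \<Longrightarrow> s \<in> S \<Longrightarrow> (\<lambda>x. p x + c * s x) \<in> fspan S"

lemma fspan_base: "s \<in> S \<Longrightarrow> s \<in> fspan S"
  using fspan.step[OF fspan.zero, of s S 1] by simp

lemma fspan_add: "p \<in> fspan S \<Longrightarrow> q \<in> fspan S \<Longrightarrow> (\<lambda>x. q x + p x) \<in> fspan S"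
proof (induction rule: fspan.induct)
  case (step p s c)
  then show ?case using fspan.step[of "\<lambda>x. q x + p x" S s c] by (simp add: add.assoc)
qed simp

lemma fspan_cmult: "p \<in> fspan S \<Longrightarrow> (\<lambda>x. d * p x) \<in> fspan S"
proof (induction rule: fspan.induct)
  case (step p s c)
  then show ?case using fspan.step[of "\<lambda>x. d * p x" S s "d * c"] by (simp add: distrib_left mult.assoc)
qed (simp add: fspan.zero)

lemma fspan_sum: "(\<And>i. i \<in> I \<Longrightarrow> p i \<in> fspan S) \<Longrightarrow> (\<lambda>x. \<Sum>i\<in>I. c i * p i x) \<in> fspan S"
proof (induction I rule: infinite_finite_induct)
  case (insert i I)
  then show ?case using fspan_add[of "\<lambda>x. \<Sum>i\<in>I. c i * p i x" S "\<lambda>x. c i * p i x"] fspan_cmult[of "p i" S "c i"] by simp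
qed (simp_all add: fspan.zero)

lemma fspan_mult_closed:
  assumes "p \<in> fspan S" "\<And>s. s \<in> S \<Longrightarrow> (\<lambda>x. s x * h x) \<in> S" shows "(\<lambda>x. p x * h x) \<in> fspan S"
  using assms(1)
proof (induction rule: fspan.induct)
  case (step p s c)
  then show ?case
    using fspan.step[of "\<lambda>x. p x * h x" S "\<lambda>x. s x * h x" c] assms(2) by (simp add: distrib_right mult.assoc)
qed (simp add: fspan.zero)

text \<open>Linearly independent functionals on a span admit dual vectors. The induction resembles
  Gram-Schmidt: find a vector for the new functional that all old ones kill, then correct the old
  dual vectors by multiples of it.\<close>

lemma dual_family:
  fixes R :: "'i \<Rightarrow> ('a \<Rightarrow> complex) \<Rightarrow> complex"
  assumes "finite I"
    and lin: "\<And>i c d p q. i \<in> I \<Longrightarrow> p \<in> fspan S \<Longrightarrow> q \<in> fspan S \<Longrightarrow>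
       R i (\<lambda>x. c * p x + d * q x) = c * R i p + d * R i q"
    and indep: "\<And>c. (\<And>g. g \<in> fspan S \<Longrightarrow> (\<Sum>i\<in>I. c i * R i g) = 0) \<Longrightarrow> \<forall>i\<in>I. c i = 0"
  shows "\<exists>G. \<forall>i\<in>I. G i \<in> fspan S \<and> (\<forall>k\<in>I. R k (G i) = (if k = i then 1 else 0))"
  using assms
proof (induction I rule: finite_induct)
  case (insert i I)
  have ind: "\<forall>k\<in>I. c k = 0" if "\<And>g. g \<in> fspan S \<Longrightarrow> (\<Sum>k\<in>I. c k * R k g) = 0" for c
  proof -
    have "(\<Sum>k\<in>insert i I. (c(i := 0)) k * R k g) = 0" if "g \<in> fspan S" for g
    proof -
      have "(\<Sum>k\<in>I. (c(i := 0)) k * R k g) = (\<Sum>k\<in>I. c k * R k g)"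
        using insert.hyps by (intro sum.cong) auto
      then show ?thesis using insert.hyps \<open>\<And>g. g \<in> fspan S \<Longrightarrow> (\<Sum>k\<in>I. c k * R k g) = 0\<close>[OF that] by simp
    qed
    from insert.prems(2)[OF this] have *: "\<forall>k\<in>insert i I. (c(i := 0)) k = 0" .
    show ?thesis
    proof
      fix k assume "k \<in> I"
      then show "c k = 0" using *[rule_format, of k] insert.hyps by (cases "k = i") auto
    qed
  qed
  obtain G where G: "\<And>k. k \<in> I \<Longrightarrow> G k \<in> fspan S"
    "\<And>k l. k \<in> I \<Longrightarrow> l \<in> I \<Longrightarrow> R l (G k) = (if l = k then 1 else 0)"
    using insert.IH[OF insert.prems(1) ind] by blast
  note lin2 = insert.prems(1)
  have "R k (\<lambda>x. \<Sum>l\<in>J. c l * G l x) = (\<Sum>l\<in>J. c l * R k (G l))"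
    if k: "k \<in> insert i I" and "finite J" "J \<subseteq> I" for k c J
    using that(2,3)
  proof (induction J rule: finite_induct)
    case empty
    show ?case using lin2[OF k fspan.zero fspan.zero, of 0 0] by simp
  next
    case (insert j J)
    have "(\<lambda>x. \<Sum>l\<in>J. c l * G l x) \<in> fspan S" by (rule fspan_sum) (use insert.prems G in auto)
    then show ?case
      using lin2[OF k, of "G j" "\<lambda>x. \<Sum>l\<in>J. c l * G l x" "c j" 1] insert G(1)[of j] by simp
  qed
  then have linI: "R k (\<lambda>x. \<Sum>l\<in>I. c l * G l x) = (\<Sum>l\<in>I. c l * R k (G l))" if "k \<in> insert i I" for k c
    using that insert.hyps(1) by blast
  have span: "(\<lambda>x. \<Sum>l\<in>I. c l * G l x) \<in> fspan S" for c
    by (rule fspan_sum[OF G(1)])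
  \<comment> \<open>These coefficients form \<open>R i\<close> minus the combination of the old
    functionals that agrees with it on all \<open>G k\<close>. Independence makes the difference
    nonzero at some \<open>g\<close>, with value \<open>s\<close>.\<close>
  define c where "c k = (if k = i then 1 else - R i (G k))" for k
  have "\<exists>g\<in>fspan S. (\<Sum>k\<in>insert i I. c k * R k g) \<noteq> 0"
    using insert.prems(2)[of c] by (auto simp: c_def)
  then obtain g where g: "g \<in> fspan S" "(\<Sum>k\<in>insert i I. c k * R k g) \<noteq> 0" by blast
  define s where "s = (\<Sum>k\<in>insert i I. c k * R k g)"
  have s: "s \<noteq> 0" using g by (simp add: s_def)
  have s_eq: "s = R i g - (\<Sum>k\<in>I. R k g * R i (G k))"
  proof -
    have "(\<Sum>k\<in>I. c k * R k g) = (\<Sum>k\<in>I. - (R k g * R i (G k)))"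
      using insert.hyps by (intro sum.cong) (auto simp: c_def)
    then show ?thesis using insert.hyps by (simp add: s_def c_def sum_negf)
  qed
  \<comment> \<open>Subtracting the old components of \<open>g\<close> kills every old functional,
    and what remains under \<open>R i\<close> is exactly \<open>s\<close>.\<close>
  define H where "H = (\<lambda>x. (1 / s) * g x + (- 1 / s) * (\<Sum>k\<in>I. R k g * G k x))"
  have H: "H \<in> fspan S"
    unfolding H_def by (rule fspan_add[OF fspan_cmult[OF span] fspan_cmult[OF g(1)]])
  have RH: "R k H = (1 / s) * (R k g - (\<Sum>l\<in>I. R l g * R k (G l)))" if "k \<in> insert i I" for k
    unfolding H_def lin2[OF that g(1) span] linI[OF that] by (simp add: diff_divide_distrib)
  have RHi: "R i H = 1" using RH[of i] s s_eq by simp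
  have RHk: "R k H = 0" if "k \<in> I" for k
  proof -
    have "(\<Sum>l\<in>I. R l g * R k (G l)) = (\<Sum>l\<in>I. if l = k then R l g else 0)"
      by (rule sum.cong) (use G(2) that in auto)
    also have "\<dots> = R k g" using that insert.hyps by simp
    finally show ?thesis using RH[of k] that by simp
  qed
  define G' where "G' k = (if k = i then H else (\<lambda>x. 1 * G k x + (- R i (G k)) * H x))" for k
  have G': "G' k \<in> fspan S" if "k \<in> insert i I" for k
  proof (cases "k = i")
    case False
    then show ?thesis
      using that G(1)[of k] fspan_add[OF fspan_cmult[OF H, of "- R i (G k)"] fspan_cmult[of "G k" S 1]]
      by (simp add: G'_def)
  qed (simp add: G'_def H)
  have "R l (G' k) = (if l = k then 1 else 0)" if k: "k \<in> insert i I" and l: "l \<in> insert i I" for k l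
  proof (cases "k = i")
    case True
    then show ?thesis using l RHi RHk by (auto simp: G'_def)
  next
    case False
    then have kI: "k \<in> I" using k by simp
    have "R l (G' k) = 1 * R l (G k) + (- R i (G k)) * R l H"
      using False lin2[OF l G(1)[OF kI] H, of 1 "- R i (G k)"] by (simp add: G'_def)
    then show ?thesis using l False kI insert.hyps RHi RHk G(2) by auto
  qed
  then show ?case using G' by (intro exI[of _ G']) blast
qed simp

section \<open>Annihilating polynomials in one variable\<close>

lemma powser_sums_holomorphic:
  assumes "\<And>z. (\<lambda>n. a n * z ^ n) sums f z"
  shows "f holomorphic_on UNIV"
proof -
  have "f holomorphic_on ball 0 r" for r
    by (rule power_series_holomorphic[where a=a]) (use assms in simp)
  then have "f field_differentiable (at z)" for z
    by (rule holomorphic_on_imp_differentiable_at[of f "ball 0 (norm z + 1)"]) auto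
  then show ?thesis by (simp add: holomorphic_on_def field_differentiable_at_within)
qed

lemma detn_holomorphic:
  assumes "\<And>i j. i < m \<Longrightarrow> j < m \<Longrightarrow> (\<lambda>z. A z i j) holomorphic_on S"
  shows "(\<lambda>z. detn m (A z)) holomorphic_on S"
proof -
  have "p i < m" if "p permutes {0..<m}" "i < m" for p i
    using permutes_in_image[OF that(1), of i] that(2) by simp
  then show ?thesis
    unfolding detn_sum by (intro holomorphic_intros assms) auto
qed

lemma cnj_detn: "cnj (detn m A) = detn m (\<lambda>i j. cnj (A i j))"
  unfolding detn_sum by (simp add: sign_def cnj_sum cnj_prod)

lemma detn_bound:
  assumes "\<And>i j. i < m \<Longrightarrow> j < m \<Longrightarrow> norm (A i j) \<le> B"
  shows "norm (detn m A) \<le> fact m * B ^ m"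
proof -
  have "norm (detn m A) \<le> (\<Sum>p | p permutes {0..<m}. B ^ m)"
    unfolding detn_sum
  proof (rule sum_norm_le)
    fix p assume "p \<in> {p. p permutes {0..<m}}"
    then have p: "p i < m" if "i < m" for i
      using permutes_in_image[of p "{0..<m}" i] that by simp
    have "norm (signof p * (\<Prod>i = 0..<m. A i (p i))) = (\<Prod>i = 0..<m. norm (A i (p i)))"
      by (simp add: norm_mult prod_norm sign_def)
    also have "\<dots> \<le> (\<Prod>i = 0..<m. B)"
      by (rule prod_mono) (use assms p in auto)
    finally show "norm (signof p * (\<Prod>i = 0..<m. A i (p i))) \<le> B ^ m" by simp
  qed
  also have "\<dots> = fact m * B ^ m"
    by (simp add: card_permutations[of "{0..<m}" m])
  finally show ?thesis .
qed

text \<open>After division by the unit \<open>Q\<close>, each \<open>V f j\<close> is a combination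
  of the fixed series \<open>W k j\<close> with polynomial coefficients of degree at most
  \<open>D\<close>. Its coefficient sequence therefore lies in a finite-dimensional space
  independent of \<open>f\<close>, and one finite linear relation holds on that space.\<close>

lemma fps_coeff_linear_dependence:
  fixes P :: "'f \<Rightarrow> nat \<Rightarrow> complex fps" and A :: "nat \<Rightarrow> nat \<Rightarrow> complex fps"
    and V :: "'f \<Rightarrow> nat \<Rightarrow> complex fps"
  assumes Q: "fps_nth Q 0 \<noteq> 0"
    and P: "\<And>f k n. f \<in> I \<Longrightarrow> k < m \<Longrightarrow> n > D \<Longrightarrow> fps_nth (P f k) n = 0"
    and eq: "\<And>f j. f \<in> I \<Longrightarrow> j < m \<Longrightarrow> (\<Sum>k<m. P f k * A k j) = Q * V f j"
  shows "\<exists>c M. (\<exists>n\<le>M. c n \<noteq> 0) \<and> (\<forall>f\<in>I. \<forall>j<m. (\<Sum>n\<le>M. c n * fps_nth (V f j) n) = 0)"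
proof -
  define W where "W k j = A k j * inverse Q" for k j
  have V: "V f j = (\<Sum>k<m. P f k * W k j)" if "f \<in> I" "j < m" for f j
  proof -
    have "(\<Sum>k<m. P f k * W k j) = (\<Sum>k<m. P f k * A k j) * inverse Q"
      by (simp add: W_def sum_distrib_right mult.assoc)
    also have "\<dots> = V f j * (inverse Q * Q)" unfolding eq[OF that] by (simp add: ac_simps)
    also have "\<dots> = V f j" using inverse_mult_eq_1[OF Q] by simp
    finally show ?thesis by simp
  qed
  \<comment> \<open>The coefficient sequence of the \<open>e\<close>-fold shift of
    \<open>W k j\<close>; these sequences span the finite-dimensional space.\<close>
  define s where "s = (\<lambda>(k, e, j) n. if e \<le> n then fps_nth (W k j) (n - e) else 0)"
  have nth: "fps_nth (V f j) n = (\<Sum>k<m. \<Sum>e\<le>D. fps_nth (P f k) e * s (k, e, j) n)"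
    if "f \<in> I" "j < m" for f j n
  proof -
    have "fps_nth (P f k * W k j) n = (\<Sum>e\<le>D. fps_nth (P f k) e * s (k, e, j) n)" if "k < m" for k
    proof -
      have "fps_nth (P f k * W k j) n = (\<Sum>e\<le>n. fps_nth (P f k) e * s (k, e, j) n)"
        unfolding fps_mult_nth by (rule sum.cong) (auto simp: s_def)
      also have "\<dots> = (\<Sum>e\<le>max n D. fps_nth (P f k) e * s (k, e, j) n)"
        by (rule sum.mono_neutral_left) (auto simp: s_def)
      also have "\<dots> = (\<Sum>e\<le>D. fps_nth (P f k) e * s (k, e, j) n)"
        by (rule sum.mono_neutral_right) (auto simp: P[OF \<open>f \<in> I\<close> that])
      finally show ?thesis .
    qed
    then show ?thesis unfolding V[OF that] fps_sum_nth by simp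
  qed
  let ?E = "{..<m} \<times> {..D} \<times> {..<m}"
  \<comment> \<open>The index set \<open>{..card ?E}\<close> has one element more than there are
    equations.\<close>
  obtain c where c: "\<exists>n\<in>{..card ?E}. c n \<noteq> 0" "\<forall>e\<in>?E. (\<Sum>n\<in>{..card ?E}. c n * s e n) = 0"
    using homogeneous_system_solvable[of ?E "{..card ?E}" s] by auto
  have "(\<Sum>n\<le>card ?E. c n * fps_nth (V f j) n) = 0" if "f \<in> I" "j < m" for f j
  proof -
    have "(\<Sum>n\<le>card ?E. c n * fps_nth (V f j) n) =
        (\<Sum>n\<le>card ?E. \<Sum>k<m. \<Sum>e\<le>D. fps_nth (P f k) e * (c n * s (k, e, j) n))"
      by (simp add: nth[OF that] sum_distrib_left mult.left_commute)
    also have "\<dots> = (\<Sum>k<m. \<Sum>n\<le>card ?E. \<Sum>e\<le>D. fps_nth (P f k) e * (c n * s (k, e, j) n))"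
      by (rule sum.swap)
    also have "\<dots> = (\<Sum>k<m. \<Sum>e\<le>D. \<Sum>n\<le>card ?E. fps_nth (P f k) e * (c n * s (k, e, j) n))"
      by (rule sum.cong[OF refl], rule sum.swap)
    also have "\<dots> = (\<Sum>k<m. \<Sum>e\<le>D. fps_nth (P f k) e * (\<Sum>n\<le>card ?E. c n * s (k, e, j) n))"
      by (simp only: sum_distrib_left)
    also have "\<dots> = 0" using c(2) that by (intro sum.neutral ballI) simp
    finally show ?thesis .
  qed
  then show ?thesis using c(1) by blast
qed

text \<open>With \<open>a h z = (F (h G\<^sub>j e\<^bsup>zl\<^esup>))\<^sub>j\<close> as row \<open>h = f\<^sub>k\<close> of a matrix \<open>a\<close> and \<open>b z = F (f\<^sub>k G\<^sub>j e\<^bsup>-cnj(zl)\<^esup>)\<close>, the factorization makes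
  the product \<open>a b\<close> a pairing of \<open>F\<close> with the oscillating exponential \<open>e\<^bsup>zl - cnj(zl)\<^esup>\<close>, which grows
  at most polynomially. Hence the entire functions \<open>det a * cnj (det b)\<close> are polynomials of bounded degree
  by Liouville's theorem, and Cramer's rule confines the Taylor coefficients of \<open>a h\<close> to a
  finite-dimensional space that does not depend on \<open>h\<close>.\<close>
lemma annihilating_polynomial_exists:
  fixes F :: "('a::euclidean_space \<Rightarrow> complex) \<Rightarrow> complex" and m :: nat
  assumes F: "comp_distr F" and l: "smooth_fun l"
    and As: "\<And>f. f \<in> A \<Longrightarrow> smooth_fun f" and Bs: "\<And>g. g \<in> B \<Longrightarrow> smooth_fun g"
    and Al: "\<And>f. f \<in> A \<Longrightarrow> (\<lambda>x. f x * l x) \<in> A" and Bl: "\<And>g. g \<in> B \<Longrightarrow> (\<lambda>x. g x * cnj (l x)) \<in> B"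
    and fA: "\<And>k. k < m \<Longrightarrow> f k \<in> A" and GB: "\<And>k. k < m \<Longrightarrow> G k \<in> B"
    and dual: "\<And>k j. k < m \<Longrightarrow> j < m \<Longrightarrow> F (\<lambda>x. f k x * G j x) = (if k = j then 1 else 0)"
    and fac: "\<And>h g. h \<in> A \<Longrightarrow> g \<in> B \<Longrightarrow>
      F (\<lambda>x. h x * g x) = (\<Sum>k<m. F (\<lambda>x. h x * G k x) * F (\<lambda>x. f k x * g x))"
  shows "\<exists>c M. (\<exists>n\<le>M. c n \<noteq> 0) \<and> (\<forall>h\<in>A. \<forall>g\<in>B. (\<Sum>n\<le>M. c n * F (\<lambda>x. h x * l x ^ n * g x)) = 0)"
proof -
  have cl: "smooth_fun (\<lambda>x. cnj (l x))" by (rule smooth_fun_cnj[OF l])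
  have Aln: "(\<lambda>x. h x * l x ^ n) \<in> A" if "h \<in> A" for h n
    using that by (induction n) (auto dest: Al simp: mult_ac)
  have Bln: "(\<lambda>x. g x * cnj (l x) ^ n) \<in> B" if "g \<in> B" for g n
    using that by (induction n) (auto dest: Bl simp: mult_ac)
  define a where "a h j z = F (\<lambda>x. h x * G j x * exp (z * l x))" for h j z
  define b where "b k j w = F (\<lambda>x. f k x * G j x * exp (w * cnj (l x)))" for k j w
  define \<alpha> where "\<alpha> h j n = F (\<lambda>x. h x * l x ^ n * G j x) / fact n" for h j n
  have a_sums: "(\<lambda>n. \<alpha> h j n * z ^ n) sums a h j z" if "h \<in> A" "j < m" for h j z
    using comp_distr_exp_sums[OF F smooth_fun_mult[OF As[OF that(1)] Bs[OF GB[OF that(2)]]] l, of z]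
    by (simp add: a_def \<alpha>_def mult_ac)
  have b_sums: "(\<lambda>n. F (\<lambda>x. f k x * (G j x * cnj (l x) ^ n)) / fact n * w ^ n) sums b k j w"
    if "k < m" "j < m" for k j w
    using comp_distr_exp_sums[OF F smooth_fun_mult[OF As[OF fA[OF that(1)]] Bs[OF GB[OF that(2)]]] cl, of w]
    by (simp add: b_def mult_ac)
  \<comment> \<open>Exponentials are not polynomials, so the factorization is applied to Taylor
    coefficients: with the power \<open>n\<close> of \<open>l\<close> fixed it is summed over the
    powers of \<open>cnj (l x)\<close>, and the result is then summed over \<open>n\<close>.\<close>
  have ab: "(\<Sum>k<m. a h k z * b k j w) = F (\<lambda>x. h x * G j x * exp (z * l x + w * cnj (l x)))"
    if h: "h \<in> A" and j: "j < m" for h j z w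
  proof -
    have 1: "F (\<lambda>x. h x * l x ^ n * G j x * exp (w * cnj (l x))) = (\<Sum>k<m. F (\<lambda>x. h x * l x ^ n * G k x) * b k j w)" for n
    proof (rule sums_unique2)
      show "(\<lambda>p. F (\<lambda>x. h x * l x ^ n * G j x * cnj (l x) ^ p) / fact p * w ^ p)
          sums F (\<lambda>x. h x * l x ^ n * G j x * exp (w * cnj (l x)))"
        by (rule comp_distr_exp_sums[OF F smooth_fun_mult[OF As[OF Aln[OF h]] Bs[OF GB[OF j]]] cl])
      have "F (\<lambda>x. h x * l x ^ n * G j x * cnj (l x) ^ p) / fact p * w ^ p =
          (\<Sum>k<m. F (\<lambda>x. h x * l x ^ n * G k x) * (F (\<lambda>x. f k x * (G j x * cnj (l x) ^ p)) / fact p * w ^ p))" for p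
        using fac[OF Aln[OF h, of n] Bln[OF GB[OF j], of p]]
        by (simp add: mult.assoc sum_distrib_right sum_divide_distrib)
      then show "(\<lambda>p. F (\<lambda>x. h x * l x ^ n * G j x * cnj (l x) ^ p) / fact p * w ^ p)
          sums (\<Sum>k<m. F (\<lambda>x. h x * l x ^ n * G k x) * b k j w)"
        by (simp only:) (intro sums_sum sums_mult b_sums j, simp)
    qed
    show ?thesis
    proof (rule sums_unique2)
      have "smooth_fun (\<lambda>x. h x * (G j x * exp (w * cnj (l x))))"
        by (intro smooth_fun_mult smooth_fun_exp smooth_fun_const cl As[OF h] Bs[OF GB[OF j]])
      from comp_distr_exp_sums[OF F this l, of z]
      show "(\<lambda>n. F (\<lambda>x. h x * l x ^ n * G j x * exp (w * cnj (l x))) / fact n * z ^ n)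
          sums F (\<lambda>x. h x * G j x * exp (z * l x + w * cnj (l x)))"
        by (simp add: exp_add mult_ac)
      have "F (\<lambda>x. h x * l x ^ n * G j x * exp (w * cnj (l x))) / fact n * z ^ n = (\<Sum>k<m. \<alpha> h k n * z ^ n * b k j w)" for n
        unfolding 1 sum_divide_distrib sum_distrib_right \<alpha>_def
        by (rule sum.cong) (simp_all add: mult_ac)
      then show "(\<lambda>n. F (\<lambda>x. h x * l x ^ n * G j x * exp (w * cnj (l x))) / fact n * z ^ n)
          sums (\<Sum>k<m. a h k z * b k j w)"
        by (simp only:) (intro sums_sum sums_mult2 a_sums h, simp)
    qed
  qed
  obtain N where N: "\<And>g l. smooth_fun g \<Longrightarrow> smooth_fun l \<Longrightarrow>
    \<exists>C\<ge>0. \<forall>z. norm (F (\<lambda>x. g x * exp (z * l x - cnj (z * l x)))) \<le> C * (1 + norm z) ^ N"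
    by (rule comp_distr_oscillatory_bound[OF F]) blast
  have bound: "\<exists>C\<ge>0. \<forall>z. norm (\<Sum>k<m. a h k z * b k j (- cnj z)) \<le> C * (1 + norm z) ^ N"
    if "h \<in> A" "j < m" for h j
    using N[OF smooth_fun_mult[OF As[OF that(1)] Bs[OF GB[OF that(2)]]] l] by (simp add: ab[OF that])
  \<comment> \<open>The determinant of \<open>b\<close> at \<open>- cnj z\<close> is antiholomorphic
    in \<open>z\<close>; conjugation restores holomorphy and keeps the modulus.\<close>
  define \<gamma> where "\<gamma> z = cnj (detn m (\<lambda>k j. b k j (- cnj z)))" for z
  define P where "P r z = detn m (\<lambda>k j. a (r k) j z) * \<gamma> z" for r z
  \<comment> \<open>Each product in the \<open>m\<close> by \<open>m\<close> determinant has
    \<open>m\<close> factors of growth \<open>N\<close>.\<close>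
  define D where "D = N * m"
  have a_hol: "a h j holomorphic_on UNIV" if "h \<in> A" "j < m" for h j
    by (rule powser_sums_holomorphic[OF a_sums[OF that]])
  have b_hol: "(\<lambda>z. cnj (b k j (- cnj z))) holomorphic_on UNIV" if "k < m" "j < m" for k j
  proof (rule powser_sums_holomorphic)
    fix z
    have "(\<lambda>n. cnj (F (\<lambda>x. f k x * (G j x * cnj (l x) ^ n)) / fact n * (- cnj z) ^ n)) sums cnj (b k j (- cnj z))"
      using b_sums[OF that, of "- cnj z"] by (simp only: sums_cnj)
    moreover have "cnj (F (\<lambda>x. f k x * (G j x * cnj (l x) ^ n)) / fact n * (- cnj z) ^ n)
        = (cnj (F (\<lambda>x. f k x * (G j x * cnj (l x) ^ n))) / fact n * (- 1) ^ n) * z ^ n" for n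
      by (simp add: power_minus[of z])
    ultimately show "(\<lambda>n. (cnj (F (\<lambda>x. f k x * (G j x * cnj (l x) ^ n))) / fact n * (- 1) ^ n) * z ^ n)
        sums cnj (b k j (- cnj z))"
      by (simp only:)
  qed
  have P_hol: "P r holomorphic_on UNIV" if "\<And>k. k < m \<Longrightarrow> r k \<in> A" for r
    unfolding P_def \<gamma>_def cnj_detn
    by (intro holomorphic_on_mult detn_holomorphic a_hol b_hol that)
  have P_poly: "P r z = (\<Sum>e\<le>D. (deriv ^^ e) (P r) 0 / fact e * z ^ e)" if r: "\<And>k. k < m \<Longrightarrow> r k \<in> A" for r z
  proof -
    have "\<forall>k j. \<exists>C\<ge>0. k < m \<longrightarrow> j < m \<longrightarrow> (\<forall>z. norm (\<Sum>i<m. a (r k) i z * b i j (- cnj z)) \<le> C * (1 + norm z) ^ N)"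
      using bound[OF r] by (metis order_refl)
    then obtain C where C: "\<And>k j. C k j \<ge> 0"
      "\<And>k j z. k < m \<Longrightarrow> j < m \<Longrightarrow> norm (\<Sum>i<m. a (r k) i z * b i j (- cnj z)) \<le> C k j * (1 + norm z) ^ N"
      by metis
    define C' where "C' = (\<Sum>k<m. \<Sum>j<m. C k j)"
    have CC': "C k j \<le> C' " if "k < m" "j < m" for k j
    proof -
      have "C k j \<le> (\<Sum>j<m. C k j)"
        by (rule member_le_sum) (use that C in auto)
      also have "\<dots> \<le> C'"
        unfolding C'_def by (rule member_le_sum[where f="\<lambda>k. \<Sum>j<m. C k j"]) (use that C in \<open>auto intro: sum_nonneg\<close>)
      finally show ?thesis .
    qed
    have C'0: "C' \<ge> 0" unfolding C'_def by (intro sum_nonneg C)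
    have "norm (P r z) \<le> fact m * (C' * 2 ^ N) ^ m * norm z ^ D" if z: "1 \<le> norm z" for z
    proof -
      have "norm (P r z) = norm (detn m (\<lambda>k j. a (r k) j z) * detn m (\<lambda>k j. b k j (- cnj z)))"
        unfolding P_def \<gamma>_def norm_mult complex_mod_cnj ..
      also have "\<dots> = norm (detn m (\<lambda>k j. \<Sum>i<m. a (r k) i z * b i j (- cnj z)))"
        by (simp add: detn_mult)
      also have "\<dots> \<le> fact m * (C' * (2 * norm z) ^ N) ^ m"
      proof (rule detn_bound)
        fix k j assume kj: "k < m" "j < m"
        have "norm (\<Sum>i<m. a (r k) i z * b i j (- cnj z)) \<le> C k j * (1 + norm z) ^ N"
          by (rule C(2)[OF kj])
        also have "\<dots> \<le> C' * (2 * norm z) ^ N"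
          using z C'0 by (intro mult_mono power_mono CC' kj) auto
        finally show "norm (\<Sum>i<m. a (r k) i z * b i j (- cnj z)) \<le> C' * (2 * norm z) ^ N" .
      qed
      also have "\<dots> = fact m * (C' * 2 ^ N) ^ m * norm z ^ D"
        by (simp add: D_def power_mult_distrib power_mult)
      finally show ?thesis .
    qed
    from Liouville_polynomial[OF P_hol[OF r] this] show ?thesis .
  qed
  define p where "p r = Abs_fps (\<lambda>e. if e \<le> D then (deriv ^^ e) (P r) 0 / fact e else 0)" for r
  have p_exp: "P r has_fps_expansion p r" if "\<And>k. k < m \<Longrightarrow> r k \<in> A" for r
  proof (rule has_fps_expansionI, rule always_eventually, rule allI)
    fix u
    have "(\<lambda>n. fps_nth (p r) n * u ^ n) sums (\<Sum>e\<in>{..D}. fps_nth (p r) e * u ^ e)"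
      by (rule sums_finite) (auto simp: p_def)
    then show "(\<lambda>n. fps_nth (p r) n * u ^ n) sums P r u"
      using P_poly[of r u, OF that] by (simp add: p_def)
  qed
  have a_exp: "a h j has_fps_expansion Abs_fps (\<alpha> h j)" if "h \<in> A" "j < m" for h j
    by (rule has_fps_expansionI) (use a_sums[OF that] in simp)
  \<comment> \<open>At 0 the exponentials are 1 and biorthogonality makes both matrices the
    identity. The constant term of \<open>p f\<close> is therefore 1, which makes the series a
    unit.\<close>
  have P0: "P f 0 = 1"
  proof -
    have 1: "a (f k) j 0 = (if k = j then 1 else 0)" "b k j 0 = (if k = j then 1 else 0)" if "k < m" "j < m" for k j
      using dual[OF that] by (simp_all add: a_def b_def)
    have "detn m (\<lambda>k j. a (f k) j 0) = 1" "detn m (\<lambda>k j. b k j 0) = 1"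
      by (subst detn_one[of m, symmetric], rule detn_cong, erule (1) 1)+
    then show ?thesis by (simp add: P_def \<gamma>_def)
  qed
  have upd: "k < m \<Longrightarrow> (f(i := h)) k \<in> A" if "h \<in> A" for h i k
    using that fA by simp
  \<comment> \<open>Cramer's rule holds pointwise for entire functions; uniqueness of expansions
    transfers it to formal power series, where \<open>p f\<close> can be inverted.\<close>
  have cramer: "(\<Sum>k<m. p (f(k := h)) * Abs_fps (\<alpha> (f k) j)) = p f * Abs_fps (\<alpha> h j)"
    if h: "h \<in> A" and j: "j < m" for h j
  proof (rule fps_expansion_unique_complex)
    have eq: "(\<Sum>k<m. P (f(k := h)) z * a (f k) j z) = P f z * a h j z" for z
    proof -
      have "(\<lambda>i j. a ((f(k := h)) i) j z) = (\<lambda>i j. a (f i) j z)(k := \<lambda>j. a h j z)" for k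
        by auto
      then show ?thesis
        using detn_cramer[OF j, of "\<lambda>i j. a (f i) j z" "\<lambda>j. a h j z"]
        by (simp add: P_def sum_distrib_left[symmetric] mult_ac mult.left_commute[of _ "\<gamma> z"])
    qed
    have "(\<lambda>z. \<Sum>k<m. P (f(k := h)) z * a (f k) j z) has_fps_expansion
        (\<Sum>k<m. p (f(k := h)) * Abs_fps (\<alpha> (f k) j))"
      by (intro has_fps_expansion_sum has_fps_expansion_mult p_exp a_exp upd h j fA) auto
    then show "(\<lambda>z. P f z * a h j z) has_fps_expansion (\<Sum>k<m. p (f(k := h)) * Abs_fps (\<alpha> (f k) j))"
      unfolding eq .
    show "(\<lambda>z. P f z * a h j z) has_fps_expansion p f * Abs_fps (\<alpha> h j)"
      by (intro has_fps_expansion_mult p_exp a_exp h j fA)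
  qed
  have p0: "fps_nth (p f) 0 \<noteq> 0" using P0 by (simp add: p_def)
  have "\<exists>c M. (\<exists>n\<le>M. c n \<noteq> 0) \<and> (\<forall>h\<in>A. \<forall>j<m. (\<Sum>n\<le>M. c n * fps_nth (Abs_fps (\<alpha> h j)) n) = 0)"
    by (rule fps_coeff_linear_dependence[where P="\<lambda>h k. p (f(k := h))" and D=D, OF p0 _ cramer]) (simp_all add: p_def)
  then obtain c M where c: "\<exists>n\<le>M. c n \<noteq> 0" "\<And>h j. h \<in> A \<Longrightarrow> j < m \<Longrightarrow> (\<Sum>n\<le>M. c n * \<alpha> h j n) = 0"
    by auto
  \<comment> \<open>The factorial comes from the definition of \<alpha>. The factorization extends
    the relation from the finitely many \<open>G k\<close> to every \<open>g\<close> in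
    \<open>B\<close>.\<close>
  have "(\<Sum>n\<le>M. c n / fact n * F (\<lambda>x. h x * l x ^ n * g x)) = 0" if h: "h \<in> A" and g: "g \<in> B" for h g
  proof -
    have "(\<Sum>n\<le>M. c n / fact n * F (\<lambda>x. h x * l x ^ n * g x)) =
       (\<Sum>n\<le>M. \<Sum>k<m. c n * \<alpha> h k n * F (\<lambda>x. f k x * g x))"
      unfolding fac[OF Aln[OF h] g] \<alpha>_def sum_distrib_left
      by (intro sum.cong refl) simp
    also have "\<dots> = (\<Sum>k<m. \<Sum>n\<le>M. c n * \<alpha> h k n * F (\<lambda>x. f k x * g x))"
      by (rule sum.swap)
    also have "\<dots> = 0"
      by (simp add: sum_distrib_right[symmetric] c(2)[OF h])
    finally show ?thesis .
  qed
  moreover have "\<exists>n\<le>M. c n / fact n \<noteq> 0" using c(1) by simp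
  ultimately show ?thesis
    by (intro exI[of _ "\<lambda>n. c n / fact n"] exI[of _ M]) blast
qed

section \<open>Consequences of finite rank\<close>

abbreviation hol_polys :: "(complex^'d::finite \<Rightarrow> complex) set" where
  "hol_polys \<equiv> fspan (range (\<lambda>\<alpha>. monom \<alpha> (\<lambda>_. 0)))"

abbreviation antihol_polys :: "(complex^'d::finite \<Rightarrow> complex) set" where
  "antihol_polys \<equiv> fspan (range (monom (\<lambda>_. 0)))"

lemma monom_split: "monom \<alpha> (\<lambda>_. 0) x * monom (\<lambda>_. 0) \<beta> x = monom \<alpha> \<beta> x"
  by (simp add: monom_def prod.distrib)

lemma fspan_smooth: "p \<in> fspan S \<Longrightarrow> (\<And>s. s \<in> S \<Longrightarrow> smooth_fun s) \<Longrightarrow> smooth_fun p"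
proof (induction rule: fspan.induct)
  case (step p s c)
  then show ?case by (intro smooth_fun_add smooth_fun_mult smooth_fun_const) auto
qed simp

lemma hol_polys_smooth: "f \<in> hol_polys \<Longrightarrow> smooth_fun f"
  by (rule fspan_smooth) (auto simp: smooth_fun_monom)

lemma antihol_polys_smooth: "f \<in> antihol_polys \<Longrightarrow> smooth_fun f"
  by (rule fspan_smooth) (auto simp: smooth_fun_monom)

lemma hol_polys_component:
  fixes i :: "'d::finite"
  shows "f \<in> hol_polys \<Longrightarrow> (\<lambda>x. f x * x $ i) \<in> hol_polys"
proof (erule fspan_mult_closed)
  fix s :: "complex^'d \<Rightarrow> complex" assume "s \<in> range (\<lambda>\<alpha>. monom \<alpha> (\<lambda>_. 0))"
  then obtain \<alpha> where s: "s = monom \<alpha> (\<lambda>_. 0)" by auto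
  have "(\<lambda>x. s x * x $ i) = monom (\<alpha>(i := Suc (\<alpha> i))) (\<lambda>_. 0)"
    unfolding s by (rule ext) (simp only: monom_upd1 mult.commute)
  then show "(\<lambda>x. s x * x $ i) \<in> range (\<lambda>\<alpha>. monom \<alpha> (\<lambda>_. 0))" by simp
qed

lemma antihol_polys_component:
  fixes i :: "'d::finite"
  shows "f \<in> antihol_polys \<Longrightarrow> (\<lambda>x. f x * cnj (x $ i)) \<in> antihol_polys"
proof (erule fspan_mult_closed)
  fix s :: "complex^'d \<Rightarrow> complex" assume "s \<in> range (monom (\<lambda>_. 0))"
  then obtain \<beta> where s: "s = monom (\<lambda>_. 0) \<beta>" by auto
  have "(\<lambda>x. s x * cnj (x $ i)) = monom (\<lambda>_. 0) (\<beta>(i := Suc (\<beta> i)))"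
    unfolding s by (rule ext) (simp only: monom_upd2 mult.commute)
  then show "(\<lambda>x. s x * cnj (x $ i)) \<in> range (monom (\<lambda>_. 0))" by simp
qed

lemma comp_distr_fspan_eq:
  assumes F: "comp_distr F" and S: "\<And>s. s \<in> S \<Longrightarrow> smooth_fun s"
    and h: "smooth_fun h" and f: "\<And>i. i \<in> I \<Longrightarrow> smooth_fun (f i)"
    and eq: "\<And>s. s \<in> S \<Longrightarrow> F (\<lambda>x. h x * s x) = (\<Sum>i\<in>I. t i * F (\<lambda>x. f i x * s x))"
    and g: "g \<in> fspan S"
  shows "F (\<lambda>x. h x * g x) = (\<Sum>i\<in>I. t i * F (\<lambda>x. f i x * g x))"
  using g
proof (induction rule: fspan.induct)
  case zero
  show ?case by (simp add: comp_distr_zero[OF F])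
next
  case (step p s c)
  have p: "smooth_fun p" by (rule fspan_smooth[OF step(1) S])
  note s = S[OF step(2)]
  have lin: "F (\<lambda>x. k x * (p x + c * s x)) = F (\<lambda>x. k x * p x) + c * F (\<lambda>x. k x * s x)"
    if k: "smooth_fun k" for k
  proof -
    have "F (\<lambda>x. k x * p x + c * (k x * s x)) = F (\<lambda>x. k x * p x) + F (\<lambda>x. c * (k x * s x))"
      by (rule comp_distr_add[OF F]) (intro smooth_fun_mult smooth_fun_const k p s)+
    then show ?thesis
      using comp_distr_cmult[OF F smooth_fun_mult[OF k s], of c] by (simp add: distrib_left mult.left_commute)
  qed
  have "(\<Sum>i\<in>I. t i * F (\<lambda>x. f i x * (p x + c * s x)))
      = (\<Sum>i\<in>I. t i * F (\<lambda>x. f i x * p x) + c * (t i * F (\<lambda>x. f i x * s x)))"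
  proof (rule sum.cong[OF refl])
    fix i assume "i \<in> I"
    from lin[OF f[OF this]]
    show "t i * F (\<lambda>x. f i x * (p x + c * s x)) = t i * F (\<lambda>x. f i x * p x) + c * (t i * F (\<lambda>x. f i x * s x))"
      by (simp only: distrib_left mult.left_commute)
  qed
  also have "\<dots> = F (\<lambda>x. h x * p x) + c * F (\<lambda>x. h x * s x)"
    by (simp add: step.IH eq[OF step(2)] sum.distrib sum_distrib_left)
  also have "\<dots> = F (\<lambda>x. h x * (p x + c * s x))" by (rule lin[OF h, symmetric])
  finally show ?case ..
qed

text \<open>A maximal independent set of rows spans all rows, so pairing with a fixed
  \<open>h\<close> is a combination of the functionals given by these rows. Evaluating on a dual
  family identifies the coefficients as \<open>F (\<lambda>x. h x * G k x)\<close>.\<close>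

lemma has_rank_factorization:
  fixes F :: "(complex^'d::finite \<Rightarrow> complex) \<Rightarrow> complex"
  assumes F: "comp_distr F" and rank: "has_rank (\<lambda>\<alpha> \<beta>. F (monom \<alpha> \<beta>)) m"
  obtains f G where "\<And>k. k < m \<Longrightarrow> f k \<in> hol_polys" "\<And>k. k < m \<Longrightarrow> G k \<in> antihol_polys"
    "\<And>k j. k < m \<Longrightarrow> j < m \<Longrightarrow> F (\<lambda>x. f k x * G j x) = (if k = j then 1 else 0)"
    "\<And>h g. h \<in> hol_polys \<Longrightarrow> g \<in> antihol_polys \<Longrightarrow>
      F (\<lambda>x. h x * g x) = (\<Sum>k<m. F (\<lambda>x. h x * G k x) * F (\<lambda>x. f k x * g x))"
proof -
  obtain I where I: "finite I" "card I = m" "rows_indep (\<lambda>\<alpha> \<beta>. F (monom \<alpha> \<beta>)) I"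
    and max: "\<And>J. finite J \<Longrightarrow> rows_indep (\<lambda>\<alpha> \<beta>. F (monom \<alpha> \<beta>)) J \<Longrightarrow> card J \<le> m"
    using rank unfolding has_rank_def by blast
  let ?f = "\<lambda>\<alpha>. monom \<alpha> (\<lambda>_. 0) :: complex^'d \<Rightarrow> complex"
  let ?g = "\<lambda>\<beta>. monom (\<lambda>_. 0) \<beta> :: complex^'d \<Rightarrow> complex"
  have fg: "F (\<lambda>x. ?f \<alpha> x * ?g \<beta> x) = F (monom \<alpha> \<beta>)" for \<alpha> \<beta>
    unfolding monom_split ..
  have row: "\<exists>t. \<forall>\<beta>. F (monom \<alpha>' \<beta>) = (\<Sum>\<alpha>\<in>I. t \<alpha> * F (monom \<alpha> \<beta>))" for \<alpha>'
  proof (cases "\<alpha>' \<in> I")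
    case True
    then show ?thesis
      using I(1) by (intro exI[of _ "\<lambda>\<alpha>. if \<alpha> = \<alpha>' then 1 else 0"]) (simp add: if_distrib[where f="\<lambda>c. c * _"] cong: if_cong)
  next
    case False
    have "\<not> rows_indep (\<lambda>\<alpha> \<beta>. F (monom \<alpha> \<beta>)) (insert \<alpha>' I)"
      using max[of "insert \<alpha>' I"] I False by auto
    then obtain c where c: "\<And>\<beta>. (\<Sum>\<alpha>\<in>insert \<alpha>' I. c \<alpha> * F (monom \<alpha> \<beta>)) = 0" "\<exists>\<alpha>\<in>insert \<alpha>' I. c \<alpha> \<noteq> 0"
      unfolding rows_indep_def by blast
    have sum: "c \<alpha>' * F (monom \<alpha>' \<beta>) + (\<Sum>\<alpha>\<in>I. c \<alpha> * F (monom \<alpha> \<beta>)) = 0" for \<beta>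
      using c(1)[of \<beta>] I(1) False by simp
    have c0: "c \<alpha>' \<noteq> 0"
    proof
      assume "c \<alpha>' = 0"
      then have "\<forall>\<alpha>\<in>I. c \<alpha> = 0" using sum I(3) unfolding rows_indep_def by simp
      then show False using c(2) \<open>c \<alpha>' = 0\<close> by auto
    qed
    have "F (monom \<alpha>' \<beta>) = (\<Sum>\<alpha>\<in>I. (- c \<alpha> / c \<alpha>') * F (monom \<alpha> \<beta>))" for \<beta>
    proof -
      have "(\<Sum>\<alpha>\<in>I. (- c \<alpha> / c \<alpha>') * F (monom \<alpha> \<beta>)) = - (\<Sum>\<alpha>\<in>I. c \<alpha> * F (monom \<alpha> \<beta>)) / c \<alpha>'"
        unfolding sum_negf[symmetric] sum_divide_distrib by (rule sum.cong) auto
      also have "\<dots> = c \<alpha>' * F (monom \<alpha>' \<beta>) / c \<alpha>'"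
        using sum[of \<beta>] by (simp only: eq_neg_iff_add_eq_0[symmetric])
      finally show ?thesis using c0 by simp
    qed
    then show ?thesis by (intro exI[of _ "\<lambda>\<alpha>. - c \<alpha> / c \<alpha>'"] allI)
  qed
  have span: "\<exists>t. \<forall>g\<in>antihol_polys. F (\<lambda>x. h x * g x) = (\<Sum>\<alpha>\<in>I. t \<alpha> * F (\<lambda>x. ?f \<alpha> x * g x))"
    if "h \<in> hol_polys" for h
    using that
  proof (induction rule: fspan.induct)
    case zero
    show ?case by (rule exI[of _ "\<lambda>_. 0"]) (simp add: comp_distr_zero[OF F])
  next
    case (step p s c)
    obtain t where t: "\<And>g. g \<in> antihol_polys \<Longrightarrow> F (\<lambda>x. p x * g x) = (\<Sum>\<alpha>\<in>I. t \<alpha> * F (\<lambda>x. ?f \<alpha> x * g x))"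
      using step.IH by blast
    obtain \<alpha>' where s: "s = ?f \<alpha>'" using step(2) by auto
    obtain t' where t': "\<And>\<beta>. F (monom \<alpha>' \<beta>) = (\<Sum>\<alpha>\<in>I. t' \<alpha> * F (monom \<alpha> \<beta>))"
      using row by blast
    have s': "F (\<lambda>x. s x * g x) = (\<Sum>\<alpha>\<in>I. t' \<alpha> * F (\<lambda>x. ?f \<alpha> x * g x))" if "g \<in> antihol_polys" for g
      by (rule comp_distr_fspan_eq[OF F _ _ _ _ that]) (auto simp: s smooth_fun_monom fg t')
    have "F (\<lambda>x. (p x + c * s x) * g x) = (\<Sum>\<alpha>\<in>I. (t \<alpha> + c * t' \<alpha>) * F (\<lambda>x. ?f \<alpha> x * g x))"
      if g: "g \<in> antihol_polys" for g
    proof -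
      note gs = antihol_polys_smooth[OF g]
      have p: "smooth_fun p" by (rule hol_polys_smooth[OF step(1)])
      have ss: "smooth_fun s" by (simp add: s smooth_fun_monom)
      have "F (\<lambda>x. (p x + c * s x) * g x) = F (\<lambda>x. p x * g x + c * (s x * g x))"
        by (simp add: distrib_right mult.assoc)
      also have "\<dots> = F (\<lambda>x. p x * g x) + c * F (\<lambda>x. s x * g x)"
        using comp_distr_add[OF F smooth_fun_mult[OF p gs] smooth_fun_mult[OF smooth_fun_const smooth_fun_mult[OF ss gs]], of c]
          comp_distr_cmult[OF F smooth_fun_mult[OF ss gs], of c] by simp
      also have "\<dots> = (\<Sum>\<alpha>\<in>I. (t \<alpha> + c * t' \<alpha>) * F (\<lambda>x. ?f \<alpha> x * g x))"
        unfolding t[OF g] s'[OF g] sum_distrib_left sum.distrib[symmetric]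
        by (rule sum.cong) (simp_all add: distrib_right mult.assoc)
      finally show ?thesis .
    qed
    then show ?case by (intro exI[of _ "\<lambda>\<alpha>. t \<alpha> + c * t' \<alpha>"] ballI)
  qed
  have "\<exists>G. \<forall>\<alpha>\<in>I. G \<alpha> \<in> antihol_polys \<and> (\<forall>k\<in>I. F (\<lambda>x. ?f k x * G \<alpha> x) = (if k = \<alpha> then 1 else 0))"
  proof (rule dual_family[OF I(1)])
    fix \<alpha> c d and p q :: "complex^'d \<Rightarrow> complex"
    assume pq: "p \<in> antihol_polys" "q \<in> antihol_polys"
    have sm: "smooth_fun (\<lambda>x. ?f \<alpha> x * p x)" "smooth_fun (\<lambda>x. ?f \<alpha> x * q x)"
      by (rule smooth_fun_mult[OF smooth_fun_monom antihol_polys_smooth[OF pq(1)]],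
          rule smooth_fun_mult[OF smooth_fun_monom antihol_polys_smooth[OF pq(2)]])
    have "F (\<lambda>x. ?f \<alpha> x * (c * p x + d * q x)) = F (\<lambda>x. c * (?f \<alpha> x * p x) + d * (?f \<alpha> x * q x))"
      by (simp add: distrib_left mult.left_commute)
    also have "\<dots> = c * F (\<lambda>x. ?f \<alpha> x * p x) + d * F (\<lambda>x. ?f \<alpha> x * q x)"
      using comp_distr_add[OF F smooth_fun_mult[OF smooth_fun_const sm(1)] smooth_fun_mult[OF smooth_fun_const sm(2)]]
      by (simp add: comp_distr_cmult[OF F sm(1)] comp_distr_cmult[OF F sm(2)])
    finally show "F (\<lambda>x. ?f \<alpha> x * (c * p x + d * q x)) = c * F (\<lambda>x. ?f \<alpha> x * p x) + d * F (\<lambda>x. ?f \<alpha> x * q x)" .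
  next
    fix c assume *: "\<And>g :: complex^'d \<Rightarrow> complex. g \<in> antihol_polys \<Longrightarrow> (\<Sum>\<alpha>\<in>I. c \<alpha> * F (\<lambda>x. ?f \<alpha> x * g x)) = 0"
    have "(\<Sum>\<alpha>\<in>I. c \<alpha> * F (monom \<alpha> \<beta>)) = 0" for \<beta>
      using *[OF fspan_base, of "?g \<beta>"] by (simp add: fg)
    then show "\<forall>\<alpha>\<in>I. c \<alpha> = 0" using I(3) unfolding rows_indep_def by blast
  qed
  then obtain G where G: "\<And>\<alpha>. \<alpha> \<in> I \<Longrightarrow> G \<alpha> \<in> antihol_polys"
    "\<And>k \<alpha>. k \<in> I \<Longrightarrow> \<alpha> \<in> I \<Longrightarrow> F (\<lambda>x. ?f k x * G \<alpha> x) = (if k = \<alpha> then 1 else 0)" by blast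
  have fac: "F (\<lambda>x. h x * g x) = (\<Sum>\<alpha>\<in>I. F (\<lambda>x. h x * G \<alpha> x) * F (\<lambda>x. ?f \<alpha> x * g x))"
    if h: "h \<in> hol_polys" and g: "g \<in> antihol_polys" for h g
  proof -
    obtain t where t: "\<And>g. g \<in> antihol_polys \<Longrightarrow> F (\<lambda>x. h x * g x) = (\<Sum>\<alpha>\<in>I. t \<alpha> * F (\<lambda>x. ?f \<alpha> x * g x))"
      using span[OF h] by blast
    have "F (\<lambda>x. h x * G \<alpha> x) = t \<alpha>" if "\<alpha> \<in> I" for \<alpha>
    proof -
      have "F (\<lambda>x. h x * G \<alpha> x) = (\<Sum>k\<in>I. if k = \<alpha> then t k else 0)"
        unfolding t[OF G(1)[OF that]] by (rule sum.cong) (use G(2) that in auto)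
      then show ?thesis using that I(1) by simp
    qed
    then show ?thesis by (simp add: t[OF g])
  qed
  obtain e where e: "bij_betw e {..<m} I"
    using ex_bij_betw_nat_finite[OF I(1)] I(2) by (auto simp: lessThan_atLeast0)
  have eI: "e k \<in> I" if "k < m" for k using e that by (auto simp: bij_betw_def)
  show thesis
  proof (rule that[of "\<lambda>k. ?f (e k)" "\<lambda>k. G (e k)"])
    show "?f (e k) \<in> hol_polys" for k by (rule fspan_base) auto
    show "G (e k) \<in> antihol_polys" if "k < m" for k by (rule G(1)[OF eI[OF that]])
    show "F (\<lambda>x. ?f (e k) x * G (e j) x) = (if k = j then 1 else 0)" if "k < m" "j < m" for k j
      using G(2)[OF eI eI, OF that] bij_betw_imp_inj_on[OF e] that by (auto simp: inj_on_def)
    show "F (\<lambda>x. h x * g x) = (\<Sum>k<m. F (\<lambda>x. h x * G (e k) x) * F (\<lambda>x. ?f (e k) x * g x))"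
      if "h \<in> hol_polys" "g \<in> antihol_polys" for h g
      unfolding fac[OF that] by (rule sum.reindex_bij_betw[OF e, symmetric])
  qed
qed

lemma annihilating_poly_Ann:
  fixes F :: "(complex^'d::finite \<Rightarrow> complex) \<Rightarrow> complex"
  assumes F: "comp_distr F" and l: "smooth_fun l" and "\<exists>n\<le>M. c n \<noteq> 0"
    and 0: "\<And>\<alpha> \<beta>. (\<Sum>n\<le>M. c n * F (\<lambda>x. monom \<alpha> (\<lambda>_. 0) x * l x ^ n * monom (\<lambda>_. 0) \<beta> x)) = 0"
  shows "\<exists>p. p \<noteq> 0 \<and> (\<lambda>x. poly p (l x)) \<in> Ann F"
proof (intro exI conjI)
  let ?p = "\<Sum>n\<le>M. Polynomial.monom (c n) n"
  have "coeff ?p n = c n" if "n \<le> M" for n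
    using that by (simp add: coeff_sum)
  then show "?p \<noteq> 0" using assms(3) by (metis coeff_0)
  have p: "poly ?p (l x) = (\<Sum>n\<le>M. c n * l x ^ n)" for x
    by (simp add: poly_sum poly_monom)
  have ln: "smooth_fun (\<lambda>x. monom \<alpha> \<beta> x * l x ^ n)" for \<alpha> \<beta> n
    by (intro smooth_fun_mult smooth_fun_power smooth_fun_monom l)
  show "(\<lambda>x. poly ?p (l x)) \<in> Ann F"
  proof (rule Ann_monomI[OF F])
    show "smooth_fun (\<lambda>x. poly ?p (l x))"
      unfolding p by (intro smooth_fun_sum smooth_fun_mult smooth_fun_const smooth_fun_power l)
    fix \<alpha> \<beta>
    have "(\<lambda>x. poly ?p (l x) * monom \<alpha> \<beta> x) = (\<lambda>x. \<Sum>n\<le>M. c n * (monom \<alpha> \<beta> x * l x ^ n))"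
      unfolding p sum_distrib_right by (simp add: mult_ac)
    then have "F (\<lambda>x. poly ?p (l x) * monom \<alpha> \<beta> x) = (\<Sum>n\<le>M. c n * F (\<lambda>x. monom \<alpha> \<beta> x * l x ^ n))"
      using comp_distr_sum_cmult[OF F ln] by simp
    also have "\<dots> = (\<Sum>n\<le>M. c n * F (\<lambda>x. monom \<alpha> (\<lambda>_. 0) x * l x ^ n * monom (\<lambda>_. 0) \<beta> x))"
      unfolding monom_split[of \<alpha> _ \<beta>, symmetric] by (simp only: mult_ac)
    finally show "F (\<lambda>x. poly ?p (l x) * monom \<alpha> \<beta> x) = 0" using 0 by simp
  qed
qed

text \<open>Every root of \<open>p\<close> has multiplicity at most \<open>n\<close>, so
  \<open>p\<close> divides the \<open>n\<close>-th power of the product over \<open>S\<close>. This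
  brings the annihilators of all coordinates to one shape with common \<open>S\<close> and
  \<open>n\<close>.\<close>

lemma annihilator_root_power:
  assumes p: "p \<noteq> 0" "(\<lambda>x. poly p (l x)) \<in> Ann F" and l: "smooth_fun l"
    and S: "finite S" "{z. poly p z = 0} \<subseteq> S" and n: "degree p \<le> n"
  shows "(\<lambda>x. (\<Prod>s\<in>S. l x - s) ^ n) \<in> Ann F"
proof -
  let ?r = "{z. poly p z = 0}"
  have "(\<Prod>z\<in>?r. [:-z, 1:] ^ order z p) dvd (\<Prod>z\<in>?r. [:-z, 1:] ^ n)"
    by (rule prod_dvd_prod) (use n order_degree[OF p(1)] in \<open>auto intro!: le_imp_power_dvd intro: order_trans\<close>)
  then have "p dvd (\<Prod>z\<in>?r. [:-z, 1:]) ^ n"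
    using p(1) by (subst complex_poly_decompose[symmetric]) (simp add: smult_dvd_iff prod_power_distrib)
  also have "\<dots> dvd (\<Prod>z\<in>S. [:-z, 1:]) ^ n"
    by (rule dvd_power_same, rule prod_dvd_prod_subset[OF S])
  finally obtain q where q: "(\<Prod>z\<in>S. [:-z, 1:]) ^ n = p * q" by (auto elim: dvdE)
  have "(\<Prod>s\<in>S. l x - s) ^ n = poly p (l x) * poly q (l x)" for x
    unfolding poly_mult[symmetric] q[symmetric] by (simp add: poly_power poly_prod)
  moreover have "smooth_fun (\<lambda>x. poly q (l x))"
    unfolding poly_altdef by (intro smooth_fun_sum smooth_fun_mult smooth_fun_const smooth_fun_power l)
  ultimately show ?thesis using Ann_mult_right[OF p(2)] by simp
qed

lemma finite_rank_annihilators: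
  fixes F :: "(complex^'d::finite \<Rightarrow> complex) \<Rightarrow> complex"
  assumes F: "comp_distr F" and rank: "has_rank (\<lambda>\<alpha> \<beta>. F (monom \<alpha> \<beta>)) m"
  obtains S n where "finite S" "\<And>i. (\<lambda>x. (\<Prod>s\<in>S. x $ i - s) ^ n) \<in> Ann F"
    "\<And>i. (\<lambda>x. cnj ((\<Prod>s\<in>S. x $ i - s) ^ n)) \<in> Ann F"
proof -
  obtain f G where fG: "\<And>k. k < m \<Longrightarrow> f k \<in> hol_polys" "\<And>k. k < m \<Longrightarrow> G k \<in> antihol_polys"
    "\<And>k j. k < m \<Longrightarrow> j < m \<Longrightarrow> F (\<lambda>x. f k x * G j x) = (if k = j then 1 else 0)"
    "\<And>h g. h \<in> hol_polys \<Longrightarrow> g \<in> antihol_polys \<Longrightarrow>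
      F (\<lambda>x. h x * g x) = (\<Sum>k<m. F (\<lambda>x. h x * G k x) * F (\<lambda>x. f k x * g x))"
    by (rule has_rank_factorization[OF F rank]) blast
  have 1: "\<exists>p. p \<noteq> 0 \<and> (\<lambda>x. poly p (x $ i)) \<in> Ann F" for i :: 'd
  proof -
    obtain c M where c: "\<exists>n\<le>M. c n \<noteq> 0"
      "\<And>h g. h \<in> hol_polys \<Longrightarrow> g \<in> antihol_polys \<Longrightarrow> (\<Sum>n\<le>M. c n * F (\<lambda>x. h x * (x $ i) ^ n * g x)) = 0"
      using annihilating_polynomial_exists[OF F smooth_fun_component[of i] hol_polys_smooth antihol_polys_smooth
          hol_polys_component antihol_polys_component fG] by blast
    show ?thesis
      by (rule annihilating_poly_Ann[OF F smooth_fun_component c(1) c(2)[OF fspan_base fspan_base]]) auto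
  qed
  have 2: "\<exists>p. p \<noteq> 0 \<and> (\<lambda>x. poly p (cnj (x $ i))) \<in> Ann F" for i :: 'd
  proof -
    \<comment> \<open>Biorthogonality and factorization are symmetric in the two families, so their
      roles can be exchanged, with \<open>cnj (x $ i)\<close> as the coordinate.\<close>
    have dual: "F (\<lambda>x. G k x * f j x) = (if k = j then 1 else 0)" if "k < m" "j < m" for k j
      using fG(3)[OF that(2,1)] by (auto simp: mult.commute)
    have fac: "F (\<lambda>x. g x * h x) = (\<Sum>k<m. F (\<lambda>x. g x * f k x) * F (\<lambda>x. G k x * h x))"
      if "g \<in> antihol_polys" "h \<in> hol_polys" for g h
      using fG(4)[OF that(2,1)] by (simp add: mult.commute)
    have hc: "(\<lambda>x. h x * cnj (cnj (x $ i))) \<in> hol_polys" if "h \<in> hol_polys" for h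
      using hol_polys_component[OF that] by simp
    obtain c M where c: "\<exists>n\<le>M. c n \<noteq> 0"
      "\<And>h g. h \<in> hol_polys \<Longrightarrow> g \<in> antihol_polys \<Longrightarrow> (\<Sum>n\<le>M. c n * F (\<lambda>x. g x * cnj (x $ i) ^ n * h x)) = 0"
      using annihilating_polynomial_exists[OF F smooth_fun_cnj[OF smooth_fun_component[of i]] antihol_polys_smooth hol_polys_smooth
          antihol_polys_component hc fG(2) fG(1) dual fac] by blast
    have "(\<Sum>n\<le>M. c n * F (\<lambda>x. monom \<alpha> (\<lambda>_. 0) x * cnj (x $ i) ^ n * monom (\<lambda>_. 0) \<beta> x)) = 0" for \<alpha> \<beta>
      using c(2)[OF fspan_base fspan_base, of "monom \<alpha> (\<lambda>_. 0)" "monom (\<lambda>_. 0) \<beta>"] by (simp add: mult_ac)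
    then show ?thesis
      by (rule annihilating_poly_Ann[OF F smooth_fun_cnj[OF smooth_fun_component] c(1)])
  qed
  obtain p where p: "\<And>i. p i \<noteq> 0" "\<And>i::'d. (\<lambda>x. poly (p i) (x $ i)) \<in> Ann F" using 1 by metis
  obtain p' where p': "\<And>i. p' i \<noteq> 0" "\<And>i::'d. (\<lambda>x. poly (p' i) (cnj (x $ i))) \<in> Ann F" using 2 by metis
  \<comment> \<open>Roots found for the conjugate coordinates are conjugated, so that the second
    annihilator becomes the conjugate of the first.\<close>
  define S where "S = (\<Union>i. {z. poly (p i) z = 0} \<union> cnj ` {z. poly (p' i) z = 0})"
  define n where "n = (\<Sum>i\<in>UNIV. degree (p i) + degree (p' i))"
  have S: "finite S" unfolding S_def using p(1) p'(1) by (auto simp: poly_roots_finite)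
  have n: "degree (p i) \<le> n" "degree (p' i) \<le> n" for i
    unfolding n_def using member_le_sum[of i UNIV "\<lambda>i. degree (p i) + degree (p' i)"] by auto
  show thesis
  proof (rule that[OF S])
    fix i
    show "(\<lambda>x. (\<Prod>s\<in>S. x $ i - s) ^ n) \<in> Ann F"
      by (rule annihilator_root_power[OF p smooth_fun_component S _ n(1)]) (auto simp: S_def)
    have sub: "{z. poly (p' i) z = 0} \<subseteq> cnj ` S"
    proof
      fix z assume "z \<in> {z. poly (p' i) z = 0}"
      then have "cnj z \<in> S" by (auto simp: S_def)
      then show "z \<in> cnj ` S" by (metis complex_cnj_cnj image_eqI)
    qed
    have "(\<lambda>x. (\<Prod>s\<in>cnj ` S. cnj (x $ i) - s) ^ n) \<in> Ann F"
      by (rule annihilator_root_power[OF p' smooth_fun_cnj[OF smooth_fun_component] finite_imageI[OF S] sub n(2)])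
    moreover have "(\<Prod>s\<in>cnj ` S. cnj (x $ i) - s) = cnj (\<Prod>s\<in>S. x $ i - s)" for x :: "complex^'d"
      by (subst prod.reindex) (auto simp: inj_on_def cnj_prod)
    ultimately show "(\<lambda>x. cnj ((\<Prod>s\<in>S. x $ i - s) ^ n)) \<in> Ann F" by simp
  qed
qed

section \<open>Taylor expansion of polynomials\<close>

text \<open>Summing over words in the basis vectors instead of multi-indices makes the Taylor coefficient
  of a word \<open>w\<close> simply \<open>1 / fact (length w)\<close>.\<close>
definition word_monom :: "'a::euclidean_space \<Rightarrow> 'a list \<Rightarrow> 'a \<Rightarrow> complex" where
  "word_monom q w x = prod_list (map (\<lambda>b. of_real ((x - q) \<bullet> b)) w)"

lemma smooth_fun_shifted_coord: "smooth_fun (\<lambda>x. complex_of_real ((x - q) \<bullet> b))"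
  unfolding inner_diff_left of_real_diff by (intro smooth_fun_diff smooth_fun_coord smooth_fun_const)

lemma word_monom_Cons: "word_monom q (b # w) = (\<lambda>x. of_real ((x - q) \<bullet> b) * word_monom q w x)"
  by (simp add: word_monom_def fun_eq_iff)

lemma smooth_fun_word_monom: "smooth_fun (word_monom q w)"
proof (induction w)
  case Nil
  show ?case by (simp add: word_monom_def[abs_def])
next
  case (Cons b w)
  then show ?case unfolding word_monom_Cons by (intro smooth_fun_mult smooth_fun_shifted_coord)
qed

text \<open>Degree less than \<open>K\<close> is expressed by the vanishing of all derivatives of
  order at least \<open>K\<close>; a coordinate factor raises the degree by at most one. In the
  product rule the coordinate contributes a constant, and the other term involves
  \<open>pd v g\<close>, of lower degree.\<close>

lemma dderiv_coord_mult_vanishes: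
  assumes "smooth_fun g" "\<And>w. length w \<ge> K \<Longrightarrow> dderiv w g = (\<lambda>x. 0)" "length w \<ge> Suc K"
  shows "dderiv w (\<lambda>x. of_real (x \<bullet> b) * g x) = (\<lambda>x. 0)"
  using assms
proof (induction K arbitrary: g w)
  case 0
  have "g = (\<lambda>x. 0)" using 0(2)[of "[]"] by simp
  then show ?case by (simp add: dderiv_zero)
next
  case (Suc K)
  obtain vs v where w: "w = vs @ [v]" using Suc.prems(3) by (cases w rule: rev_cases) auto
  have len: "length vs \<ge> Suc K" using Suc.prems(3) w by simp
  note g = Suc.prems(1)
  have g': "smooth_fun (pd v g)" by (rule smooth_fun_pd[OF g])
  have 0: "dderiv w' (pd v g) = (\<lambda>x. 0)" if "length w' \<ge> K" for w'
    using Suc.prems(2)[of "w' @ [v]"] that by (simp add: dderiv_snoc)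
  have 1: "dderiv vs (\<lambda>x. of_real (x \<bullet> b) * pd v g x) = (\<lambda>x. 0)"
    by (rule Suc.IH[OF g' 0 len])
  have 2: "dderiv vs (\<lambda>x. of_real (v \<bullet> b) * g x) = (\<lambda>x. 0)"
    using Suc.prems(2)[of vs] len by (simp add: dderiv_cmult[OF g])
  have "dderiv w (\<lambda>x. of_real (x \<bullet> b) * g x) = dderiv vs (\<lambda>x. of_real (v \<bullet> b) * g x + of_real (x \<bullet> b) * pd v g x)"
    unfolding w dderiv_snoc pd_smooth_mult[OF smooth_fun_coord g] pd_coord ..
  also have "\<dots> = (\<lambda>x. 0)"
    using dderiv_add[OF smooth_fun_mult[OF smooth_fun_const g] smooth_fun_mult[OF smooth_fun_coord g'], of vs] 1 2
    by simp
  finally show ?case .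
qed

lemma ppoly_dderiv_vanishes: "ppoly p \<Longrightarrow> \<exists>K. \<forall>w. length w \<ge> K \<longrightarrow> dderiv w p = (\<lambda>x. 0)"
proof (induction rule: ppoly.induct)
  case (const c)
  have "dderiv w (\<lambda>x. c) = (\<lambda>x. 0)" if len: "length w \<ge> 1" for w :: "'a list"
  proof -
    obtain vs v where w: "w = vs @ [v]" using len by (cases w rule: rev_cases) auto
    show ?thesis unfolding w dderiv_snoc by (simp add: dderiv_zero)
  qed
  then show ?case by blast
next
  case (var b p)
  then obtain K where "\<And>w. length w \<ge> K \<Longrightarrow> dderiv w p = (\<lambda>x. 0)" by blast
  from dderiv_coord_mult_vanishes[OF ppoly_smooth[OF var(2)] this]
  show ?case by blast
next
  case (add p q)
  then obtain K K' where "\<And>w. length w \<ge> K \<Longrightarrow> dderiv w p = (\<lambda>x. 0)" "\<And>w. length w \<ge> K' \<Longrightarrow> dderiv w q = (\<lambda>x. 0)" by blast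
  then have "dderiv w (\<lambda>x. p x + q x) = (\<lambda>x. 0)" if "length w \<ge> max K K'" for w
    using that by (simp add: dderiv_add[OF ppoly_smooth[OF add(1)] ppoly_smooth[OF add(2)]])
  then show ?case by blast
qed

lemma pd_expand:
  fixes f :: "'a::euclidean_space \<Rightarrow> complex"
  assumes "smooth_fun f"
  shows "pd y f x = (\<Sum>b\<in>Basis. of_real (y \<bullet> b) * pd b f x)"
proof -
  interpret bounded_linear "\<lambda>v. pd v f x"
    by (rule has_derivative_bounded_linear[OF smooth_fun_has_derivative[OF assms]])
  have "pd y f x = pd (\<Sum>b\<in>Basis. (y \<bullet> b) *\<^sub>R b) f x"
    by (simp add: euclidean_representation)
  also have "\<dots> = (\<Sum>b\<in>Basis. (y \<bullet> b) *\<^sub>R pd b f x)"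
    unfolding sum by (simp add: scaleR)
  finally show ?thesis by (simp add: scaleR_conv_of_real)
qed

text \<open>Taylor's formula on the segment from \<open>q\<close> to \<open>x\<close>, where the
  remainder vanishes for high order. All large \<open>K\<close> are covered so that \<open>K\<close>
  can be taken above a further bound as well.\<close>

lemma ppoly_taylor:
  fixes p :: "'a::euclidean_space \<Rightarrow> complex"
  assumes p: "ppoly p"
  shows "\<exists>K0. \<forall>K\<ge>K0. \<forall>x. p x = (\<Sum>w\<in>dirs K. word_monom q w x / fact (length w) * dderiv w p q)"
proof -
  obtain K0 where K0: "\<And>w. length w \<ge> K0 \<Longrightarrow> dderiv w p = (\<lambda>x. 0)"
    using ppoly_dderiv_vanishes[OF p] by blast
  have ps: "smooth_fun p" by (rule ppoly_smooth[OF p])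
  define W where "W k = {w :: 'a list. set w \<subseteq> Basis \<and> length w = k}" for k
  have finW: "finite (W k)" for k
    unfolding W_def by (rule finite_lists_length_eq[OF finite_Basis])
  have "p x = (\<Sum>w\<in>dirs K. word_monom q w x / fact (length w) * dderiv w p q)" if K: "K \<ge> K0" for K x
  proof -
    define y where "y = x - q"
    \<comment> \<open>The \<open>k\<close>-th derivative in \<open>t\<close> of p(q + ty), expanded
      in basis directions.\<close>
    define D where "D k t = (\<Sum>w\<in>W k. word_monom q w x * dderiv w p (q + t *\<^sub>R y))" for k and t :: real
    have WS: "W (Suc k) = (\<lambda>(w, b). b # w) ` (W k \<times> Basis)" for k
      unfolding W_def by (rule lists_length_Suc_eq)
    have DS: "D (Suc k) t = (\<Sum>w\<in>W k. word_monom q w x * pd y (dderiv w p) (q + t *\<^sub>R y))" for k t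
    proof -
      have "D (Suc k) t = (\<Sum>(w, b)\<in>W k \<times> Basis. word_monom q (b # w) x * dderiv (b # w) p (q + t *\<^sub>R y))"
        unfolding D_def WS by (subst sum.reindex) (auto simp: inj_on_def case_prod_unfold)
      also have "\<dots> = (\<Sum>w\<in>W k. \<Sum>b\<in>Basis. word_monom q (b # w) x * dderiv (b # w) p (q + t *\<^sub>R y))"
        by (rule sum.cartesian_product[symmetric])
      also have "\<dots> = (\<Sum>w\<in>W k. word_monom q w x * pd y (dderiv w p) (q + t *\<^sub>R y))"
        unfolding pd_expand[OF smooth_fun_dderiv[OF ps], where y=y] sum_distrib_left
        by (intro sum.cong refl) (simp add: word_monom_Cons y_def mult_ac)
      finally show ?thesis .
    qed
    have der: "(D k has_vector_derivative D (Suc k) t) (at t within {0..1})" for k t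
      unfolding DS unfolding D_def
      by (rule has_vector_derivative_sum, rule has_vector_derivative_mult_right,
          rule has_vector_derivative_at_within, rule smooth_fun_line_derivative, rule smooth_fun_dderiv[OF ps])
    have D0: "D (Suc K) t = 0" for t
    proof -
      have "dderiv w p = (\<lambda>x. 0)" if "w \<in> W (Suc K)" for w
        using K0[of w] that K by (simp add: W_def)
      then show ?thesis by (simp add: D_def)
    qed
    have "D 0 1 = (\<Sum>i<Suc K. ((1 - 0) ^ i / fact i) *\<^sub>R D i 0) +
        integral {0..1} (\<lambda>t. ((1 - t) ^ (Suc K - 1) / fact (Suc K - 1)) *\<^sub>R D (Suc K) t)"
      by (rule Taylor_integral[where f="D 0"]) (use der in auto)
    then have "D 0 1 = (\<Sum>i<Suc K. (1 / fact i) *\<^sub>R D i 0)"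
      unfolding D0 by simp
    moreover have "D 0 1 = p x"
    proof -
      have "W 0 = {[]}" by (auto simp: W_def)
      then show ?thesis by (simp add: D_def word_monom_def y_def)
    qed
    moreover have "(\<Sum>i<Suc K. (1 / fact i) *\<^sub>R D i 0) = (\<Sum>w\<in>dirs K. word_monom q w x / fact (length w) * dderiv w p q)"
    proof -
      have "dirs K = (\<Union>i\<in>{..<Suc K}. W i)"
        by (auto simp: dirs_def W_def)
      then have "(\<Sum>w\<in>dirs K. word_monom q w x / fact (length w) * dderiv w p q) =
          (\<Sum>i<Suc K. \<Sum>w\<in>W i. word_monom q w x / fact (length w) * dderiv w p q)"
        by (simp only:) (rule sum.UNION_disjoint, auto simp: finW, auto simp: W_def)
      also have "\<dots> = (\<Sum>i<Suc K. (1 / fact i) *\<^sub>R D i 0)"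
        by (intro sum.cong refl)
          (auto simp: D_def scaleR_conv_of_real sum_distrib_left W_def intro!: sum.cong)
      finally show ?thesis ..
    qed
    ultimately show ?thesis by simp
  qed
  then show ?thesis by blast
qed

section \<open>Distributions annihilated by a power of a polynomial in each coordinate\<close>

lemma word_monom_power_factor:
  assumes "k \<le> count_list w b"
  shows "\<exists>r. smooth_fun r \<and> (\<forall>x. word_monom q w x = of_real ((x - q) \<bullet> b) ^ k * r x)"
  using assms
proof (induction w arbitrary: k)
  case Nil
  then show ?case by (intro exI[of _ "\<lambda>_. 1"]) (simp add: word_monom_def)
next
  case (Cons c w)
  show ?case
  proof (cases "c = b \<and> k > 0")
    case True
    then obtain k' where k: "k = Suc k'" using gr0_implies_Suc by blast
    then obtain r where r: "smooth_fun r" "\<And>x. word_monom q w x = of_real ((x - q) \<bullet> b) ^ k' * r x"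
      using Cons.IH[of k'] Cons.prems True by auto
    then show ?thesis
      using True by (intro exI[of _ r]) (auto simp: word_monom_Cons k)
  next
    case False
    then have "k \<le> count_list w b" using Cons.prems by (cases "c = b") auto
    then obtain r where r: "smooth_fun r" "\<And>x. word_monom q w x = of_real ((x - q) \<bullet> b) ^ k * r x"
      using Cons.IH[of k] by blast
    then show ?thesis
      by (intro exI[of _ "\<lambda>x. of_real ((x - q) \<bullet> c) * r x"])
        (auto simp: word_monom_Cons mult_ac intro!: smooth_fun_mult smooth_fun_shifted_coord)
  qed
qed

text \<open>The functions \<open>u q\<close>, for \<open>q\<close> with all coordinates in \<open>S\<close>, have disjoint supports, and \<open>F\<close> vanishes away
  from the points \<open>q\<close>.\<close>
locale root_cutoffs =
  fixes F :: "(complex^'d::finite \<Rightarrow> complex) \<Rightarrow> complex" and S :: "complex set" and n :: nat and \<rho> :: real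
    and u :: "complex^'d \<Rightarrow> complex^'d \<Rightarrow> complex"
  assumes F: "comp_distr F" and S: "finite S"
    and hol: "\<And>i. (\<lambda>x. (\<Prod>s\<in>S. x $ i - s) ^ n) \<in> Ann F"
    and antihol: "\<And>i. (\<lambda>x. cnj ((\<Prod>s\<in>S. x $ i - s) ^ n)) \<in> Ann F"
    and \<rho>: "\<rho> > 0" and sep: "\<And>s s'. s \<in> S \<Longrightarrow> s' \<in> S \<Longrightarrow> s \<noteq> s' \<Longrightarrow> 4 * \<rho> \<le> dist s s'"
    and u: "\<And>q. smooth_fun (u q)"
    and u1: "\<And>q x. dist x q \<le> \<rho> \<Longrightarrow> u q x = 1" and u0: "\<And>q x. dist x q \<ge> 2 * \<rho> \<Longrightarrow> u q x = 0"
begin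

text \<open>The candidates for support points: a common zero of the coordinate annihilators has all
  its coordinates in \<open>S\<close>.\<close>

definition grid :: "(complex^'d) set" where
  "grid = {q. \<forall>i. q $ i \<in> S}"

lemma finite_grid: "finite grid"
proof -
  have "grid = vec_lambda ` {f. \<forall>i. f i \<in> S}"
    by (auto simp: grid_def image_iff) (metis vec_lambda_eta)
  moreover have "finite {f :: 'd \<Rightarrow> complex. \<forall>i. f i \<in> S}"
    using finite_PiE[of "UNIV :: 'd set" "\<lambda>_. S"] S by (simp add: PiE_UNIV_domain Pi_def)
  ultimately show ?thesis by simp
qed

lemma smooth_fun_prod_power: "smooth_fun (\<lambda>x::complex^'d. (\<Prod>s\<in>T. x $ i - s) ^ k)"
  by (intro smooth_fun_power smooth_fun_prod smooth_fun_diff smooth_fun_component smooth_fun_const)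

lemma prod_power_lower:
  assumes "r \<ge> 0" "\<And>s. s \<in> T \<Longrightarrow> r \<le> norm (z - s)"
  shows "(r ^ card T) ^ k \<le> norm ((\<Prod>s\<in>T. z - s) ^ k :: complex)"
proof -
  have "(\<Prod>s\<in>T. r) \<le> (\<Prod>s\<in>T. norm (z - s))"
    by (rule prod_mono) (use assms in auto)
  then show ?thesis
    unfolding norm_power prod_norm[symmetric] using assms(1) by (intro power_mono) auto
qed

lemma cutoff_sum_one:
  assumes q: "q \<in> grid" and x: "dist x q \<le> \<rho>"
  shows "(\<Sum>q\<in>grid. u q x) = 1"
proof -
  have "u q' x = 0" if q': "q' \<in> grid" "q' \<noteq> q" for q'
  proof (rule u0)
    obtain i where i: "q' $ i \<noteq> q $ i" using q'(2) by (auto simp: Finite_Cartesian_Product.vec_eq_iff)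
    have "4 * \<rho> \<le> dist (q' $ i) (q $ i)"
      using q q'(1) i by (intro sep) (auto simp: grid_def)
    also have "\<dots> \<le> dist q' q" by (rule dist_vec_nth_le)
    finally show "2 * \<rho> \<le> dist x q'" using x \<rho> dist_triangle[of q' q x] by (simp add: dist_commute)
  qed
  then have "(\<Sum>q\<in>grid. u q x) = (\<Sum>q'\<in>{q}. u q' x)"
    by (intro sum.mono_neutral_right finite_grid) (use q in auto)
  then show ?thesis using u1[OF x] by simp
qed

text \<open>The sum \<open>G\<close> of the squared moduli of the coordinate annihilators lies in
  the ideal and is bounded below wherever some coordinate stays away from \<open>S\<close>. This
  includes every point where the cutoffs do not sum to 1, so \<open>G\<close> can be divided
  out.\<close>

lemma one_minus_cutoffs_Ann: "(\<lambda>x. 1 - (\<Sum>q\<in>grid. u q x)) \<in> Ann F"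
proof -
  define P where "P i x = (\<Prod>s\<in>S. x $ i - s) ^ n" for i and x :: "complex^'d"
  \<comment> \<open>If each coordinate is closer than \<open>r\<close> to \<open>S\<close>, the sum
    of the coordinate distances to a grid point, which dominates the Euclidean distance, is at most
    \<rho>.\<close>
  define r where "r = \<rho> / CARD('d)"
  have r: "r > 0" using \<rho> by (simp add: r_def)
  define \<epsilon> where "\<epsilon> = ((r ^ card S) ^ n)\<^sup>2"
  have \<epsilon>: "\<epsilon> > 0" using r by (simp add: \<epsilon>_def)
  define G where "G x = (\<Sum>i\<in>UNIV. P i x * cnj (P i x))" for x
  have Psm: "smooth_fun (P i)" for i unfolding P_def by (rule smooth_fun_prod_power)
  have "(\<lambda>x. P i x * cnj (P i x)) \<in> Ann F" for i
    by (rule Ann_mult_right[OF _ smooth_fun_cnj[OF Psm]]) (use hol[of i] in \<open>simp add: P_def[abs_def]\<close>)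
  then have G: "G \<in> Ann F" unfolding G_def[abs_def] by (rule Ann_sum[OF F])
  have G_eq: "G x = of_real (\<Sum>i\<in>UNIV. (norm (P i x))\<^sup>2)" for x
    unfolding G_def complex_norm_square[symmetric] by simp
  have "(\<lambda>x. 1 * (1 - (\<Sum>q\<in>grid. u q x))) \<in> Ann F"
  proof (rule Ann_divide)
    show "(\<lambda>x. 1 * G x) \<in> Ann F" using G by simp
    show "smooth_fun G" by (rule Ann_smooth[OF G])
    show "smooth_fun (\<lambda>x. 1 - (\<Sum>q\<in>grid. u q x))"
      by (intro smooth_fun_diff smooth_fun_sum smooth_fun_const u)
    show "\<epsilon>\<^sup>2 > 0" using \<epsilon> by simp
    fix x assume ne: "1 - (\<Sum>q\<in>grid. u q x) \<noteq> 0"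
    have "\<exists>i. \<forall>s\<in>S. r \<le> norm (x $ i - s)"
    proof (rule ccontr)
      assume "\<not> ?thesis"
      then have "\<forall>i. \<exists>s. s \<in> S \<and> norm (x $ i - s) < r" by (metis not_le)
      then obtain t where t: "\<And>i. t i \<in> S" "\<And>i. norm (x $ i - t i) < r" by metis
      define q where "q = vec_lambda t"
      have qi: "q $ i = t i" for i by (simp add: q_def)
      have "q \<in> grid" using t(1) by (simp add: grid_def qi)
      moreover have "dist x q \<le> \<rho>"
      proof -
        have "dist x q \<le> (\<Sum>i\<in>UNIV. dist (x $ i) (q $ i))"
          unfolding dist_vec_def by (rule L2_set_le_sum) simp
        also have "\<dots> \<le> (\<Sum>i\<in>(UNIV::'d set). r)"
          using t(2) by (intro sum_mono) (auto simp: qi dist_norm less_imp_le)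
        finally show ?thesis by (simp add: r_def)
      qed
      ultimately show False using cutoff_sum_one[of q x] ne by simp
    qed
    then obtain i where i: "\<And>s. s \<in> S \<Longrightarrow> r \<le> norm (x $ i - s)" by blast
    have "(r ^ card S) ^ n \<le> norm (P i x)"
      unfolding P_def by (rule prod_power_lower) (use r i in auto)
    then have "\<epsilon> \<le> (norm (P i x))\<^sup>2"
      unfolding \<epsilon>_def using r by (intro power_mono) auto
    also have "\<dots> \<le> (\<Sum>i\<in>UNIV. (norm (P i x))\<^sup>2)"
      by (rule member_le_sum) auto
    also have "\<dots> \<le> norm (G x)" unfolding G_eq by (simp only: norm_of_real abs_ge_self)
    \<comment> \<open>\<open>Ann_divide\<close> wants a bound on the squared norm, and \<epsilon>
      bounds the norm of \<open>G\<close> itself; hence the square.\<close>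
    finally show "\<epsilon>\<^sup>2 \<le> (norm (G x))\<^sup>2" using \<epsilon> by (intro power_mono) auto
  qed
  then show ?thesis by simp
qed

lemma distr_eq_sum_cutoffs:
  assumes f: "smooth_fun f"
  shows "F f = (\<Sum>q\<in>grid. F (\<lambda>x. u q x * f x))"
proof -
  have sm: "smooth_fun (\<lambda>x. u q x * f x)" for q by (intro smooth_fun_mult u f)
  have "F (\<lambda>x. (1 - (\<Sum>q\<in>grid. u q x)) * f x) = 0"
    by (rule Ann_D[OF one_minus_cutoffs_Ann f])
  moreover have "(\<lambda>x. (1 - (\<Sum>q\<in>grid. u q x)) * f x) = (\<lambda>x. f x - (\<Sum>q\<in>grid. u q x * f x))"
    by (simp add: left_diff_distrib sum_distrib_right)
  moreover have "F (\<lambda>x. f x - (\<Sum>q\<in>grid. u q x * f x)) = F f - F (\<lambda>x. \<Sum>q\<in>grid. u q x * f x)"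
    by (rule comp_distr_diff[OF F f]) (intro smooth_fun_sum sm)
  ultimately show ?thesis using comp_distr_sum[OF F sm] by simp
qed

lemma cutoff_coord_lower:
  assumes q: "q \<in> grid" and x: "u q x \<noteq> 0" and s: "s \<in> S" "s \<noteq> q $ i"
  shows "2 * \<rho> \<le> norm (x $ i - s)"
proof -
  have "dist x q < 2 * \<rho>" using u0[where q=q and x=x] x by (meson not_le)
  then have "dist (x $ i) (q $ i) < 2 * \<rho>" using dist_vec_nth_le[of x i q] by linarith
  moreover have "4 * \<rho> \<le> dist s (q $ i)" using q s by (intro sep) (auto simp: grid_def)
  ultimately show ?thesis using dist_triangle[of s "q $ i" "x $ i"] by (simp add: dist_norm norm_minus_commute)
qed

text \<open>On the support of \<open>u q\<close> the factors belonging to the other points of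
  \<open>S\<close> are bounded away from zero, so they can be divided out of the
  annihilator.\<close>

lemma coord_power_cutoff_Ann:
  assumes q: "q \<in> grid"
  shows "(\<lambda>x. (x $ i - q $ i) ^ n * u q x) \<in> Ann F"
    and "(\<lambda>x. cnj ((x $ i - q $ i) ^ n) * u q x) \<in> Ann F"
proof -
  define E where "E x = (\<Prod>s\<in>S - {q $ i}. x $ i - s) ^ n" for x :: "complex^'d"
  have E: "smooth_fun E" unfolding E_def by (rule smooth_fun_prod_power)
  have prod: "(x $ i - q $ i) ^ n * E x = (\<Prod>s\<in>S. x $ i - s) ^ n" for x
    unfolding E_def power_mult_distrib[symmetric]
    using prod.remove[OF S, of "q $ i" "\<lambda>s. x $ i - s"] q by (simp add: grid_def)
  define \<epsilon> where "\<epsilon> = (((2 * \<rho>) ^ card (S - {q $ i})) ^ n)\<^sup>2"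
  have \<epsilon>: "\<epsilon> > 0" using \<rho> by (simp add: \<epsilon>_def)
  have low: "\<epsilon> \<le> (norm (E x))\<^sup>2" if "u q x \<noteq> 0" for x
    unfolding \<epsilon>_def E_def using \<rho> cutoff_coord_lower[OF q that]
    by (intro power_mono[OF prod_power_lower]) auto
  show "(\<lambda>x. (x $ i - q $ i) ^ n * u q x) \<in> Ann F"
  proof (rule Ann_divide[OF _ E u \<epsilon>])
    show "(\<lambda>x. (x $ i - q $ i) ^ n * E x) \<in> Ann F" unfolding prod by (rule hol)
  qed (rule low)
  have prod': "cnj ((x $ i - q $ i) ^ n) * cnj (E x) = cnj ((\<Prod>s\<in>S. x $ i - s) ^ n)" for x
    unfolding prod[symmetric] by simp
  show "(\<lambda>x. cnj ((x $ i - q $ i) ^ n) * u q x) \<in> Ann F"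
  proof (rule Ann_divide[OF _ smooth_fun_cnj[OF E] u \<epsilon>])
    show "(\<lambda>x. cnj ((x $ i - q $ i) ^ n) * cnj (E x)) \<in> Ann F" unfolding prod' by (rule antihol)
    show "\<epsilon> \<le> (norm (cnj (E x)))\<^sup>2" if "u q x \<noteq> 0" for x
      using low[OF that] by simp
  qed
qed

text \<open>A shifted real coordinate is a combination of a shifted complex coordinate and its
  conjugate. In the binomial expansion of its \<open>2 * n\<close>-th power every term contains at
  least \<open>n\<close> factors of one of the two.\<close>

lemma real_coord_power_cutoff_Ann:
  assumes q: "q \<in> grid" and b: "b \<in> Basis"
  shows "(\<lambda>x. of_real ((x - q) \<bullet> b) ^ (2 * n) * u q x) \<in> Ann F"
proof -
  obtain i c e where eq: "\<And>x. complex_of_real (x \<bullet> b) = c * (x $ i) + e * cnj (x $ i)"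
    using b
  proof (cases b rule: Basis_coord_cases)
    case (re i)
    then show thesis by (intro that[of "1/2" i "1/2"]) (simp add: add_divide_distrib)
  next
    case (im i)
    then show thesis by (intro that[of "- \<i>/2" i "\<i>/2"]) (simp add: field_simps)
  qed
  let ?v = "\<lambda>x::complex^'d. x $ i - q $ i"
  have v: "smooth_fun ?v" by (intro smooth_fun_diff smooth_fun_component smooth_fun_const)
  have trm: "(\<lambda>x. of_nat ((2 * n) choose k) * (c * ?v x) ^ k * (e * cnj (?v x)) ^ (2 * n - k) * u q x) \<in> Ann F" for k
  proof (cases "n \<le> k")
    case True
    have eq1: "of_nat ((2 * n) choose k) * (c * ?v x) ^ k * (e * cnj (?v x)) ^ (2 * n - k) * u q x =
       ?v x ^ n * u q x * (of_nat ((2 * n) choose k) * c ^ k * ?v x ^ (k - n) * (e * cnj (?v x)) ^ (2 * n - k))" for x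
    proof -
      have "?v x ^ k = ?v x ^ n * ?v x ^ (k - n)" using True by (simp flip: power_add)
      then show ?thesis by (simp only: power_mult_distrib mult_ac)
    qed
    show ?thesis unfolding eq1
      by (intro Ann_mult_right[OF coord_power_cutoff_Ann(1)[OF q]] smooth_fun_mult smooth_fun_power smooth_fun_cnj v
          smooth_fun_const)
  next
    case False
    define j where "j = 2 * n - k"
    have eq1: "of_nat ((2 * n) choose k) * (c * ?v x) ^ k * (e * cnj (?v x)) ^ j * u q x =
       cnj (?v x ^ n) * u q x * (of_nat ((2 * n) choose k) * (c * ?v x) ^ k * e ^ j * cnj (?v x) ^ (j - n))" for x
    proof -
      have "cnj (?v x) ^ j = cnj (?v x ^ n) * cnj (?v x) ^ (j - n)"
      proof -
        have "j = n + (j - n)" using False by (simp add: j_def)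
        then have "cnj (?v x) ^ j = cnj (?v x) ^ (n + (j - n))" by (rule arg_cong)
        then show ?thesis by (simp only: power_add complex_cnj_power)
      qed
      then show ?thesis by (simp only: power_mult_distrib mult_ac)
    qed
    show ?thesis unfolding j_def[symmetric] eq1
      by (intro Ann_mult_right[OF coord_power_cutoff_Ann(2)[OF q]] smooth_fun_mult smooth_fun_power smooth_fun_cnj v
          smooth_fun_const)
  qed
  have "of_real ((x - q) \<bullet> b) ^ (2 * n) * u q x =
    (\<Sum>k\<le>2 * n. of_nat ((2 * n) choose k) * (c * ?v x) ^ k * (e * cnj (?v x)) ^ (2 * n - k) * u q x)" for x
  proof -
    have "complex_of_real ((x - q) \<bullet> b) = c * ?v x + e * cnj (?v x)"
      unfolding eq by simp
    then show ?thesis by (simp only: binomial_ring sum_distrib_right)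
  qed
  then show ?thesis using Ann_sum[OF F trm] by simp
qed

text \<open>A pigeonhole bound: a word of this length contains one of the
  \<open>DIM(complex^'d)\<close> basis vectors at least \<open>2 * n\<close> times.\<close>

definition jet_order :: nat where
  "jet_order = DIM(complex^'d) * (2 * n)"

lemma word_monom_cutoff_Ann:
  assumes q: "q \<in> grid" and w: "set w \<subseteq> Basis" "length w \<ge> jet_order"
  shows "(\<lambda>x. u q x * word_monom q w x) \<in> Ann F"
proof -
  have "\<exists>b\<in>(Basis :: (complex^'d) set). 2 * n \<le> count_list w b"
  proof (rule ccontr)
    assume "\<not> ?thesis"
    then have "(\<Sum>b\<in>Basis. count_list w b) < (\<Sum>b\<in>(Basis :: (complex^'d) set). 2 * n)"
      by (intro sum_strict_mono) auto
    then show False using w sum_count_set[OF w(1) finite_Basis] by (simp add: jet_order_def)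
  qed
  then obtain b where b: "b \<in> Basis" "2 * n \<le> count_list w b" by blast
  obtain r where r: "smooth_fun r" "\<And>x. word_monom q w x = of_real ((x - q) \<bullet> b) ^ (2 * n) * r x"
    using word_monom_power_factor[OF b(2), of q] by blast
  have "(\<lambda>x. u q x * word_monom q w x) = (\<lambda>x. of_real ((x - q) \<bullet> b) ^ (2 * n) * u q x * r x)"
    unfolding r(2) by (simp only: mult_ac)
  then show ?thesis
    using Ann_mult_right[OF real_coord_power_cutoff_Ann[OF q b(1)] r(1)] by simp
qed

definition jet_coeff :: "complex^'d \<Rightarrow> (complex^'d) list \<Rightarrow> complex" where
  "jet_coeff q w = F (\<lambda>x. u q x * word_monom q w x) / fact (length w)"

lemma cutoff_ppoly_jet:
  assumes q: "q \<in> grid" and p: "ppoly p"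
  shows "F (\<lambda>x. u q x * p x) = (\<Sum>w\<in>dirs jet_order. jet_coeff q w * dderiv w p q)"
proof -
  obtain K0 where K0: "\<And>K x. K \<ge> K0 \<Longrightarrow> p x = (\<Sum>w\<in>dirs K. word_monom q w x / fact (length w) * dderiv w p q)"
    using ppoly_taylor[OF p, of q] by blast
  define K where "K = max K0 jet_order"
  have sm: "smooth_fun (\<lambda>x. u q x * word_monom q w x)" for w by (intro smooth_fun_mult u smooth_fun_word_monom)
  have "F (\<lambda>x. u q x * p x) = F (\<lambda>x. \<Sum>w\<in>dirs K. (dderiv w p q / fact (length w)) * (u q x * word_monom q w x))"
    by (subst K0[of K]) (simp_all add: K_def sum_distrib_left mult_ac)
  also have "\<dots> = (\<Sum>w\<in>dirs K. (dderiv w p q / fact (length w)) * F (\<lambda>x. u q x * word_monom q w x))"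
    by (rule comp_distr_sum_cmult[OF F sm])
  also have "\<dots> = (\<Sum>w\<in>dirs K. jet_coeff q w * dderiv w p q)"
    by (rule sum.cong) (simp_all add: jet_coeff_def)
  also have "\<dots> = (\<Sum>w\<in>dirs jet_order. jet_coeff q w * dderiv w p q)"
  proof (rule sum.mono_neutral_right[OF finite_dirs])
    show "dirs jet_order \<subseteq> (dirs K :: (complex^'d) list set)" by (auto simp: dirs_def K_def)
    show "\<forall>w\<in>dirs K - dirs jet_order. jet_coeff q w * dderiv w p q = 0"
    proof
      fix w :: "(complex^'d) list" assume "w \<in> dirs K - dirs jet_order"
      then have "set w \<subseteq> Basis" "length w \<ge> jet_order" by (auto simp: dirs_def)
      from Ann_D[OF word_monom_cutoff_Ann[OF q this] smooth_fun_const[of 1]]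
      show "jet_coeff q w * dderiv w p q = 0" by (simp add: jet_coeff_def)
    qed
  qed
  finally show ?thesis .
qed

text \<open>Both sides are continuous under convergence of all derivatives, so the formula passes
  from polynomials to their limits.\<close>

lemma cutoff_jet:
  assumes q: "q \<in> grid" and f: "smooth_fun f"
  shows "F (\<lambda>x. u q x * f x) = (\<Sum>w\<in>dirs jet_order. jet_coeff q w * dderiv w f q)"
proof -
  obtain K where K: "compact K" and *:
    "\<And>f g h. (\<And>n. smooth_fun (f n)) \<Longrightarrow> smooth_fun g \<Longrightarrow> smooth_fun h \<Longrightarrow> cconv K f g
       \<Longrightarrow> (\<lambda>n. F (\<lambda>x. h x * f n x)) \<longlonglongrightarrow> F (\<lambda>x. h x * g x)"
    by (rule comp_distr_mult_cconv[OF F]) blast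
  \<comment> \<open>\<open>K\<close> need not contain \<open>q\<close>, where the right-hand side
    evaluates derivatives.\<close>
  obtain p where p: "\<And>n. ppoly (p n)" "cconv (insert q K) p f"
    by (rule ppoly_dense[OF compact_insert[OF K] f]) blast
  have "cconv K p f"
    using p(2) unfolding cconv_def by (meson subset_insertI uniform_limit_on_subset)
  then have 1: "(\<lambda>k. F (\<lambda>x. u q x * p k x)) \<longlonglongrightarrow> F (\<lambda>x. u q x * f x)"
    by (intro * ppoly_smooth p(1) f u)
  have "(\<lambda>k. dderiv w (p k) q) \<longlonglongrightarrow> dderiv w f q" if "w \<in> dirs jet_order" for w
    using p(2) that unfolding cconv_def dirs_def by (auto intro: tendsto_uniform_limitI[where S="insert q K"])
  then have "(\<lambda>k. \<Sum>w\<in>dirs jet_order. jet_coeff q w * dderiv w (p k) q) \<longlonglongrightarrow>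
      (\<Sum>w\<in>dirs jet_order. jet_coeff q w * dderiv w f q)"
    by (intro tendsto_sum tendsto_mult tendsto_const)
  then show ?thesis
    using LIMSEQ_unique[OF 1] by (simp add: cutoff_ppoly_jet[OF q p(1)])
qed

end

section \<open>The support and its cardinality\<close>

lemma hol_polys_factor:
  fixes i :: "'d::finite"
  assumes "h \<in> hol_polys" shows "(\<lambda>x. h x * (x $ i - c) ^ k) \<in> hol_polys"
proof (induction k)
  case (Suc k)
  have "(\<lambda>x. (- c) * (h x * (x $ i - c) ^ k)) \<in> hol_polys" by (rule fspan_cmult[OF Suc])
  from fspan_add[OF this hol_polys_component[OF Suc, of i]]
  show ?case by (simp add: algebra_simps)
qed (use assms in simp)

lemma antihol_polys_factor:
  fixes i :: "'d::finite"
  assumes "h \<in> antihol_polys" shows "(\<lambda>x. h x * cnj (x $ i - c) ^ k) \<in> antihol_polys"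
proof (induction k)
  case (Suc k)
  have "(\<lambda>x. (- cnj c) * (h x * cnj (x $ i - c) ^ k)) \<in> antihol_polys" by (rule fspan_cmult[OF Suc])
  from fspan_add[OF this antihol_polys_component[OF Suc, of i]]
  show ?case by (simp add: algebra_simps)
qed (use assms in simp)

lemma hol_polys_prod_factor:
  assumes "h \<in> (hol_polys :: (complex^'d::finite \<Rightarrow> complex) set)"
  shows "(\<lambda>x. h x * (\<Prod>t\<in>T. (x $ i t - c t) ^ k)) \<in> hol_polys"
proof (induction T rule: infinite_finite_induct)
  case (insert t T)
  then show ?case using hol_polys_factor[OF insert.IH, of "i t" "c t" k] by (simp add: mult_ac)
qed (use assms in simp_all)

lemma antihol_polys_prod_factor:
  assumes "h \<in> (antihol_polys :: (complex^'d::finite \<Rightarrow> complex) set)"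
  shows "(\<lambda>x. h x * cnj (\<Prod>t\<in>T. (x $ i t - c t) ^ k)) \<in> antihol_polys"
proof (induction T rule: infinite_finite_induct)
  case (insert t T)
  then show ?case using antihol_polys_factor[OF insert.IH, of "i t" "c t" k] by (simp add: mult_ac)
qed (use assms in simp_all)

section \<open>Identification of the support and separation of its points\<close>

context root_cutoffs
begin

definition active :: "(complex^'d) set" where
  "active = {q \<in> grid. u q \<notin> Ann F}"

lemma finite_active: "finite active"
  using finite_grid by (simp add: active_def)

lemma distr_eq_sum_active:
  assumes f: "smooth_fun f"
  shows "F f = (\<Sum>q\<in>active. F (\<lambda>x. u q x * f x))"
  unfolding distr_eq_sum_cutoffs[OF f]
  by (rule sum.mono_neutral_right[OF finite_grid]) (auto simp: active_def intro: Ann_D f)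

lemma distr_eq_sum_jets:
  assumes "smooth_fun f"
  shows "F f = (\<Sum>q\<in>active. \<Sum>w\<in>dirs jet_order. jet_coeff q w * dderiv w f q)"
  unfolding distr_eq_sum_active[OF assms]
  by (rule sum.cong[OF refl], rule cutoff_jet[OF _ assms]) (simp add: active_def)

lemma cutoff_local:
  assumes "q \<in> grid" "smooth_fun f" "smooth_fun g" "r > 0" "\<And>x. dist x q < r \<Longrightarrow> f x = g x"
  shows "F (\<lambda>x. u q x * f x) = F (\<lambda>x. u q x * g x)"
proof -
  have "dderiv w f q = dderiv w g q" for w
    by (rule dderiv_cong_open[of "ball q r"]) (use assms in \<open>auto simp: dist_commute\<close>)
  then show ?thesis by (simp add: cutoff_jet assms)
qed

text \<open>Functions supported off the active points have vanishing jets there, so \<open>F\<close>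
  kills them. Conversely, a bump at an active \<open>q\<close> changes no germ at \<open>q\<close>;
  if \<open>F\<close> vanished near \<open>q\<close>, inserting the bump would show that
  \<open>u q\<close> annihilates \<open>F\<close>.\<close>

lemma dsupp_eq_active: "dsupp F = active"
proof
  show "dsupp F \<subseteq> active"
  proof
    fix x assume x: "x \<in> dsupp F"
    show "x \<in> active"
    proof (rule ccontr)
      assume "x \<notin> active"
      have "F f = 0" if f: "smooth_fun f" and sub: "closure {x. f x \<noteq> 0} \<subseteq> - active" for f
      proof -
        have "dderiv w f q = 0" if "q \<in> active" for q w
        proof -
          have "dderiv w f q = dderiv w (\<lambda>x. 0) q"
          proof (rule dderiv_cong_open)
            show "open (- closure {x. f x \<noteq> 0})" by auto
            show "q \<in> - closure {x. f x \<noteq> 0}" using sub that by auto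
            show "f x = 0" if "x \<in> - closure {x. f x \<noteq> 0}" for x
              using that closure_subset[of "{x. f x \<noteq> 0}"] by auto
          qed
          then show ?thesis by (simp add: dderiv_zero)
        qed
        then show ?thesis unfolding distr_eq_sum_jets[OF f] by simp
      qed
      moreover have "open (- active)" using finite_active by (simp add: finite_imp_closed open_Compl)
      ultimately show False using x \<open>x \<notin> active\<close> unfolding dsupp_def by blast
    qed
  qed
  show "active \<subseteq> dsupp F"
  proof
    fix q assume q: "q \<in> active"
    then have qg: "q \<in> grid" by (simp add: active_def)
    show "q \<in> dsupp F"
    proof (rule ccontr)
      assume "q \<notin> dsupp F"
      then obtain U where U: "open U" "q \<in> U" and 0: "\<And>\<phi>. smooth_fun \<phi> \<Longrightarrow>
          compact (closure {x. \<phi> x \<noteq> 0}) \<Longrightarrow> closure {x. \<phi> x \<noteq> 0} \<subseteq> U \<Longrightarrow> F \<phi> = 0"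
        unfolding dsupp_def by blast
      obtain e where e: "e > 0" "cball q e \<subseteq> U" using U open_contains_cball by blast
      have "e / 2 > 0" using e by simp
      then obtain v where v: "smooth_fun v" "\<And>x. dist x q \<le> e / 2 \<Longrightarrow> v x = 1" "\<And>x. dist x q \<ge> 2 * (e / 2) \<Longrightarrow> v x = 0"
        by (rule bump_exists[of "e / 2" q]) blast
      have "F (\<lambda>x. u q x * f x) = 0" if f: "smooth_fun f" for f
      proof -
        have "F (\<lambda>x. u q x * f x) = F (\<lambda>x. u q x * (v x * f x))"
          by (rule cutoff_local[OF qg f smooth_fun_mult[OF v(1) f] \<open>e / 2 > 0\<close>]) (simp add: v(2))
        also have "\<dots> = 0"
        proof (rule 0)
          show "smooth_fun (\<lambda>x. u q x * (v x * f x))" by (intro smooth_fun_mult u v(1) f)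
          have "{x. u q x * (v x * f x) \<noteq> 0} \<subseteq> cball q e"
          proof (clarsimp simp: dist_commute)
            fix x assume "v x \<noteq> 0"
            then show "dist x q \<le> e" using v(3)[of x] by force
          qed
          then have "closure {x. u q x * (v x * f x) \<noteq> 0} \<subseteq> cball q e"
            and "bounded {x. u q x * (v x * f x) \<noteq> 0}"
            by (auto intro: closure_minimal[THEN subsetD] bounded_subset[OF bounded_cball])
          then show "compact (closure {x. u q x * (v x * f x) \<noteq> 0})" "closure {x. u q x * (v x * f x) \<noteq> 0} \<subseteq> U"
            using e(2) by (auto simp: compact_closure)
        qed
        finally show ?thesis .
      qed
      then have "u q \<in> Ann F" using u by (simp add: Ann_def)
      then show False using q by (simp add: active_def)
    qed
  qed
qed

definition sep_index :: "complex^'d \<Rightarrow> complex^'d \<Rightarrow> 'd" where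
  "sep_index q q' = (SOME i. q $ i \<noteq> q' $ i)"

lemma sep_index: "q \<noteq> q' \<Longrightarrow> q $ sep_index q q' \<noteq> q' $ sep_index q q'"
  unfolding sep_index_def by (rule someI_ex) (simp add: Finite_Cartesian_Product.vec_eq_iff)

text \<open>A holomorphic polynomial with a zero of order at least \<open>n\<close> at every other
  active point: the order at which a coordinate power annihilates the cutoff piece of
  \<open>F\<close> there.\<close>

definition separator :: "complex^'d \<Rightarrow> complex^'d \<Rightarrow> complex" where
  "separator q x = (\<Prod>q'\<in>active - {q}. (x $ sep_index q q' - q' $ sep_index q q') ^ n)"

lemma smooth_fun_separator: "smooth_fun (separator q)"
  unfolding separator_def[abs_def]
  by (intro smooth_fun_prod smooth_fun_power smooth_fun_diff smooth_fun_component smooth_fun_const)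

lemma separator_Ann:
  assumes "q' \<in> active" "q' \<noteq> q"
  shows "(\<lambda>x. separator q x * u q' x) \<in> Ann F" "(\<lambda>x. cnj (separator q x) * u q' x) \<in> Ann F"
proof -
  let ?i = "sep_index q q'"
  have q': "q' \<in> grid" using assms by (simp add: active_def)
  define r where "r x = (\<Prod>t\<in>active - {q} - {q'}. (x $ sep_index q t - t $ sep_index q t) ^ n)" for x
  have r: "smooth_fun r"
    unfolding r_def by (intro smooth_fun_prod smooth_fun_power smooth_fun_diff smooth_fun_component smooth_fun_const)
  have eq: "separator q x = (x $ ?i - q' $ ?i) ^ n * r x" for x
    unfolding separator_def r_def using assms finite_active by (subst prod.remove[of _ q']) auto
  have "(\<lambda>x. separator q x * u q' x) = (\<lambda>x. (x $ ?i - q' $ ?i) ^ n * u q' x * r x)"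
    unfolding eq by (simp only: mult_ac)
  then show "(\<lambda>x. separator q x * u q' x) \<in> Ann F"
    using Ann_mult_right[OF coord_power_cutoff_Ann(1)[OF q'] r] by simp
  have "(\<lambda>x. cnj (separator q x) * u q' x) = (\<lambda>x. cnj ((x $ ?i - q' $ ?i) ^ n) * u q' x * cnj (r x))"
    unfolding eq complex_cnj_mult by (simp only: mult_ac)
  then show "(\<lambda>x. cnj (separator q x) * u q' x) \<in> Ann F"
    using Ann_mult_right[OF coord_power_cutoff_Ann(2)[OF q'] smooth_fun_cnj[OF r]] by simp
qed

text \<open>Otherwise \<open>u q\<close> times the squared modulus of the separator would annihilate
  \<open>F\<close>. The separator is bounded away from zero on the support of \<open>u q\<close>, so
  it could be divided out and \<open>q\<close> would not be active.\<close>

lemma separator_detects: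
  assumes q: "q \<in> active"
  shows "\<exists>\<alpha> \<beta>. F (\<lambda>x. u q x * separator q x * cnj (separator q x) * monom \<alpha> \<beta> x) \<noteq> 0"
proof (rule ccontr)
  let ?e = "separator q"
  have qg: "q \<in> grid" using q by (simp add: active_def)
  have E: "smooth_fun (\<lambda>x. ?e x * cnj (?e x))"
    by (intro smooth_fun_mult smooth_fun_cnj smooth_fun_separator)
  assume "\<not> ?thesis"
  then have ann: "(\<lambda>x. u q x * (?e x * cnj (?e x))) \<in> Ann F"
    by (intro Ann_monomI[OF F smooth_fun_mult[OF u E]]) (simp add: mult.assoc)
  define c where "c = (\<Prod>q'\<in>active - {q}. (2 * \<rho>) ^ n)"
  have c: "c > 0" unfolding c_def using \<rho> by (intro prod_pos) auto
  have low: "c \<le> norm (?e x)" if x: "u q x \<noteq> 0" for x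
    unfolding c_def separator_def prod_norm[symmetric] norm_power
  proof (rule prod_mono, intro conjI power_mono)
    fix q' assume q': "q' \<in> active - {q}"
    then have "q' $ sep_index q q' \<in> S" "q' $ sep_index q q' \<noteq> q $ sep_index q q'"
      using sep_index[of q q'] by (auto simp: active_def grid_def)
    then show "2 * \<rho> \<le> norm (x $ sep_index q q' - q' $ sep_index q q')"
      by (rule cutoff_coord_lower[OF qg x])
  qed (use \<rho> in auto)
  have "(\<lambda>x. u q x * u q x) \<in> Ann F"
  proof (rule Ann_divide[OF ann E u])
    show "(c * c)\<^sup>2 > 0" using c by simp
    show "(c * c)\<^sup>2 \<le> (norm (?e x * cnj (?e x)))\<^sup>2" if "u q x \<noteq> 0" for x
      using low[OF that] c unfolding norm_mult complex_mod_cnj by (intro power_mono mult_mono) auto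
  qed
  from Ann_D[OF this] have 0: "F (\<lambda>x. u q x * (u q x * f x)) = 0" if "smooth_fun f" for f
    using that by (simp add: mult.assoc)
  have "F (\<lambda>x. u q x * f x) = 0" if f: "smooth_fun f" for f
    using cutoff_local[OF qg f smooth_fun_mult[OF u[of q] f] \<rho>] 0[OF f] u1[of _ q] by simp
  then have "u q \<in> Ann F" using u by (simp add: Ann_def)
  then show False using q by (simp add: active_def)
qed

text \<open>The separators turn the pairing of holomorphic with antiholomorphic polynomials into a diagonal
  matrix indexed by the support, with nonzero diagonal; it factors through a space of dimension \<open>m\<close>.\<close>
lemma card_active_le:
  fixes f G :: "nat \<Rightarrow> complex^'d \<Rightarrow> complex"
  assumes fac: "\<And>h g. h \<in> hol_polys \<Longrightarrow> g \<in> antihol_polys \<Longrightarrow>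
      F (\<lambda>x. h x * g x) = (\<Sum>k<m. F (\<lambda>x. h x * G k x) * F (\<lambda>x. f k x * g x))"
  shows "card active \<le> m"
proof (rule ccontr)
  assume "\<not> card active \<le> m"
  obtain \<alpha> \<beta> where ab: "\<And>q. q \<in> active \<Longrightarrow>
      F (\<lambda>x. u q x * separator q x * cnj (separator q x) * monom (\<alpha> q) (\<beta> q) x) \<noteq> 0"
    using separator_detects by metis
  define h where "h q x = monom (\<alpha> q) (\<lambda>_. 0) x * separator q x" for q x
  define g where "g q x = monom (\<lambda>_. 0) (\<beta> q) x * cnj (separator q x)" for q x
  have h: "h q \<in> hol_polys" for q
    unfolding h_def[abs_def] separator_def by (rule hol_polys_prod_factor, rule fspan_base) simp
  have g: "g q \<in> antihol_polys" for q
    unfolding g_def[abs_def] separator_def by (rule antihol_polys_prod_factor, rule fspan_base) simp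
  have sm: "smooth_fun (\<lambda>x. h q x * g q' x)" for q q'
    by (rule smooth_fun_mult[OF hol_polys_smooth[OF h] antihol_polys_smooth[OF g]])
  have off1: "F (\<lambda>x. u p x * (h q x * g q' x)) = 0" if "p \<in> active" "p \<noteq> q" for p q q'
  proof -
    have "(\<lambda>x. u p x * (h q x * g q' x)) = (\<lambda>x. separator q x * u p x * (monom (\<alpha> q) (\<lambda>_. 0) x * g q' x))"
      by (simp only: h_def mult_ac)
    moreover have "smooth_fun (\<lambda>x. monom (\<alpha> q) (\<lambda>_. 0) x * g q' x)"
      by (rule smooth_fun_mult[OF smooth_fun_monom antihol_polys_smooth[OF g]])
    ultimately show ?thesis using Ann_D[OF separator_Ann(1)[OF that]] by simp
  qed
  have off2: "F (\<lambda>x. u p x * (h q x * g q' x)) = 0" if "p \<in> active" "p \<noteq> q'" for p q q'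
  proof -
    have "(\<lambda>x. u p x * (h q x * g q' x)) = (\<lambda>x. cnj (separator q' x) * u p x * (monom (\<lambda>_. 0) (\<beta> q') x * h q x))"
      by (simp only: g_def mult_ac)
    moreover have "smooth_fun (\<lambda>x. monom (\<lambda>_. 0) (\<beta> q') x * h q x)"
      by (rule smooth_fun_mult[OF smooth_fun_monom hol_polys_smooth[OF h]])
    ultimately show ?thesis using Ann_D[OF separator_Ann(2)[OF that]] by simp
  qed
  \<comment> \<open>For \<open>q \<noteq> q'\<close> every \<open>p\<close> differs from at least
    one of them, so one of the two separators kills its term.\<close>
  have off: "F (\<lambda>x. h q x * g q' x) = 0" if "q \<noteq> q'" for q q'
    unfolding distr_eq_sum_active[OF sm] using off1 off2 that by (intro sum.neutral) metis
  have diag: "F (\<lambda>x. h q x * g q x) \<noteq> 0" if q: "q \<in> active" for q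
  proof -
    have "F (\<lambda>x. h q x * g q x) = (\<Sum>p\<in>{q}. F (\<lambda>x. u p x * (h q x * g q x)))"
      unfolding distr_eq_sum_active[OF sm]
      by (rule sum.mono_neutral_right[OF finite_active]) (use q off1 in auto)
    also have "\<dots> = F (\<lambda>x. u q x * separator q x * cnj (separator q x) * monom (\<alpha> q) (\<beta> q) x)"
      unfolding monom_split[of "\<alpha> q" _ "\<beta> q", symmetric] by (simp add: h_def g_def mult_ac)
    finally show ?thesis using ab[OF q] by simp
  qed
  \<comment> \<open>Some nontrivial combination of the \<open>h q\<close> pairs to zero with all
    \<open>G k\<close>. By the factorization it pairs to zero with every \<open>g q'\<close>,
    contradicting the nonzero diagonal.\<close>
  have "card {..<m} < card active" using \<open>\<not> card active \<le> m\<close> by simp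
  then obtain c where c: "\<exists>q\<in>active. c q \<noteq> 0" "\<forall>k\<in>{..<m}. (\<Sum>q\<in>active. c q * F (\<lambda>x. h q x * G k x)) = 0"
    using homogeneous_system_solvable[OF finite_lessThan finite_active, of m "\<lambda>k q. F (\<lambda>x. h q x * G k x)"] by blast
  have "c q' = 0" if q': "q' \<in> active" for q'
  proof -
    have "(\<Sum>q\<in>active. c q * F (\<lambda>x. h q x * g q' x)) =
        (\<Sum>q\<in>active. \<Sum>k<m. c q * F (\<lambda>x. h q x * G k x) * F (\<lambda>x. f k x * g q' x))"
      unfolding fac[OF h g] sum_distrib_left by (simp only: mult.assoc)
    also have "\<dots> = (\<Sum>k<m. (\<Sum>q\<in>active. c q * F (\<lambda>x. h q x * G k x)) * F (\<lambda>x. f k x * g q' x))"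
      unfolding sum_distrib_right by (rule sum.swap)
    also have "\<dots> = 0" using c(2) by simp
    finally have "(\<Sum>q\<in>active. c q * F (\<lambda>x. h q x * g q' x)) = 0" .
    moreover have "(\<Sum>q\<in>active. c q * F (\<lambda>x. h q x * g q' x)) = (\<Sum>q\<in>{q'}. c q * F (\<lambda>x. h q x * g q' x))"
      by (rule sum.mono_neutral_right[OF finite_active]) (use q' off in auto)
    ultimately show ?thesis using diag[OF q'] by simp
  qed
  then show False using c(1) by blast
qed

end

theorem theorem4p1:
  fixes F :: "(complex^'d::finite \<Rightarrow> complex) \<Rightarrow> complex" and m :: nat
  assumes "comp_distr F"
    and "has_rank (\<lambda>\<alpha> \<beta>. F (monom \<alpha> \<beta>)) m"
  shows "finite (dsupp F) \<and> card (dsupp F) \<le> m \<and>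
         (\<exists>L N. \<forall>\<phi>. smooth_fun \<phi> \<longrightarrow>
            F \<phi> = (\<Sum>q\<in>dsupp F. \<Sum>vs\<in>dirs N. L q vs * dderiv vs \<phi> q))"
proof -
  obtain S n where S: "finite S" "\<And>i. (\<lambda>x. (\<Prod>s\<in>S. x $ i - s) ^ n) \<in> Ann F"
    "\<And>i. (\<lambda>x. cnj ((\<Prod>s\<in>S. x $ i - s) ^ n)) \<in> Ann F"
    by (rule finite_rank_annihilators[OF assms]) blast
  \<comment> \<open>The element 1 keeps \<open>D\<close> nonempty when \<open>S\<close> has at most
    one point.\<close>
  define D where "D = insert 1 ((\<lambda>(s, s'). dist s s') ` {(s, s') \<in> S \<times> S. s \<noteq> s'})"
  have finD: "finite D" unfolding D_def
    using finite_subset[OF _ finite_cartesian_product[OF S(1) S(1)], of "{(s, s') \<in> S \<times> S. s \<noteq> s'}"] by auto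
  define \<rho> where "\<rho> = Min D / 4"
  have "Min D > 0" using finD by (subst Min_gr_iff) (auto simp: D_def)
  then have \<rho>: "\<rho> > 0" by (simp add: \<rho>_def)
  have sep: "4 * \<rho> \<le> dist s s'" if "s \<in> S" "s' \<in> S" "s \<noteq> s'" for s s'
    unfolding \<rho>_def using Min_le[OF finD, of "dist s s'"] that by (force simp: D_def)
  have "\<exists>v. smooth_fun v \<and> (\<forall>x. dist x q \<le> \<rho> \<longrightarrow> v x = 1) \<and> (\<forall>x. dist x q \<ge> 2 * \<rho> \<longrightarrow> v x = 0)"
    for q :: "complex^'d"
    by (rule bump_exists[OF \<rho>, of q]) blast
  then obtain u where u: "\<And>q :: complex^'d. smooth_fun (u q)" "\<And>q x. dist x q \<le> \<rho> \<Longrightarrow> u q x = 1"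
    "\<And>q x. dist x q \<ge> 2 * \<rho> \<Longrightarrow> u q x = 0" by metis
  interpret root_cutoffs F S n \<rho> u
    by unfold_locales (fact assms(1) S \<rho> sep u)+
  obtain f G where "\<And>h g. h \<in> hol_polys \<Longrightarrow> g \<in> antihol_polys \<Longrightarrow>
      F (\<lambda>x. h x * g x) = (\<Sum>k<m. F (\<lambda>x. h x * G k x) * F (\<lambda>x. f k x * g x))"
    by (rule has_rank_factorization[OF assms]) blast
  then have "card active \<le> m" by (rule card_active_le)
  then show ?thesis
    unfolding dsupp_eq_active using finite_active distr_eq_sum_jets by blast
qed

end
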